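(* Let $f = u + \iota v$ be a hyperholomorphic function and let $K$ be any smooth, simple closed hypersurface in the quaternionic space $\mathbf{H}\cong\mathbb{R}^4$, disjoint from the real axis, with $K^{*}$ the interior of $K$ (and $f$ defined on an open set containing $K\cup K^{*}$). For $p\in K$ let $n(p)=n_{0}+n_{1}i+n_{2}j+n_{3}k$, where $(n_{0},n_{1},n_{2},n_{3})$ is the unit outer normal to $K$ at $p$. Then $$\int_{K} n(p)\, f(p)\,\frac{1}{r^2}\,dS_{K} = -2 \int_{K^{*}} u\, \frac{\iota}{r^3}\, dV,$$ where $dS_{K}$ is the element of surface area on $K$ and $dV$ is the volume element on $\mathbb{R}^4$.
   Context: $\mathbf{H}$ is the algebra of quaternions; a quaternion is written $p = t + xi + yj + zk$ with $t,x,y,z\in\mathbb{R}$, and $\mathbf{H}$ is identified with $\mathbb{R}^4$ via $(t,x,y,z)$. The real axis is $\{x=y=z=0\}$. Off the real axis put $$r := \sqrt{x^2+y^2+z^2},\qquad \iota := \frac{xi+yj+zk}{\sqrt{x^2+y^2+z^2}},$$ so $p = t + r\iota$ and $\iota^2=-1$. A quaternion-valued function $f$ of a quaternionic variable is complex-like if $f = u + \iota v$ with $u,v$ real-valued functions of $p$ (they may depend on all four coordinates $t,x,y,z$). The left-Fueter operator is $$D_{l} f := \frac{\partial f}{\partial t} + i\frac{\partial f}{\partial x} + j\frac{\partial f}{\partial y} + k\frac{\partial f}{\partial z},$$ with the units multiplying from the left. A (differentiable) complex-like function $f=u+\iota v$ is called hyperholomorphic if $D_{l} f = \dfrac{-2v}{r}$.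 The interior of $K$ is the bounded component of its complement. Integrals of quaternion-valued functions are taken componentwise, and $n(p)f(p)$ is the quaternion product. *)

theory Defs
  imports "HOL-Analysis.Analysis"
begin

section \<open>Quaternions as points of four-dimensional Euclidean space\<close>

text \<open>The coordinates $(t,x,y,z)$ of a quaternion are the components 1, 2, 3, 4 of a vector.
  The type already carries a componentwise product written with the ordinary multiplication sign;
  the quaternion product is the operation \<open>\<odot>\<close> below.\<close>

type_synonym quat = "real^4"

definition quat :: "real \<Rightarrow> real \<Rightarrow> real \<Rightarrow> real \<Rightarrow> quat" where
  "quat t x y z = vector [t, x, y, z]"

abbreviation qone :: quat where "qone \<equiv> axis 1 1"
abbreviation qi :: quat where "qi \<equiv> axis 2 1"
abbreviation qj :: quat where "qj \<equiv> axis 3 1"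
abbreviation qk :: quat where "qk \<equiv> axis 4 1"

definition qmult :: "quat \<Rightarrow> quat \<Rightarrow> quat" (infixl \<open>\<odot>\<close> 70) where
  "p \<odot> q = quat
     (p$1 * q$1 - p$2 * q$2 - p$3 * q$3 - p$4 * q$4)
     (p$1 * q$2 + p$2 * q$1 + p$3 * q$4 - p$4 * q$3)
     (p$1 * q$3 - p$2 * q$4 + p$3 * q$1 + p$4 * q$2)
     (p$1 * q$4 + p$2 * q$3 - p$3 * q$2 + p$4 * q$1)"

definition real_axis :: "quat set" where
  "real_axis = {p. p$2 = 0 \<and> p$3 = 0 \<and> p$4 = 0}"

definition qr :: "quat \<Rightarrow> real" where
  "qr p = sqrt ((p$2)\<^sup>2 + (p$3)\<^sup>2 + (p$4)\<^sup>2)"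

definition iota :: "quat \<Rightarrow> quat" where
  "iota p = (1 / qr p) *\<^sub>R (p$2 *\<^sub>R qi + p$3 *\<^sub>R qj + p$4 *\<^sub>R qk)"

lemma quat_nth [simp]:
  "quat t x y z $ 1 = t" "quat t x y z $ 2 = x" "quat t x y z $ 3 = y" "quat t x y z $ 4 = z"
  by (simp_all add: quat_def vector_def)

lemma quat_eq_iff: "(p::quat) = q \<longleftrightarrow> p$1 = q$1 \<and> p$2 = q$2 \<and> p$3 = q$3 \<and> p$4 = q$4"
  by (simp add: vec_eq_iff forall_4)

lemma qmult_units:
  "qi \<odot> qi = - qone" "qj \<odot> qj = - qone" "qk \<odot> qk = - qone"
  "qi \<odot> qj = qk" "qj \<odot> qk = qi" "qk \<odot> qi = qj"
  "qj \<odot> qi = - qk" "qk \<odot> qj = - qi" "qi \<odot> qk = - qj"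
  by (simp_all add: quat_eq_iff qmult_def axis_def)

lemma qmult_one: "qone \<odot> p = p" "p \<odot> qone = p"
  by (simp_all add: quat_eq_iff qmult_def axis_def)

lemma qmult_assoc: "(p \<odot> q) \<odot> s = p \<odot> (q \<odot> s)"
  by (simp add: quat_eq_iff qmult_def algebra_simps)

lemma bilinear_qmult: "bilinear qmult"
  by (auto simp: bilinear_def linear_iff quat_eq_iff qmult_def algebra_simps)

lemma qr_pos: "p \<notin> real_axis \<Longrightarrow> qr p > 0"
  unfolding qr_def real_axis_def
  by (auto simp: add_pos_nonneg add_nonneg_pos)

lemma quat_polar: "p \<notin> real_axis \<Longrightarrow> p = p$1 *\<^sub>R qone + qr p *\<^sub>R iota p"
  using qr_pos[of p] by (simp add: iota_def quat_eq_iff axis_def)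

lemma iota_iota:
  assumes "p \<notin> real_axis" shows "iota p \<odot> iota p = - qone"
proof -
  have sq: "(qr p)\<^sup>2 = (p$2)\<^sup>2 + (p$3)\<^sup>2 + (p$4)\<^sup>2"
    by (simp add: qr_def)
  have "((p$2)\<^sup>2 + (p$3)\<^sup>2 + (p$4)\<^sup>2) / (qr p)\<^sup>2 = 1"
    unfolding sq[symmetric] using qr_pos[OF assms] by simp
  then show ?thesis
    by (simp add: iota_def quat_eq_iff qmult_def axis_def power2_eq_square add_divide_distrib)
qed


section \<open>Hyperholomorphic functions\<close>

definition partial_deriv :: "(quat \<Rightarrow> quat) \<Rightarrow> quat \<Rightarrow> quat \<Rightarrow> quat" where
  "partial_deriv f e p = vector_derivative (\<lambda>h. f (p + h *\<^sub>R e)) (at 0)"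

definition fueter_left :: "(quat \<Rightarrow> quat) \<Rightarrow> quat \<Rightarrow> quat" where
  "fueter_left f p =
     partial_deriv f qone p + qi \<odot> partial_deriv f qi p
       + qj \<odot> partial_deriv f qj p + qk \<odot> partial_deriv f qk p"

text \<open>The real-valued parts \<open>u\<close>, \<open>v\<close> are determined by \<open>f\<close> off the real axis.  Since \<open>\<iota>\<close> and \<open>1/r\<close>
  make sense only there, nothing is required at real points of \<open>U\<close>.\<close>

definition complex_like_on ::
  "quat set \<Rightarrow> (quat \<Rightarrow> quat) \<Rightarrow> (quat \<Rightarrow> real) \<Rightarrow> (quat \<Rightarrow> real) \<Rightarrow> bool" where
  "complex_like_on U f u v \<longleftrightarrow>
     (\<forall>p \<in> U - real_axis. f p = u p *\<^sub>R qone + v p *\<^sub>R iota p)"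

definition hyperholomorphic_on ::
  "quat set \<Rightarrow> (quat \<Rightarrow> quat) \<Rightarrow> (quat \<Rightarrow> real) \<Rightarrow> (quat \<Rightarrow> real) \<Rightarrow> bool" where
  "hyperholomorphic_on U f u v \<longleftrightarrow>
     complex_like_on U f u v \<and>
     (\<forall>p \<in> U - real_axis. f differentiable (at p) \<and>
        fueter_left f p = (- 2 * v p / qr p) *\<^sub>R qone)"


section \<open>Smooth closed hypersurfaces\<close>

primrec Ck_on :: "nat \<Rightarrow> 'a::euclidean_space set \<Rightarrow> ('a \<Rightarrow> 'b::real_normed_vector) \<Rightarrow> bool" where
  "Ck_on 0 V f \<longleftrightarrow> continuous_on V f"
| "Ck_on (Suc k) V f \<longleftrightarrow> f differentiable_on V \<and>
     (\<forall>b\<in>Basis. Ck_on k V (\<lambda>x. frechet_derivative f (at x) b))"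

text \<open>Meant for open \<open>V\<close> only.\<close>

definition smooth_on :: "'a::euclidean_space set \<Rightarrow> ('a \<Rightarrow> 'b::real_normed_vector) \<Rightarrow> bool" where
  "smooth_on V f \<longleftrightarrow> (\<forall>k. Ck_on k V f)"

text \<open>Local regular parametrizations of a set \<open>K\<close>: smooth immersions of an open set \<open>V\<close> that are
  homeomorphisms onto a relatively open subset of \<open>K\<close>.\<close>

definition patches :: "quat set \<Rightarrow> ((real^3) set \<times> (real^3 \<Rightarrow> quat)) set" where
  "patches K = {(V, \<phi>).
     open V \<and> smooth_on V \<phi> \<and>
     (\<forall>y\<in>V. inj (frechet_derivative \<phi> (at y))) \<and>
     (\<exists>\<psi>. homeomorphism V (\<phi> ` V) \<phi> \<psi>) \<and>
     openin (top_of_set K) (\<phi> ` V)}"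

text \<open>Compact connected embedded hypersurfaces without boundary; that \<open>K\<close> does not
  intersect itself is contained in the last two conditions on patches.\<close>

definition smooth_closed_hypersurface :: "quat set \<Rightarrow> bool" where
  "smooth_closed_hypersurface K \<longleftrightarrow>
     K \<noteq> {} \<and> compact K \<and> connected K \<and>
     (\<forall>p\<in>K. \<exists>(V, \<phi>)\<in>patches K. p \<in> \<phi> ` V)"

text \<open>\<open>n\<close> is orthogonal to the tangent space of \<open>K\<close> at \<open>p\<close> and points out of the region \<open>C\<close>.\<close>

definition unit_outer_normal :: "quat set \<Rightarrow> quat set \<Rightarrow> quat \<Rightarrow> quat \<Rightarrow> bool" where
  "unit_outer_normal K C p n \<longleftrightarrow>
     norm n = 1 \<and>
     (\<forall>(V, \<phi>)\<in>patches K. \<forall>y\<in>V. \<phi> y = p \<longrightarrow>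
        (\<forall>w. n \<bullet> frechet_derivative \<phi> (at y) w = 0)) \<and>
     (\<forall>\<^sub>F s in at_right 0. p - s *\<^sub>R n \<in> C \<and> p + s *\<^sub>R n \<notin> C)"


section \<open>Surface area\<close>

definition area_density :: "(real^3 \<Rightarrow> quat) \<Rightarrow> real^3 \<Rightarrow> real" where
  "area_density \<phi> y =
     (let J = matrix (frechet_derivative \<phi> (at y)) in sqrt (det (transpose J ** J)))"

definition patch_area :: "(real^3) set \<Rightarrow> (real^3 \<Rightarrow> quat) \<Rightarrow> quat measure" where
  "patch_area V \<phi> =
     distr (density (restrict_space lborel V) (\<lambda>y. ennreal (area_density \<phi> y))) borel \<phi>"

text \<open>The patch areas agree on overlaps of patches, so their supremum in the lattice of measures
  is the measure that restricts to \<open>patch_area V \<phi>\<close> on every \<open>\<phi> ` V\<close>, and is null off \<open>K\<close>.\<close>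

definition surface_measure :: "quat set \<Rightarrow> quat measure" where
  "surface_measure K = (SUP (V, \<phi>)\<in>patches K. patch_area V \<phi>)"

lemma sets_surface_measure:
  assumes "smooth_closed_hypersurface K"
  shows "sets (surface_measure K) = sets borel"
proof -
  have "patches K \<noteq> {}"
    using assms by (auto simp: smooth_closed_hypersurface_def)
  then show ?thesis
    unfolding surface_measure_def
    by (subst sets_SUP[where N = borel]) (auto simp: patch_area_def)
qed

end

theory Submission
  imports Defs
begin

text \<open>Away from the real axis put \<open>g = f / r\<^sup>2\<close>.  The equation for \<open>f\<close> turns into
  \<open>D\<^sub>l g = -2 u \<iota> / r\<^sup>3\<close>, so the claim is the divergence theorem for the four vector
  fields whose flux densities are the components of \<open>n g\<close>.  These fields are differentiable
  and have continuous divergence, but need not be continuously differentiable.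

  A Goursat bisection argument shows that the divergence of a compactly supported field of this kind
  has integral zero.  Near a point \<open>p\<close> of \<open>K\<close>, translating a patch of \<open>K\<close> along the fixed
  vector \<open>n p\<close> gives coordinates in which the interior is the region of negative height.
  Applying the vanishing result to the field times a cutoff of width \<open>\<delta>\<close> in the height and
  letting \<open>\<delta>\<close> tend to zero gives the divergence theorem for fields supported near \<open>p\<close>;
  bump functions and compactness globalize it.\<close>

section \<open>Goursat's argument for the divergence\<close>

text \<open>The obstacle is regularity: \<open>f\<close> is differentiable but its partial
  derivatives may be discontinuous, so the divergence theorem for C^1 fields does not apply to the
  flux fields. What survives is continuity of the divergence: it is a component of
  \<open>-2 u \<iota> / r^3\<close>, and \<open>u\<close> is the real part of the continuous
  function \<open>f\<close>. Differentiable fields with continuous divergence form a class stable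
  under multiplication by a C^1 function \<open>h\<close>, because
  \<open>div (h F) = h div F + grad h \<bullet> F\<close> contains no single partial derivative of
  \<open>F\<close>. Cutoffs and bumps therefore stay inside the class as soon as they have
  continuous gradients. For the cutoff in the height this asks for a continuous gradient of the
  height, which the inverse function theorem delivers for a patch thickened in a fixed direction.
  The bisection is the place where pointwise differentiability is exploited: it compares the flux
  through a small cube with that of the affine approximation at a single point.\<close>

lemma differentiable_at_imp_continuous_on:
  assumes "\<And>x. x \<in> S \<Longrightarrow> f differentiable (at x)"
  shows "continuous_on S f"
proof (rule differentiable_imp_continuous_on)
  show "f differentiable_on S"
    unfolding differentiable_on_def using assms by (blast intro: differentiable_at_withinI)
qed

definition set_coord :: "'a::euclidean_space \<Rightarrow> 'a \<Rightarrow> real \<Rightarrow> 'a" where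
  "set_coord i y c = y + (c - y \<bullet> i) *\<^sub>R i"

text \<open>The flux through the two faces of \<open>cbox a b\<close> orthogonal to \<open>i\<close>.  Integrating over
  the whole box a function that does not depend on the \<open>i\<close>-coordinate, and dividing by the side
  length, avoids integrals over faces.\<close>

definition box_flux :: "('a::euclidean_space \<Rightarrow> 'a) \<Rightarrow> 'a \<Rightarrow> 'a \<Rightarrow> 'a \<Rightarrow> real" where
  "box_flux H a b i =
     integral (cbox a b) (\<lambda>y. (H (set_coord i y (b \<bullet> i)) - H (set_coord i y (a \<bullet> i))) \<bullet> i) / (b \<bullet> i - a \<bullet> i)"

definition divergence :: "('a::euclidean_space \<Rightarrow> 'a) \<Rightarrow> 'a \<Rightarrow> real" where
  "divergence H x = (\<Sum>i\<in>Basis. frechet_derivative H (at x) i \<bullet> i)"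

text \<open>The quantity that is bisected: it is additive when a box is cut in two, and its
  vanishing is the divergence theorem on the box.\<close>

definition flux_defect :: "('a::euclidean_space \<Rightarrow> 'a) \<Rightarrow> 'a \<Rightarrow> 'a \<Rightarrow> real" where
  "flux_defect H a b = (\<Sum>i\<in>Basis. box_flux H a b i) - integral (cbox a b) (divergence H)"

lemma continuous_on_set_coord [continuous_intros]:
  "continuous_on S f \<Longrightarrow> continuous_on S (\<lambda>y. set_coord i (f y) c)"
  unfolding set_coord_def by (intro continuous_intros)

section \<open>Cutting a box in half\<close>

context
  fixes a b j d :: "'a::euclidean_space"
  assumes j: "j \<in> Basis" and d: "d = ((b \<bullet> j - a \<bullet> j) / 2) *\<^sub>R j"
    and ab: "\<And>i. i \<in> Basis \<Longrightarrow> a \<bullet> i < b \<bullet> i"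
begin

lemma inner_halving: "i \<in> Basis \<Longrightarrow> d \<bullet> i = (if i = j then (b \<bullet> j - a \<bullet> j) / 2 else 0)"
  using j by (auto simp: d inner_Basis)

lemma cbox_lower_half: "cbox a b \<inter> {x. x \<bullet> j \<le> (a \<bullet> j + b \<bullet> j) / 2} = cbox a (b - d)"
proof (intro set_eqI iffI)
  fix x assume x: "x \<in> cbox a b \<inter> {x. x \<bullet> j \<le> (a \<bullet> j + b \<bullet> j) / 2}"
  show "x \<in> cbox a (b - d)"
    unfolding mem_box
  proof (intro ballI)
    fix i :: 'a assume i: "i \<in> Basis"
    show "a \<bullet> i \<le> x \<bullet> i \<and> x \<bullet> i \<le> (b - d) \<bullet> i"
      using x i by (cases "i = j") (auto simp: mem_box inner_halving inner_diff_left field_simps)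
  qed
next
  fix x assume x: "x \<in> cbox a (b - d)"
  have "a \<bullet> i \<le> x \<bullet> i \<and> x \<bullet> i \<le> b \<bullet> i - (if i = j then (b \<bullet> j - a \<bullet> j) / 2 else 0)" if "i \<in> Basis" for i
    using x that unfolding mem_box by (auto simp: inner_halving inner_diff_left)
  note bounds = this
  have "a \<bullet> i \<le> x \<bullet> i \<and> x \<bullet> i \<le> b \<bullet> i" if "i \<in> Basis" for i
    using bounds[OF that] ab[OF j] by (auto split: if_splits simp: field_simps)
  then show "x \<in> cbox a b \<inter> {x. x \<bullet> j \<le> (a \<bullet> j + b \<bullet> j) / 2}"
    using bounds[OF j] by (auto simp: mem_box field_simps)
qed

lemma cbox_upper_half: "cbox a b \<inter> {x. x \<bullet> j \<ge> (a \<bullet> j + b \<bullet> j) / 2} = cbox (a + d) b"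
proof (intro set_eqI iffI)
  fix x assume x: "x \<in> cbox a b \<inter> {x. x \<bullet> j \<ge> (a \<bullet> j + b \<bullet> j) / 2}"
  show "x \<in> cbox (a + d) b"
    unfolding mem_box
  proof (intro ballI)
    fix i :: 'a assume i: "i \<in> Basis"
    show "(a + d) \<bullet> i \<le> x \<bullet> i \<and> x \<bullet> i \<le> b \<bullet> i"
      using x i by (cases "i = j") (auto simp: mem_box inner_halving inner_add_left field_simps)
  qed
next
  fix x assume x: "x \<in> cbox (a + d) b"
  have "a \<bullet> i + (if i = j then (b \<bullet> j - a \<bullet> j) / 2 else 0) \<le> x \<bullet> i \<and> x \<bullet> i \<le> b \<bullet> i" if "i \<in> Basis" for i
    using x that unfolding mem_box by (auto simp: inner_halving inner_add_left)
  note bounds = this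
  have "a \<bullet> i \<le> x \<bullet> i \<and> x \<bullet> i \<le> b \<bullet> i" if "i \<in> Basis" for i
    using bounds[OF that] ab[OF j] by (auto split: if_splits simp: field_simps)
  then show "x \<in> cbox a b \<inter> {x. x \<bullet> j \<ge> (a \<bullet> j + b \<bullet> j) / 2}"
    using bounds[OF j] by (auto simp: mem_box field_simps)
qed

lemma integral_halves:
  fixes g :: "'a \<Rightarrow> real"
  assumes "continuous_on UNIV g"
  shows "integral (cbox a b) g = integral (cbox a (b - d)) g + integral (cbox (a + d) b) g"
  using integral_split[OF integrable_continuous[OF continuous_on_subset[OF assms subset_UNIV]] j,
      of a b "(a \<bullet> j + b \<bullet> j) / 2"]
  by (simp only: cbox_lower_half cbox_upper_half)

text \<open>The two halves are translates of each other by \<open>d\<close>, a multiple of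
  \<open>j\<close>, so an integrand that is constant along \<open>j\<close> has the same integral
  over both.\<close>

lemma integral_half_invariant:
  fixes g :: "'a \<Rightarrow> real"
  assumes g: "continuous_on UNIV g" and inv: "\<And>y t. g (y + t *\<^sub>R j) = g y"
  shows "integral (cbox a (b - d)) g = integral (cbox a b) g / 2"
    and "integral (cbox (a + d) b) g = integral (cbox a b) g / 2"
proof -
  have "integral (cbox (a + d) ((b - d) + d)) g = integral (cbox a (b - d)) (g \<circ> (+) d)"
    by (rule integral_shift_cbox_plus[symmetric])
  also have "g \<circ> (+) d = g"
    by (simp add: d inv fun_eq_iff add.commute[of _ "_ :: 'a"])
  finally have "integral (cbox (a + d) b) g = integral (cbox a (b - d)) g"
    by simp
  with integral_halves[OF g]
  show "integral (cbox a (b - d)) g = integral (cbox a b) g / 2"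
    and "integral (cbox (a + d) b) g = integral (cbox a b) g / 2"
    by simp_all
qed

text \<open>For \<open>i \<noteq> j\<close> the faces themselves are cut and the integral splits.
  For \<open>i = j\<close> a middle face is inserted whose flux cancels; each integral is halved
  with the box, which the halved side length in the denominator compensates.\<close>

lemma box_flux_halves:
  assumes H: "continuous_on UNIV H" and i: "i \<in> Basis"
  shows "box_flux H a b i = box_flux H a (b - d) i + box_flux H (a + d) b i"
proof (cases "i = j")
  case False
  then have "d \<bullet> i = 0"
    using i by (simp add: inner_halving)
  moreover have "continuous_on UNIV (\<lambda>y. (H (set_coord i y (b \<bullet> i)) - H (set_coord i y (a \<bullet> i))) \<bullet> i)"
    by (intro continuous_intros continuous_on_compose2[OF H]) auto
  ultimately show ?thesis
    unfolding box_flux_def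
    by (subst integral_halves) (auto simp: inner_add_left inner_diff_left add_divide_distrib)
next
  case True
  define m where "m = (a \<bullet> j + b \<bullet> j) / 2"
  define g where "g = (\<lambda>s t y. (H (set_coord j y s) - H (set_coord j y t)) \<bullet> j)"
  have g: "continuous_on UNIV (g s t)" for s t
    unfolding g_def by (intro continuous_intros continuous_on_compose2[OF H]) auto
  have inv: "g s t (y + r *\<^sub>R j) = g s t y" for s t y r
    using j by (simp add: g_def set_coord_def inner_add_left inner_Basis algebra_simps)
  have ends: "(b - d) \<bullet> j = m" "(a + d) \<bullet> j = m"
    using inner_halving[OF j] by (auto simp: m_def inner_diff_left inner_add_left field_simps)
  have pos: "b \<bullet> j - a \<bullet> j > 0"
    using ab[OF j] by simp
  have mid: "m - a \<bullet> j = (b \<bullet> j - a \<bullet> j) / 2" "b \<bullet> j - m = (b \<bullet> j - a \<bullet> j) / 2"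
    by (auto simp: m_def field_simps)
  have "g (b \<bullet> j) (a \<bullet> j) = (\<lambda>y. g m (a \<bullet> j) y + g (b \<bullet> j) m y)"
    by (auto simp: g_def inner_diff_left)
  then have "integral (cbox a b) (g (b \<bullet> j) (a \<bullet> j)) =
      integral (cbox a b) (g m (a \<bullet> j)) + integral (cbox a b) (g (b \<bullet> j) m)"
    by (simp add: Henstock_Kurzweil_Integration.integral_add integrable_continuous continuous_on_subset[OF g])
  moreover have "box_flux H a (b - d) j = integral (cbox a b) (g m (a \<bullet> j)) / (b \<bullet> j - a \<bullet> j)"
    unfolding box_flux_def ends mid
    using integral_half_invariant(1)[OF g inv, of m "a \<bullet> j"] pos by (simp add: g_def)
  moreover have "box_flux H (a + d) b j = integral (cbox a b) (g (b \<bullet> j) m) / (b \<bullet> j - a \<bullet> j)"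
    unfolding box_flux_def ends mid
    using integral_half_invariant(2)[OF g inv, of "b \<bullet> j" m] pos by (simp add: g_def)
  moreover have "box_flux H a b j = integral (cbox a b) (g (b \<bullet> j) (a \<bullet> j)) / (b \<bullet> j - a \<bullet> j)"
    by (simp add: box_flux_def g_def)
  ultimately show ?thesis
    using True by (simp add: add_divide_distrib)
qed

lemma flux_defect_halves:
  assumes H: "continuous_on UNIV H" "continuous_on UNIV (divergence H)"
  shows "flux_defect H a b = flux_defect H a (b - d) + flux_defect H (a + d) b"
proof -
  have "(\<Sum>i\<in>Basis. box_flux H a b i) = (\<Sum>i\<in>Basis. box_flux H a (b - d) i + box_flux H (a + d) b i)"
    by (intro sum.cong box_flux_halves H) auto
  then show ?thesis
    unfolding flux_defect_def integral_halves[OF H(2)] by (simp add: sum.distrib)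
qed

end

text \<open>Halving the sides one direction at a time, until \<open>S\<close> is all of \<open>Basis\<close>, keeps cubes cubes;
  the local bound below needs bounded eccentricity.\<close>

lemma flux_defect_half_sides:
  fixes a b :: "'a::euclidean_space"
  assumes H: "continuous_on UNIV H" "continuous_on UNIV (divergence H)"
    and ab: "\<And>i. i \<in> Basis \<Longrightarrow> a \<bullet> i < b \<bullet> i"
    and "finite S" "S \<subseteq> Basis"
  shows "\<exists>a' b'. cbox a' b' \<subseteq> cbox a b \<and>
      (\<forall>i\<in>Basis. b' \<bullet> i - a' \<bullet> i = (if i \<in> S then (b \<bullet> i - a \<bullet> i) / 2 else b \<bullet> i - a \<bullet> i)) \<and>
      \<bar>flux_defect H a b\<bar> \<le> 2 ^ card S * \<bar>flux_defect H a' b'\<bar>"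
  using assms(4,5)
proof (induction S rule: finite_induct)
  case empty
  show ?case by (intro exI[of _ a] exI[of _ b]) auto
next
  case (insert j S)
  then obtain a' b' where sub: "cbox a' b' \<subseteq> cbox a b"
    and sides: "\<And>i. i \<in> Basis \<Longrightarrow> b' \<bullet> i - a' \<bullet> i = (if i \<in> S then (b \<bullet> i - a \<bullet> i) / 2 else b \<bullet> i - a \<bullet> i)"
    and le: "\<bar>flux_defect H a b\<bar> \<le> 2 ^ card S * \<bar>flux_defect H a' b'\<bar>"
    by auto
  have j: "j \<in> Basis"
    using insert.prems by simp
  have ab': "a' \<bullet> i < b' \<bullet> i" if "i \<in> Basis" for i
    using sides[OF that] ab[OF that] by (auto split: if_splits)
  define d where "d = ((b' \<bullet> j - a' \<bullet> j) / 2) *\<^sub>R j"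
  have d: "d \<bullet> i = (if i = j then (b' \<bullet> j - a' \<bullet> j) / 2 else 0)" if "i \<in> Basis" for i
    using j that by (auto simp: d_def inner_Basis)
  note halves = cbox_lower_half[OF j d_def ab', symmetric] cbox_upper_half[OF j d_def ab', symmetric]
  have side_j: "b' \<bullet> j - a' \<bullet> j = b \<bullet> j - a \<bullet> j"
    using sides[OF j] insert.hyps by simp
  have sum: "\<bar>flux_defect H a' b'\<bar> \<le> \<bar>flux_defect H a' (b' - d)\<bar> + \<bar>flux_defect H (a' + d) b'\<bar>"
    using flux_defect_halves[OF j d_def ab' H] by linarith
  \<comment> \<open>The half with the larger absolute defect. It carries at least half of the total,
    whence one factor 2 per direction.\<close>
  define c e where "c = (if \<bar>flux_defect H a' (b' - d)\<bar> \<ge> \<bar>flux_defect H (a' + d) b'\<bar> then a' else a' + d)"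
    and "e = (if \<bar>flux_defect H a' (b' - d)\<bar> \<ge> \<bar>flux_defect H (a' + d) b'\<bar> then b' - d else b')"
  have "cbox c e \<subseteq> cbox a' b'"
    using halves by (auto simp: c_def e_def)
  moreover have "e - c = b' - a' - d"
    by (auto simp: c_def e_def algebra_simps)
  then have "e \<bullet> i - c \<bullet> i = b' \<bullet> i - a' \<bullet> i - d \<bullet> i" for i
    by (metis inner_diff_left)
  from this have "e \<bullet> i - c \<bullet> i = (if i \<in> insert j S then (b \<bullet> i - a \<bullet> i) / 2 else b \<bullet> i - a \<bullet> i)"
    if "i \<in> Basis" for i
    using sides[OF that] d[OF that] side_j insert.hyps that
    by (cases "i = j") (auto simp: diff_divide_distrib)
  moreover have "\<bar>flux_defect H a' b'\<bar> \<le> 2 * \<bar>flux_defect H c e\<bar>"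
    using sum by (auto simp: c_def e_def)
  then have "2 ^ card S * \<bar>flux_defect H a' b'\<bar> \<le> 2 ^ card S * (2 * \<bar>flux_defect H c e\<bar>)"
    by (intro mult_left_mono) auto
  then have "\<bar>flux_defect H a b\<bar> \<le> 2 ^ card (insert j S) * \<bar>flux_defect H c e\<bar>"
    using order_trans[OF le] insert.hyps by (simp add: mult_ac)
  ultimately show ?case
    using sub by (intro exI[of _ c] exI[of _ e]) blast
qed

text \<open>For the affine approximation at \<open>x\<close> the flux in direction \<open>i\<close>
  is exactly the volume times \<open>A i \<bullet> i\<close>. The remainder is at most
  \<open>e * (d * s)\<close> at each point of the cube, with \<open>d\<close> the dimension. Two
  opposite faces and division by \<open>s\<close> give \<open>2 * d * e\<close> times the volume per
  direction, hence \<open>2 * d^2\<close> in total; the summand 1 comes from the oscillation of the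
  divergence.\<close>

lemma flux_defect_local_bound:
  fixes H :: "'a::euclidean_space \<Rightarrow> 'a"
  assumes H: "continuous_on UNIV H" "continuous_on UNIV (divergence H)"
    and diff: "H differentiable (at x)" and e: "e > 0"
  shows "\<exists>\<delta>>0. \<forall>a b s. 0 < s \<and> (\<forall>i\<in>Basis. b \<bullet> i - a \<bullet> i = s) \<and> x \<in> cbox a b \<and> real DIM('a) * s < \<delta> \<longrightarrow>
      \<bar>flux_defect H a b\<bar> \<le> (2 * real DIM('a) ^ 2 + 1) * e * s ^ DIM('a)"
proof -
  define A where "A = frechet_derivative H (at x)"
  have A: "(H has_derivative A) (at x)"
    using diff by (simp add: A_def flip: frechet_derivative_works)
  interpret A: bounded_linear A
    using A by (rule has_derivative_bounded_linear)
  obtain \<delta>1 where \<delta>1: "\<delta>1 > 0"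
      "\<And>z. norm (z - x) < \<delta>1 \<Longrightarrow> norm (H z - H x - A (z - x)) \<le> e * norm (z - x)"
    using A e unfolding has_derivative_at_alt by blast
  obtain \<delta>2 where \<delta>2: "\<delta>2 > 0" "\<And>z. dist z x < \<delta>2 \<Longrightarrow> dist (divergence H z) (divergence H x) < e"
    using H(2) e unfolding continuous_on_iff by blast
  show ?thesis
  proof (intro exI[of _ "min \<delta>1 \<delta>2"] conjI allI impI)
    fix a b :: 'a and s :: real
    assume *: "0 < s \<and> (\<forall>i\<in>Basis. b \<bullet> i - a \<bullet> i = s) \<and> x \<in> cbox a b \<and> real DIM('a) * s < min \<delta>1 \<delta>2"
    then have s: "s > 0" "\<And>i. i \<in> Basis \<Longrightarrow> b \<bullet> i - a \<bullet> i = s" and x: "x \<in> cbox a b"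
      and small: "real DIM('a) * s < \<delta>1" "real DIM('a) * s < \<delta>2"
      by auto
    define d where "d = real DIM('a)"
    have ab: "a \<bullet> i \<le> b \<bullet> i" if "i \<in> Basis" for i
      using s(2)[OF that] s(1) by linarith
    have content: "measure lborel (cbox a b) = s ^ DIM('a)"
      using ab s by (subst content_cbox) auto
    have near: "norm (z - x) \<le> d * s" if z: "z \<in> cbox a b" for z
    proof -
      have "norm (z - x) \<le> (\<Sum>i\<in>Basis. \<bar>(z - x) \<bullet> i\<bar>)"
        by (rule norm_le_l1)
      also have "\<dots> \<le> (\<Sum>i\<in>(Basis :: 'a set). s)"
      proof (rule sum_mono)
        fix i :: 'a assume i: "i \<in> Basis"
        then show "\<bar>(z - x) \<bullet> i\<bar> \<le> s"
          using z x s(2)[OF i] by (auto simp: mem_box inner_diff_left abs_le_iff) (smt (verit) i)+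
      qed
      finally show ?thesis
        by (simp add: d_def)
    qed
    have rem: "norm (H z - H x - A (z - x)) \<le> e * (d * s)" if "z \<in> cbox a b" for z
    proof -
      have "norm (H z - H x - A (z - x)) \<le> e * norm (z - x)"
        using near[OF that] small by (intro \<delta>1) (simp add: d_def)
      also have "\<dots> \<le> e * (d * s)"
        using near[OF that] e by simp
      finally show ?thesis .
    qed
    have flux: "\<bar>box_flux H a b i - measure lborel (cbox a b) * (A i \<bullet> i)\<bar> \<le> 2 * d * e * measure lborel (cbox a b)"
      if i: "i \<in> Basis" for i
    proof -
      define g where "g = (\<lambda>y. (H (set_coord i y (b \<bullet> i)) - H (set_coord i y (a \<bullet> i))) \<bullet> i)"
      have "continuous_on UNIV g"
        unfolding g_def by (intro continuous_intros continuous_on_compose2[OF H(1)]) auto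
      then have "g integrable_on cbox a b"
        by (meson continuous_on_subset integrable_continuous subset_UNIV)
      then have int: "((\<lambda>y. g y - s * (A i \<bullet> i)) has_integral
          (integral (cbox a b) g - measure lborel (cbox a b) * (s * (A i \<bullet> i)))) (cbox a b)"
        using has_integral_diff[OF integrable_integral has_integral_const[of "s * (A i \<bullet> i)" a b]] by simp
      have bound: "norm (g y - s * (A i \<bullet> i)) \<le> 2 * (e * (d * s))" if y: "y \<in> cbox a b" for y
      proof -
        let ?p = "set_coord i y (b \<bullet> i)" and ?q = "set_coord i y (a \<bullet> i)"
        have mem: "?p \<in> cbox a b" "?q \<in> cbox a b"
          using y i ab by (auto simp: mem_box set_coord_def inner_add_left inner_Basis)
        have "?p - ?q = s *\<^sub>R i"
          using s(2)[OF i] by (simp add: set_coord_def algebra_simps flip: scaleR_diff_left)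
        then have "A (?p - x) - A (?q - x) = s *\<^sub>R A i"
          by (simp flip: A.diff A.scaleR)
        then have "g y - s * (A i \<bullet> i) = ((H ?p - H x - A (?p - x)) - (H ?q - H x - A (?q - x))) \<bullet> i"
          by (simp add: g_def inner_diff_left algebra_simps)
        also have "\<bar>\<dots>\<bar> \<le> norm ((H ?p - H x - A (?p - x)) - (H ?q - H x - A (?q - x)))"
          using i by (rule Basis_le_norm)
        also have "\<dots> \<le> e * (d * s) + e * (d * s)"
          by (rule order_trans[OF norm_triangle_ineq4]) (intro add_mono rem mem)
        finally show ?thesis by (simp add: mult_ac)
      qed
      have "norm (integral (cbox a b) g - measure lborel (cbox a b) * (s * (A i \<bullet> i))) \<le> 2 * (e * (d * s)) * measure lborel (cbox a b)"
        using e s by (intro has_integral_bound[OF _ int bound]) (auto simp: d_def)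
      moreover have "box_flux H a b i - measure lborel (cbox a b) * (A i \<bullet> i) =
          (integral (cbox a b) g - measure lborel (cbox a b) * (s * (A i \<bullet> i))) / s"
        using s(1) s(2)[OF i] by (simp add: box_flux_def g_def diff_divide_distrib)
      ultimately show ?thesis
        using s(1) by (simp only: abs_divide) (simp add: pos_divide_le_eq mult_ac)
    qed
    have "divergence H integrable_on cbox a b"
      by (meson H(2) continuous_on_subset integrable_continuous subset_UNIV)
    then have int: "((\<lambda>y. divergence H y - divergence H x) has_integral
          (integral (cbox a b) (divergence H) - measure lborel (cbox a b) * divergence H x)) (cbox a b)"
      using has_integral_diff[OF integrable_integral has_integral_const[of "divergence H x" a b]] by simp
    have "norm (integral (cbox a b) (divergence H) - measure lborel (cbox a b) * divergence H x) \<le> e * measure lborel (cbox a b)"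
    proof (rule has_integral_bound[OF _ int])
      fix y assume "y \<in> cbox a b"
      then have "dist y x < \<delta>2"
        using near small by (fastforce simp: dist_norm d_def)
      then show "norm (divergence H y - divergence H x) \<le> e"
        using \<delta>2(2) by (fastforce simp: dist_norm)
    qed (use e in simp)
    moreover have "\<bar>(\<Sum>i\<in>Basis. box_flux H a b i) - measure lborel (cbox a b) * divergence H x\<bar> \<le> d * (2 * d * e * measure lborel (cbox a b))"
    proof -
      have "(\<Sum>i\<in>Basis. box_flux H a b i) - measure lborel (cbox a b) * divergence H x =
          (\<Sum>i\<in>Basis. box_flux H a b i - measure lborel (cbox a b) * (A i \<bullet> i))"
        by (simp add: divergence_def A_def sum_subtractf sum_distrib_left)
      also have "\<bar>\<dots>\<bar> \<le> (\<Sum>i\<in>(Basis :: 'a set). 2 * d * e * measure lborel (cbox a b))"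
        by (rule order_trans[OF sum_abs]) (intro sum_mono flux)
      finally show ?thesis by (simp add: d_def)
    qed
    ultimately have "\<bar>flux_defect H a b\<bar> \<le> d * (2 * d * e * measure lborel (cbox a b)) + e * measure lborel (cbox a b)"
      unfolding flux_defect_def by simp
    then show "\<bar>flux_defect H a b\<bar> \<le> (2 * real DIM('a) ^ 2 + 1) * e * s ^ DIM('a)"
      unfolding content d_def by (simp add: algebra_simps power2_eq_square)
  qed (use \<delta>1 \<delta>2 in auto)
qed

text \<open>Goursat's bisection: passing to the worst subcube costs a factor \<open>2 ^ d\<close>,
  exactly the factor by which the volume shrinks. At the common point \<open>x\<close> of the nested
  cubes the local bound is \<open>e\<close> times the volume, so undoing the \<open>n\<close> steps
  leaves \<open>K \<le> C * e\<close> with \<open>C\<close> independent of \<open>n\<close> and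
  \<open>e\<close>.\<close>

theorem flux_defect_cube_eq_0:
  fixes H :: "'a::euclidean_space \<Rightarrow> 'a"
  assumes diff: "\<And>x. H differentiable (at x)" and div: "continuous_on UNIV (divergence H)"
    and s: "s > 0" and ab: "\<And>i. i \<in> Basis \<Longrightarrow> b \<bullet> i - a \<bullet> i = s"
  shows "flux_defect H a b = 0"
proof -
  have H: "continuous_on UNIV H"
    by (rule differentiable_at_imp_continuous_on[OF diff])
  define K where "K = \<bar>flux_defect H a b\<bar>"
  define d where "d = DIM('a)"
  define P where "P = (\<lambda>n (c::'a \<times> 'a). (\<forall>i\<in>Basis. snd c \<bullet> i - fst c \<bullet> i = s / 2 ^ n) \<and>
      K \<le> (2 ^ d) ^ n * \<bar>flux_defect H (fst c) (snd c)\<bar>)"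
  have "\<exists>c. \<forall>n. P n (c n) \<and> cbox (fst (c (Suc n))) (snd (c (Suc n))) \<subseteq> cbox (fst (c n)) (snd (c n))"
  proof (rule dependent_nat_choice)
    show "\<exists>c. P 0 c"
      by (intro exI[of _ "(a, b)"]) (simp add: P_def ab K_def)
    fix c :: "'a \<times> 'a" and n
    assume c: "P n c"
    then have sides: "snd c \<bullet> i - fst c \<bullet> i = s / 2 ^ n" if "i \<in> Basis" for i
      using that by (simp add: P_def)
    have lt: "fst c \<bullet> i < snd c \<bullet> i" if "i \<in> Basis" for i
    proof -
      have "s / 2 ^ n > 0" using s by simp
      then show ?thesis using sides[OF that] by linarith
    qed
    obtain a' b' where sub: "cbox a' b' \<subseteq> cbox (fst c) (snd c)"
      and sides': "\<And>i. i \<in> Basis \<Longrightarrow> b' \<bullet> i - a' \<bullet> i = (snd c \<bullet> i - fst c \<bullet> i) / 2"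
      and le: "\<bar>flux_defect H (fst c) (snd c)\<bar> \<le> 2 ^ d * \<bar>flux_defect H a' b'\<bar>"
      using flux_defect_half_sides[OF H div lt finite_Basis order_refl] unfolding d_def by auto
    have "K \<le> (2 ^ d) ^ n * \<bar>flux_defect H (fst c) (snd c)\<bar>"
      using c by (simp add: P_def)
    also have "\<dots> \<le> (2 ^ d) ^ n * (2 ^ d * \<bar>flux_defect H a' b'\<bar>)"
      using le by (intro mult_left_mono) auto
    finally have "P (Suc n) (a', b')"
      using sides sides' by (simp add: P_def mult_ac)
    then show "\<exists>y. P (Suc n) y \<and> cbox (fst y) (snd y) \<subseteq> cbox (fst c) (snd c)"
      using sub by (intro exI[of _ "(a', b')"]) simp
  qed
  then obtain c where c: "\<And>n. P n (c n)"
    and nested: "\<And>n. cbox (fst (c (Suc n))) (snd (c (Suc n))) \<subseteq> cbox (fst (c n)) (snd (c n))"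
    by blast
  define F where "F = (\<lambda>n. cbox (fst (c n)) (snd (c n)))"
  have sides: "snd (c n) \<bullet> i - fst (c n) \<bullet> i = s / 2 ^ n" if "i \<in> Basis" for n i
    using c[of n] that by (simp add: P_def)
  have "F n \<noteq> {}" for n
  proof -
    have "s / 2 ^ n > 0" using s by simp
    then have "fst (c n) \<bullet> i \<le> snd (c n) \<bullet> i" if "i \<in> Basis" for i
      using sides[OF that, of n] by linarith
    then show ?thesis by (simp add: F_def box_ne_empty)
  qed
  moreover have "F n \<subseteq> F m" if "m \<le> n" for m n
    using nested that unfolding F_def by (rule lift_Suc_antimono_le)
  ultimately have "\<Inter>(range F) \<noteq> {}"
    by (intro compact_nest) (auto simp: F_def)
  then obtain x where x: "\<And>n. x \<in> F n"
    by blast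
  define C where "C = (2 * real d ^ 2 + 1) * s ^ d"
  have "K \<le> C * e" if e: "e > 0" for e
  proof -
    obtain \<delta> where \<delta>: "\<delta> > 0" "\<And>a b s. 0 < s \<Longrightarrow> (\<And>i. i \<in> Basis \<Longrightarrow> b \<bullet> i - a \<bullet> i = s) \<Longrightarrow> x \<in> cbox a b \<Longrightarrow> real d * s < \<delta> \<Longrightarrow>
        \<bar>flux_defect H a b\<bar> \<le> (2 * real d ^ 2 + 1) * e * s ^ d"
      using flux_defect_local_bound[OF H div diff e] unfolding d_def by metis
    have "(\<lambda>n. real d * s * (1 / 2) ^ n) \<longlonglongrightarrow> real d * s * 0"
      by (intro tendsto_mult tendsto_const LIMSEQ_power_zero) auto
    then have "eventually (\<lambda>n. real d * s * (1 / 2) ^ n < \<delta>) sequentially"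
      using \<delta>(1) by (intro order_tendstoD(2)) auto
    then obtain n where n: "real d * s * (1 / 2) ^ n < \<delta>"
      by (meson eventually_sequentially order_refl)
    have "K \<le> (2 ^ d) ^ n * \<bar>flux_defect H (fst (c n)) (snd (c n))\<bar>"
      using c[of n] by (simp add: P_def)
    also have "\<dots> \<le> (2 ^ d) ^ n * ((2 * real d ^ 2 + 1) * e * (s / 2 ^ n) ^ d)"
    proof (intro mult_left_mono \<delta>(2))
      show "x \<in> cbox (fst (c n)) (snd (c n))"
        using x[of n] by (simp add: F_def)
      show "real d * (s / 2 ^ n) < \<delta>"
        using n by (simp add: power_divide)
    qed (use s sides in auto)
    also have "\<dots> = C * e"
      using s by (simp add: C_def power_divide power_mult[symmetric] mult.commute[of d])
    finally show ?thesis .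
  qed
  moreover have "C > 0"
    using s by (simp add: C_def add_nonneg_pos)
  ultimately have "K \<le> e" if "e > 0" for e
    using that \<open>C > 0\<close> by (metis divide_pos_pos nonzero_mult_div_cancel_left order_less_irrefl times_divide_eq_right)
  then have "K \<le> 0"
    by (meson dense_ge)
  then show ?thesis
    by (simp add: K_def)
qed

section \<open>Fields with compact support\<close>

lemma frechet_derivative_eq_0_outside:
  assumes "closed C" "\<And>x. x \<notin> C \<Longrightarrow> H x = 0" "x \<notin> C"
  shows "(H has_derivative (\<lambda>_. 0)) (at x)" "frechet_derivative H (at x) = (\<lambda>_. 0)"
proof -
  have "((\<lambda>_. 0) has_derivative (\<lambda>_. 0)) (at x)"
    by simp
  then show *: "(H has_derivative (\<lambda>_. 0)) (at x)"
    by (rule has_derivative_transform_within_open[of _ _ _ _ "- C"]) (use assms in auto)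
  then show "frechet_derivative H (at x) = (\<lambda>_. 0)"
    by (metis frechet_derivative_at)
qed

text \<open>Enclose the support in a ball of radius \<open>r\<close> and take the cube of side
  \<open>2 * r\<close> around it. Points of its faces have norm at least \<open>r\<close>, so no
  flux passes through them, and the vanishing defect leaves only the volume integral.\<close>

theorem integral_divergence_compact_support:
  fixes H :: "'a::euclidean_space \<Rightarrow> 'a"
  assumes diff: "\<And>x. H differentiable (at x)" and div: "continuous_on UNIV (divergence H)"
    and C: "compact C" "\<And>x. x \<notin> C \<Longrightarrow> H x = 0"
  shows "integrable lborel (divergence H)" "(LINT x|lborel. divergence H x) = 0"
proof -
  obtain r where r: "r > 0" "\<And>x. x \<in> C \<Longrightarrow> norm x < r"
    using compact_imp_bounded[OF C(1)] unfolding bounded_pos by (metis gt_ex le_less_trans less_trans)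
  define a b where "a = - (r *\<^sub>R (One :: 'a))" and "b = r *\<^sub>R (One :: 'a)"
  have ab: "a \<bullet> i = - r" "b \<bullet> i = r" if "i \<in> Basis" for i
    using that by (auto simp: a_def b_def)
  have H0: "H x = 0" if "norm x \<ge> r" for x
    using r(2) C(2) that by (meson not_less)
  have "box_flux H a b i = 0" if i: "i \<in> Basis" for i
  proof -
    have "H (set_coord i y t) = 0" if "\<bar>t\<bar> = r" for y t
    proof (rule H0)
      have "set_coord i y t \<bullet> i = t"
        using i by (simp add: set_coord_def inner_add_left)
      then show "r \<le> norm (set_coord i y t)"
        using Basis_le_norm[OF i, of "set_coord i y t"] that by simp
    qed
    then show ?thesis
      using ab[OF i] r(1) by (simp add: box_flux_def)
  qed
  moreover have "flux_defect H a b = 0"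
    using diff div r(1) by (intro flux_defect_cube_eq_0[where s = "2 * r"]) (auto simp: ab)
  ultimately have int: "integral (cbox a b) (divergence H) = 0"
    by (simp add: flux_defect_def)
  have supp: "divergence H x = 0" if "x \<notin> cbox a b" for x
  proof -
    have "x \<notin> C"
    proof
      assume "x \<in> C"
      then have "\<bar>x \<bullet> i\<bar> < r" if "i \<in> Basis" for i
        using r(2) Basis_le_norm[OF that, of x] by fastforce
      then have "x \<in> cbox a b"
        by (fastforce simp: mem_box ab)
      with that show False by simp
    qed
    then show ?thesis
      using frechet_derivative_eq_0_outside(2)[OF compact_imp_closed[OF C(1)] C(2)]
      by (simp add: divergence_def)
  qed
  have si: "set_integrable lborel (cbox a b) (divergence H)"
    unfolding set_integrable_def
    by (intro borel_integrable_compact compact_cbox continuous_on_subset[OF div]) auto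
  have ind: "(\<lambda>x. indicator (cbox a b) x *\<^sub>R divergence H x) = divergence H"
    using supp by (auto simp: indicator_def fun_eq_iff)
  show "integrable lborel (divergence H)"
    using si unfolding set_integrable_def ind .
  have "(LINT x:cbox a b|lborel. divergence H x) = 0"
    using set_borel_integral_eq_integral(2)[OF si] int by simp
  then show "(LINT x|lborel. divergence H x) = 0"
    unfolding set_lebesgue_integral_def ind .
qed

section \<open>Determinants of bordered matrices\<close>

lemma det_4:
  fixes A :: "'a::comm_ring_1^4^4"
  shows "det A =
    A$1$1 * A$2$2 * A$3$3 * A$4$4 + A$1$1 * A$2$3 * A$3$4 * A$4$2
     + A$1$1 * A$2$4 * A$3$2 * A$4$3 + A$1$2 * A$2$1 * A$3$4 * A$4$3
     + A$1$2 * A$2$3 * A$3$1 * A$4$4 + A$1$2 * A$2$4 * A$3$3 * A$4$1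
     + A$1$3 * A$2$1 * A$3$2 * A$4$4 + A$1$3 * A$2$2 * A$3$4 * A$4$1
     + A$1$3 * A$2$4 * A$3$1 * A$4$2 + A$1$4 * A$2$1 * A$3$3 * A$4$2
     + A$1$4 * A$2$2 * A$3$1 * A$4$3 + A$1$4 * A$2$3 * A$3$2 * A$4$1
     - A$1$1 * A$2$2 * A$3$4 * A$4$3 - A$1$1 * A$2$3 * A$3$2 * A$4$4
     - A$1$1 * A$2$4 * A$3$3 * A$4$2 - A$1$2 * A$2$1 * A$3$3 * A$4$4
     - A$1$2 * A$2$3 * A$3$4 * A$4$1 - A$1$2 * A$2$4 * A$3$1 * A$4$3
     - A$1$3 * A$2$1 * A$3$4 * A$4$2 - A$1$3 * A$2$2 * A$3$1 * A$4$4
     - A$1$3 * A$2$4 * A$3$2 * A$4$1 - A$1$4 * A$2$1 * A$3$2 * A$4$3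
     - A$1$4 * A$2$2 * A$3$3 * A$4$1 - A$1$4 * A$2$3 * A$3$1 * A$4$2"
proof -
  have f: "finite {4::4}" "3 \<notin> {4::4}" "finite {3::4,4}" "2 \<notin> {3::4,4}" "finite {2::4,3,4}" "1 \<notin> {2::4,3,4}"
    by auto
  show ?thesis
    unfolding det_def UNIV_4
    unfolding sum_over_permutations_insert[OF f(5,6)]
    unfolding sum_over_permutations_insert[OF f(3,4)]
    unfolding sum_over_permutations_insert[OF f(1,2)]
    unfolding permutes_sing
    by (simp add: sign_swap_id permutation_swap_id sign_compose permutation_compose sign_id swap_id_eq)
qed

text \<open>When \<open>J\<close> is the Jacobian of a patch, this is the Jacobian of the map that
  moves the patch along the constant vector \<open>m\<close>, with the height as fourth
  coordinate.\<close>

definition bordered :: "real^3^4 \<Rightarrow> real^4 \<Rightarrow> real^4^4" where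
  "bordered J m = (\<chi> i j. if j = 1 then J$i$1 else if j = 2 then J$i$2 else if j = 3 then J$i$3 else m$i)"

definition tangent_part :: "real^4 \<Rightarrow> real^3" where
  "tangent_part w = vector [w$1, w$2, w$3]"

lemma tangent_part_nth [simp]:
  "tangent_part w $ 1 = w$1" "tangent_part w $ 2 = w$2" "tangent_part w $ 3 = w$3"
  by (simp_all add: tangent_part_def)

lemma bordered_nth [simp]:
  "bordered J m $ i $ 1 = J$i$1" "bordered J m $ i $ 2 = J$i$2" "bordered J m $ i $ 3 = J$i$3"
  "bordered J m $ i $ 4 = m$i"
  by (simp_all add: bordered_def)

lemma bordered_mult_vec: "bordered J m *v w = J *v tangent_part w + w$4 *\<^sub>R m"
  by (simp add: vec_eq_iff matrix_vector_mult_def sum_4 sum_3 mult.commute)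

text \<open>The generalized cross product of the columns of \<open>J\<close>.\<close>

definition normal_minors :: "real^3^4 \<Rightarrow> real^4" where
  "normal_minors J = (\<chi> i. det (bordered J (axis i 1)))"

text \<open>Laplace expansion along the last column, whose cofactors are the components of
  \<open>normal_minors J\<close>.\<close>

lemma inner_normal_minors: "normal_minors J \<bullet> v = det (bordered J v)"
  by (simp add: normal_minors_def inner_vec_def sum_4 det_4 axis_def algebra_simps)

text \<open>A determinant whose last column is a combination of the other three.\<close>

lemma inner_normal_minors_range: "normal_minors J \<bullet> (J *v y) = 0"
  by (simp add: inner_normal_minors det_4 matrix_vector_mult_def sum_3 algebra_simps)

context
  fixes J :: "real^3^4" and n :: "real^4"
  assumes orth: "\<And>y. n \<bullet> (J *v y) = 0"
begin

lemma orth_column: "n$1 * J$1$j + n$2 * J$2$j + n$3 * J$3$j + n$4 * J$4$j = 0"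
  using orth[of "axis j 1"] by (simp add: matrix_vector_mult_basis column_def inner_vec_def sum_4)

text \<open>The transpose of \<open>bordered J n\<close> times \<open>bordered J m\<close> is block triangular.\<close>

lemma det_bordered_mult:
  "det (bordered J n) * det (bordered J m) = det (transpose J ** J) * (n \<bullet> m)"
proof -
  have "det (bordered J n) * det (bordered J m) = det (transpose (bordered J n) ** bordered J m)"
    by (simp add: det_mul det_transpose)
  also have "\<dots> = det (transpose J ** J) * (n \<bullet> m)"
  proof -
    let ?B = "transpose (bordered J n) ** bordered J m" and ?G = "transpose J ** J"
    have row: "?B$4$1 = 0" "?B$4$2 = 0" "?B$4$3 = 0" "?B$4$4 = n \<bullet> m"
      using orth_column by (simp_all add: matrix_matrix_mult_def transpose_def sum_4 inner_vec_def)
    have block: "?B$i$j = ?G$i'$j'" if "(i, i') \<in> {(1, 1), (2, 2), (3, 3)}" "(j, j') \<in> {(1, 1), (2, 2), (3, 3)}" for i i' j j'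
      using that by (auto simp: matrix_matrix_mult_def transpose_def sum_4)
    show ?thesis
      by (simp add: det_4[of ?B] det_3[of ?G] row block algebra_simps)
  qed
  finally show ?thesis .
qed

end

text \<open>The Cauchy-Binet formula: up to sign, the components of \<open>normal_minors J\<close>
  are the 3 by 3 minors of \<open>J\<close>.\<close>

lemma det_gram: "det (transpose J ** J) = normal_minors J \<bullet> normal_minors J" for J :: "real^3^4"
proof -
  define a where "a = (\<lambda>i j. J$i$j)"
  show ?thesis
    by (simp add: det_3 det_4 normal_minors_def inner_vec_def sum_4 axis_def matrix_matrix_mult_def transpose_def
      flip: a_def) (simp only: algebra_simps)
qed

text \<open>The quadratic form of the Gram matrix at \<open>y\<close> is the squared norm of
  \<open>J *v y\<close>, so its kernel is trivial and the determinant nonzero; as a sum of squares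
  it is also nonnegative.\<close>

lemma det_gram_pos:
  fixes J :: "real^3^4"
  assumes "inj ((*v) J)"
  shows "det (transpose J ** J) > 0"
proof -
  have "n = 0" if "J *v n = 0" for n
    using assms that by (metis injD matrix_vector_mult_0_right)
  moreover have "y = 0" if "(transpose J ** J) *v y = 0" for y
  proof -
    have "(J *v y) \<bullet> (J *v y) = ((transpose J ** J) *v y) \<bullet> y"
      by (simp add: dot_lmul_matrix transpose_matrix_vector flip: matrix_vector_mul_assoc)
    then show ?thesis
      using that calculation by simp
  qed
  then have "det (transpose J ** J) \<noteq> 0"
    using matrix_left_invertible_ker[of "transpose J ** J"] invertible_left_inverse invertible_det_nz by metis
  moreover have "det (transpose J ** J) \<ge> 0"
    by (simp add: det_gram)
  ultimately show ?thesis by simp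
qed

text \<open>Volume equals base area times height. Taking \<open>n\<close> itself as the border shows
  that its determinant squares to the Gram determinant, and \<open>det_bordered_mult\<close> then
  yields the one for \<open>m\<close>. This is the link between the volume Jacobian and the area
  density.\<close>

lemma abs_det_bordered:
  fixes J :: "real^3^4"
  assumes orth: "\<And>y. n \<bullet> (J *v y) = 0" and n: "norm n = 1" and inj: "inj ((*v) J)"
  shows "\<bar>det (bordered J m)\<bar> = sqrt (det (transpose J ** J)) * \<bar>n \<bullet> m\<bar>"
proof -
  let ?g = "det (transpose J ** J)"
  have sq: "(det (bordered J n))\<^sup>2 = ?g"
    using det_bordered_mult[OF orth, of n] n by (simp add: power2_eq_square norm_eq_1)
  have "\<bar>det (bordered J n)\<bar> = sqrt ?g"
    by (simp flip: sq)
  moreover have "?g \<ge> 0"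
    by (simp flip: sq)
  moreover have "\<bar>det (bordered J n)\<bar> * \<bar>det (bordered J m)\<bar> = \<bar>?g\<bar> * \<bar>n \<bullet> m\<bar>"
    using det_bordered_mult[OF orth, of m] by (metis abs_mult)
  ultimately have "sqrt ?g * \<bar>det (bordered J m)\<bar> = sqrt ?g * (sqrt ?g * \<bar>n \<bullet> m\<bar>)"
    by (simp flip: mult.assoc)
  then show ?thesis using det_gram_pos[OF inj] by simp
qed

text \<open>Combined with the chain rule, this is how the area density transforms under a change of
  parameters.\<close>

lemma det_gram_mult:
  "det (transpose (J ** T) ** (J ** T)) = (det T)\<^sup>2 * det (transpose J ** (J :: real^3^4))" for T :: "real^3^3"
proof -
  have "transpose (J ** T) ** (J ** T) = transpose T ** (transpose J ** J) ** T"
    by (simp add: matrix_transpose_mul matrix_mul_assoc)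
  then show ?thesis
    by (simp add: det_mul det_transpose power2_eq_square)
qed

section \<open>Normal charts of a hypersurface\<close>

definition join :: "real^3 \<Rightarrow> real \<Rightarrow> real^4" where
  "join y s = vector [y$1, y$2, y$3, s]"

lemma join_nth [simp]:
  "join y s $ 1 = y$1" "join y s $ 2 = y$2" "join y s $ 3 = y$3" "join y s $ 4 = s"
  by (simp_all add: join_def vector_def)

lemma tangent_part_join [simp]: "tangent_part (join y s) = y"
  by (simp add: vec_eq_iff forall_3)

lemma join_tangent_part [simp]: "join (tangent_part w) (w$4) = w"
  by (simp add: vec_eq_iff forall_4)

lemma bounded_linear_tangent_part: "bounded_linear tangent_part"
  by (intro linear_conv_bounded_linear[THEN iffD1] linearI) (simp_all add: vec_eq_iff forall_3)

lemmas tangent_part_diff = linear_diff[OF bounded_linear.linear[OF bounded_linear_tangent_part]]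
lemmas continuous_on_tangent_part [continuous_intros] =
  bounded_linear.continuous_on[OF bounded_linear_tangent_part]

lemma continuous_on_join [continuous_intros]:
  "continuous_on S f \<Longrightarrow> continuous_on S h \<Longrightarrow> continuous_on S (\<lambda>x. join (f x) (h x))"
proof -
  have "join y s = y$1 *\<^sub>R axis 1 1 + y$2 *\<^sub>R axis 2 1 + y$3 *\<^sub>R axis 3 1 + s *\<^sub>R axis 4 1" for y s
    by (simp add: vec_eq_iff forall_4 axis_def)
  then show "continuous_on S f \<Longrightarrow> continuous_on S h \<Longrightarrow> ?thesis"
    by (auto intro!: continuous_intros)
qed

lemma norm_le_tangent_part: "norm w \<le> norm (tangent_part w) + \<bar>w$4\<bar>"
proof -
  have "w = join (tangent_part w) 0 + w$4 *\<^sub>R axis 4 1"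
    by (simp add: vec_eq_iff forall_4 axis_def)
  then have "norm w \<le> norm (join (tangent_part w) 0) + norm (w$4 *\<^sub>R (axis 4 1 :: real^4))"
    by (metis norm_triangle_ineq)
  moreover have "norm (join (tangent_part w) 0) = norm (tangent_part w)"
    by (simp add: norm_vec_def L2_set_def sum_4 sum_3)
  ultimately show ?thesis
    by simp
qed

section \<open>Thickened patches\<close>

definition patch_jacobian :: "(real^3 \<Rightarrow> quat) \<Rightarrow> real^3 \<Rightarrow> real^3^4" where
  "patch_jacobian \<phi> y = matrix (frechet_derivative \<phi> (at y))"

text \<open>The direction \<open>m\<close> is constant instead of following the normal field, whose
  regularity along \<open>K\<close> is only established later from these coordinates. The Jacobian
  then depends on the tangential part of \<open>w\<close> alone.\<close>

definition thicken :: "(real^3 \<Rightarrow> quat) \<Rightarrow> quat \<Rightarrow> real^4 \<Rightarrow> quat" where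
  "thicken \<phi> m w = \<phi> (tangent_part w) + w$4 *\<^sub>R m"

lemma thicken_join [simp]: "thicken \<phi> m (join y s) = \<phi> y + s *\<^sub>R m"
  by (simp add: thicken_def)

context
  fixes V :: "(real^3) set" and \<phi> :: "real^3 \<Rightarrow> quat"
  assumes V: "open V" and smooth: "smooth_on V \<phi>"
begin

lemma smooth_on_differentiable: "y \<in> V \<Longrightarrow> \<phi> differentiable (at y)"
  using smooth V unfolding smooth_on_def
  by (metis Ck_on.simps(2) differentiable_on_eq_differentiable_at)

lemma smooth_on_continuous: "continuous_on V \<phi>"
  using smooth unfolding smooth_on_def by (metis Ck_on.simps(1))

lemma smooth_on_has_derivative:
  assumes "y \<in> V" shows "(\<phi> has_derivative (\<lambda>z. patch_jacobian \<phi> y *v z)) (at y)"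
proof -
  have "(\<phi> has_derivative frechet_derivative \<phi> (at y)) (at y)"
    using smooth_on_differentiable[OF assms] by (simp add: frechet_derivative_works)
  then show ?thesis
    by (simp add: patch_jacobian_def matrix_works has_derivative_bounded_linear bounded_linear.linear)
qed

lemma frechet_derivative_jacobian:
  "y \<in> V \<Longrightarrow> frechet_derivative \<phi> (at y) = (\<lambda>z. patch_jacobian \<phi> y *v z)"
  using smooth_on_has_derivative by (metis frechet_derivative_at)

lemma continuous_on_jacobian: "continuous_on V (patch_jacobian \<phi>)"
proof -
  have "continuous_on V (\<lambda>y. patch_jacobian \<phi> y $ i $ j)" for i j
  proof -
    have "Ck_on (Suc 0) V \<phi>"
      using smooth by (simp add: smooth_on_def)
    then have "continuous_on V (\<lambda>y. frechet_derivative \<phi> (at y) (axis j 1))"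
      by (auto simp: axis_in_Basis_iff)
    then have "continuous_on V (\<lambda>y. frechet_derivative \<phi> (at y) (axis j 1) $ i)"
      by (intro continuous_intros)
    then show ?thesis
      by (simp add: patch_jacobian_def matrix_def)
  qed
  then have "continuous_on V (\<lambda>y. \<chi> i j. patch_jacobian \<phi> y $ i $ j)"
    by (intro continuous_on_vec_lambda)
  then show ?thesis by simp
qed

lemma thicken_has_derivative:
  assumes "tangent_part w \<in> V"
  shows "(thicken \<phi> m has_derivative (\<lambda>z. bordered (patch_jacobian \<phi> (tangent_part w)) m *v z)) (at w)"
  unfolding bordered_mult_vec thicken_def
  by (intro has_derivative_add has_derivative_scaleR_left
      has_derivative_compose[OF bounded_linear.has_derivative[OF bounded_linear_tangent_part has_derivative_ident]
        smooth_on_has_derivative[OF assms]]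
      bounded_linear.has_derivative[OF bounded_linear_vec_nth has_derivative_ident])

text \<open>The inverse function theorem at height 0. The derivative of the inverse is recorded as a
  right inverse of the Jacobian, the form in which it enters the gradient of the height and the
  comparison with the normal.\<close>

lemma thicken_inverse:
  assumes y0: "y0 \<in> V" and det: "det (bordered (patch_jacobian \<phi> y0) m) \<noteq> 0"
  obtains U' V' g g' where "open U'" "U' \<subseteq> tangent_part -` V" "join y0 0 \<in> U'" "open V'"
    "homeomorphism U' V' (thicken \<phi> m) g"
    "\<And>p. p \<in> V' \<Longrightarrow> (g has_derivative g' p) (at p)"
    "\<And>p v. p \<in> V' \<Longrightarrow> bordered (patch_jacobian \<phi> (tangent_part (g p))) m *v g' p v = v"
proof -
  define M where "M = (\<lambda>w. bordered (patch_jacobian \<phi> (tangent_part w)) m)"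
  define F where "F = (\<lambda>w. Blinfun ((*v) (M w)))"
  have F: "blinfun_apply (F w) = (*v) (M w)" for w
    by (simp add: F_def bounded_linear_Blinfun_apply matrix_vector_mul_bounded_linear)
  let ?U = "tangent_part -` V"
  have open_U: "open ?U"
    using V by (intro open_vimage continuous_on_tangent_part continuous_intros)
  have contF: "continuous_on ?U F"
  proof (rule continuous_on_blinfun_componentwise)
    fix i :: "real^4"
    have *: "continuous_on ?U (\<lambda>w. patch_jacobian \<phi> (tangent_part w))"
      by (rule continuous_on_compose2[OF continuous_on_jacobian]) (auto intro!: continuous_intros)
    have "blinfun_apply (F w) i = (\<chi> k. \<Sum>j\<in>UNIV. patch_jacobian \<phi> (tangent_part w) $ k $ j * tangent_part i $ j) + i$4 *\<^sub>R m" for w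
      by (simp only: F M_def bordered_mult_vec) (simp add: matrix_vector_mult_def)
    then show "continuous_on ?U (\<lambda>w. blinfun_apply (F w) i)"
      by (auto intro!: continuous_intros *)
  qed
  have "invertible (M (join y0 0))"
    using det by (simp add: M_def invertible_det_nz)
  then obtain A where A: "A ** M (join y0 0) = mat 1"
    using invertible_def by blast
  define invF where "invF = Blinfun ((*v) A)"
  have invF: "blinfun_apply invF = (*v) A"
    by (simp add: invF_def bounded_linear_Blinfun_apply matrix_vector_mul_bounded_linear)
  have inv: "invF o\<^sub>L F (join y0 0) = id_blinfun"
    by (rule blinfun_eqI) (simp add: F invF matrix_vector_mul_assoc A)
  obtain U' V' g g' where *: "open U'" "U' \<subseteq> ?U" "join y0 0 \<in> U'" "open V'"
    "homeomorphism U' V' (thicken \<phi> m) g"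
    "\<And>p. p \<in> V' \<Longrightarrow> (g has_derivative g' p) (at p)"
    "\<And>p. p \<in> V' \<Longrightarrow> g' p = inv (blinfun_apply (F (g p)))"
    "\<And>p. p \<in> V' \<Longrightarrow> bij (blinfun_apply (F (g p)))"
  proof (rule inverse_function_theorem[OF open_U _ contF _ inv])
    show "(thicken \<phi> m has_derivative blinfun_apply (F w)) (at w)" if "w \<in> ?U" for w
      using thicken_has_derivative[of w m] that by (simp add: F M_def)
  qed (use y0 in auto)
  show thesis
  proof (rule that[OF *(1-6)])
    fix p v assume "p \<in> V'"
    then show "bordered (patch_jacobian \<phi> (tangent_part (g p))) m *v g' p v = v"
      using *(7,8)[of p] by (metis F M_def bij_inv_eq_iff)
  qed
qed

end

lemma patchesD:
  assumes "(V, \<phi>) \<in> patches K"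
  shows "open V" "smooth_on V \<phi>" "\<And>y. y \<in> V \<Longrightarrow> inj ((*v) (patch_jacobian \<phi> y))"
    "\<exists>\<psi>. homeomorphism V (\<phi> ` V) \<phi> \<psi>" "openin (top_of_set K) (\<phi> ` V)"
proof -
  show V: "open V" and s: "smooth_on V \<phi>" and "\<exists>\<psi>. homeomorphism V (\<phi> ` V) \<phi> \<psi>"
    and "openin (top_of_set K) (\<phi> ` V)"
    using assms by (auto simp: patches_def)
  show "inj ((*v) (patch_jacobian \<phi> y))" if "y \<in> V" for y
    using assms that frechet_derivative_jacobian[OF V s that] by (auto simp: patches_def)
qed

lemma unit_outer_normalD:
  assumes "unit_outer_normal K C p n"
  shows "norm n = 1" "\<forall>\<^sub>F s in at_right 0. p - s *\<^sub>R n \<in> C \<and> p + s *\<^sub>R n \<notin> C"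
    "\<And>V \<phi> y w. (V, \<phi>) \<in> patches K \<Longrightarrow> y \<in> V \<Longrightarrow> \<phi> y = p \<Longrightarrow> n \<bullet> (patch_jacobian \<phi> y *v w) = 0"
proof -
  show "norm n = 1" "\<forall>\<^sub>F s in at_right 0. p - s *\<^sub>R n \<in> C \<and> p + s *\<^sub>R n \<notin> C"
    using assms by (auto simp: unit_outer_normal_def)
  show "n \<bullet> (patch_jacobian \<phi> y *v w) = 0" if "(V, \<phi>) \<in> patches K" "y \<in> V" "\<phi> y = p" for V \<phi> y w
  proof -
    have "n \<bullet> frechet_derivative \<phi> (at y) w = 0"
      using assms that unfolding unit_outer_normal_def by blast
    then show ?thesis
      using frechet_derivative_jacobian[OF patchesD(1,2)[OF that(1)] that(2)] by simp
  qed
qed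

text \<open>Coordinates on a neighbourhood \<open>N\<close> in which \<open>K\<close> is the zero
  set of the height and \<open>C\<close> its negative side. The closed ball inside \<open>V\<close>
  is there to bound the area density on the open parameter ball.\<close>

locale normal_chart =
  fixes K C :: "quat set" and n :: "quat \<Rightarrow> quat" and V :: "(real^3) set" and \<phi> :: "real^3 \<Rightarrow> quat"
    and y0 :: "real^3" and a :: real and m :: quat and N :: "quat set"
    and g :: "quat \<Rightarrow> real^4" and g' :: "quat \<Rightarrow> quat \<Rightarrow> real^4"
  assumes outer: "\<And>p. p \<in> K \<Longrightarrow> unit_outer_normal K C p (n p)"
    and patch: "(V, \<phi>) \<in> patches K" and a: "a > 0" and cball: "cball y0 a \<subseteq> V"
    and open_N: "open N"
    and homeo: "homeomorphism {w. tangent_part w \<in> ball y0 a \<and> \<bar>w$4\<bar> < a} N (thicken \<phi> m) g"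
    and g_derivative: "\<And>p. p \<in> N \<Longrightarrow> (g has_derivative g' p) (at p)"
    and g_inverse: "\<And>p v. p \<in> N \<Longrightarrow> bordered (patch_jacobian \<phi> (tangent_part (g p))) m *v g' p v = v"
    and in_K_iff: "\<And>p. p \<in> N \<Longrightarrow> p \<in> K \<longleftrightarrow> g p $ 4 = 0"
    and in_C_iff: "\<And>p. p \<in> N \<Longrightarrow> p \<in> C \<longleftrightarrow> g p $ 4 < 0"
begin

abbreviation "B \<equiv> ball y0 a"
abbreviation "W \<equiv> {w. tangent_part w \<in> B \<and> \<bar>w$4\<bar> < a}"
abbreviation "J \<equiv> patch_jacobian \<phi>"

text \<open>The gradient of the height \<open>g p $ 4\<close>; it is constant along the direction \<open>m\<close>.\<close>

definition grad_height :: "quat \<Rightarrow> quat" where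
  "grad_height p = (let c = normal_minors (J (tangent_part (g p))) in (1 / (c \<bullet> m)) *\<^sub>R c)"

lemmas V = patchesD(1)[OF patch] and smooth = patchesD(2)[OF patch]

lemma B_subset_V: "B \<subseteq> V"
  using cball ball_subset_cball by blast

lemma g_in_W: "p \<in> N \<Longrightarrow> tangent_part (g p) \<in> B" "p \<in> N \<Longrightarrow> \<bar>g p $ 4\<bar> < a"
  using homeo by (auto simp: homeomorphism_def)

lemma thicken_g: "p \<in> N \<Longrightarrow> thicken \<phi> m (g p) = p"
  using homeo by (auto simp: homeomorphism_def)

lemma g_thicken: "w \<in> W \<Longrightarrow> g (thicken \<phi> m w) = w"
  using homeo by (auto simp: homeomorphism_def)

lemma thicken_in_N: "w \<in> W \<Longrightarrow> thicken \<phi> m w \<in> N"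
  using homeo by (auto simp: homeomorphism_def)

lemma \<phi>_in_N: "y \<in> B \<Longrightarrow> \<phi> y \<in> N" and g_\<phi>: "y \<in> B \<Longrightarrow> g (\<phi> y) = join y 0"
  using thicken_in_N[of "join y 0"] g_thicken[of "join y 0"] a by auto

lemma \<phi>_in_K: "y \<in> B \<Longrightarrow> \<phi> y \<in> K"
  using in_K_iff[OF \<phi>_in_N] g_\<phi> by simp

lemma K_Int_N: "K \<inter> N = \<phi> ` B"
proof
  show "\<phi> ` B \<subseteq> K \<inter> N"
    using \<phi>_in_N \<phi>_in_K by blast
  show "K \<inter> N \<subseteq> \<phi> ` B"
  proof
    fix p assume p: "p \<in> K \<inter> N"
    then have "p = \<phi> (tangent_part (g p))"
      using thicken_g[of p] in_K_iff[of p] by (simp add: thicken_def)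
    then show "p \<in> \<phi> ` B"
      using g_in_W p by blast
  qed
qed

lemma det_bordered_nonzero:
  assumes "y \<in> B" shows "det (bordered (J y) m) \<noteq> 0"
proof -
  have "surj ((*v) (bordered (J y) m))"
    using g_inverse[OF \<phi>_in_N[OF assms]] g_\<phi>[OF assms] by (metis surjI tangent_part_join)
  then show ?thesis
    by (metis invertible_det_nz invertible_right_inverse matrix_right_invertible_surjective)
qed

text \<open>Pair the Jacobian identity with \<open>normal_minors\<close>, which annihilates the
  tangential columns; only the height component of \<open>g' p v\<close> survives, multiplied by the
  inner product with \<open>m\<close>.\<close>

lemma height_derivative:
  assumes p: "p \<in> N"
  shows "((\<lambda>p. g p $ 4) has_derivative (\<lambda>v. grad_height p \<bullet> v)) (at p)"
proof -
  have "g' p v $ 4 = grad_height p \<bullet> v" for v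
  proof -
    let ?J = "J (tangent_part (g p))"
    let ?c = "normal_minors ?J"
    have "?c \<bullet> v = ?c \<bullet> (bordered ?J m *v g' p v)"
      by (simp only: g_inverse[OF p])
    also have "\<dots> = g' p v $ 4 * (?c \<bullet> m)"
      by (simp add: bordered_mult_vec inner_add_right inner_normal_minors_range)
    finally have "?c \<bullet> v = g' p v $ 4 * (?c \<bullet> m)" .
    moreover have "?c \<bullet> m \<noteq> 0"
      using det_bordered_nonzero[OF g_in_W(1)[OF p]] by (simp add: inner_normal_minors)
    ultimately show ?thesis
      by (simp add: grad_height_def Let_def field_simps)
  qed
  moreover have "((\<lambda>p. g p $ 4) has_derivative (\<lambda>v. g' p v $ 4)) (at p)"
    by (rule bounded_linear.has_derivative[OF bounded_linear_vec_nth g_derivative[OF p]])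
  ultimately show ?thesis by simp
qed

lemma continuous_on_g: "continuous_on N g"
  using homeo by (auto simp: homeomorphism_def)

lemma continuous_on_normal_minors: "continuous_on B (\<lambda>y. normal_minors (J y))"
proof -
  have J: "continuous_on B J"
    using continuous_on_jacobian[OF V smooth] B_subset_V by (rule continuous_on_subset)
  show ?thesis
    unfolding normal_minors_def det_4 bordered_nth
    by (intro continuous_intros J)
qed

lemma continuous_on_grad_height: "continuous_on N grad_height"
proof -
  have *: "continuous_on N (\<lambda>p. normal_minors (J (tangent_part (g p))))"
    by (rule continuous_on_compose2[OF continuous_on_normal_minors])
      (auto intro!: continuous_intros continuous_on_g g_in_W(1) simp del: mem_ball)
  show ?thesis
    unfolding grad_height_def Let_def
    by (intro continuous_intros *) (use det_bordered_nonzero g_in_W in \<open>auto simp: inner_normal_minors\<close>)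
qed

lemma grad_height_thicken: "w \<in> W \<Longrightarrow> grad_height (thicken \<phi> m w) = grad_height (\<phi> (tangent_part w))"
  using g_thicken[of w] g_\<phi>[of "tangent_part w"] by (simp add: grad_height_def)

text \<open>Both sides annihilate the tangent vectors and have the same inner product with
  \<open>m\<close>; together these vectors span the space.\<close>

lemma normal_eq_grad_height:
  assumes y: "y \<in> B"
  shows "n (\<phi> y) = (n (\<phi> y) \<bullet> m) *\<^sub>R grad_height (\<phi> y)"
proof -
  let ?p = "\<phi> y" and ?n = "n (\<phi> y)"
  have p: "?p \<in> N" and yV: "y \<in> V"
    using y \<phi>_in_N B_subset_V by auto
  have orth: "?n \<bullet> (J y *v w) = 0" for w
    by (rule unit_outer_normalD(3)[OF outer[OF \<phi>_in_K[OF y]] patch yV refl])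
  have "?n \<bullet> v = ((?n \<bullet> m) *\<^sub>R grad_height ?p) \<bullet> v" for v
  proof -
    have "?n \<bullet> v = ?n \<bullet> (bordered (J y) m *v g' ?p v)"
      using g_inverse[OF p] g_\<phi>[OF y] by simp
    also have "\<dots> = g' ?p v $ 4 * (?n \<bullet> m)"
      by (simp add: bordered_mult_vec inner_add_right orth)
    also have "g' ?p v $ 4 = grad_height ?p \<bullet> v"
    proof -
      have "((\<lambda>p. g p $ 4) has_derivative (\<lambda>v. g' ?p v $ 4)) (at ?p)"
        by (rule bounded_linear.has_derivative[OF bounded_linear_vec_nth g_derivative[OF p]])
      from has_derivative_unique[OF this height_derivative[OF p]] show ?thesis
        by metis
    qed
    finally show ?thesis by simp
  qed
  then show ?thesis
    by (metis vector_eq_rdot)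
qed

text \<open>If \<open>n (\<phi> y) \<bullet> m\<close> were negative, moving against \<open>n (\<phi> y)\<close> would increase the height and so
  leave \<open>C\<close>.\<close>

lemma normal_inner_pos:
  assumes y: "y \<in> B" shows "n (\<phi> y) \<bullet> m > 0"
proof (rule ccontr)
  let ?p = "\<phi> y" and ?n = "n (\<phi> y)"
  assume "\<not> ?n \<bullet> m > 0"
  have p: "?p \<in> N"
    using y \<phi>_in_N by auto
  note o = unit_outer_normalD(1,2)[OF outer[OF \<phi>_in_K[OF y]]]
  have "?n \<bullet> ?n = 1"
    using o(1) by (simp add: norm_eq_1)
  then have one: "(?n \<bullet> m) * (grad_height ?p \<bullet> ?n) = 1"
    using normal_eq_grad_height[OF y] by (metis inner_scaleR_left)
  \<comment> \<open>The product being 1, the two factors have the same sign and neither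
    vanishes.\<close>
  then have neg: "grad_height ?p \<bullet> ?n < 0"
    using \<open>\<not> ?n \<bullet> m > 0\<close> by (smt (verit) mult_nonpos_nonneg)
  have "((\<lambda>s. g (?p - s *\<^sub>R ?n) $ 4) has_derivative (\<lambda>s. grad_height ?p \<bullet> (- s *\<^sub>R ?n))) (at 0)"
    by (rule has_derivative_compose[where g = "\<lambda>p. g p $ 4" and g' = "\<lambda>v. grad_height ?p \<bullet> v"])
       (use height_derivative[OF p] in \<open>auto intro!: derivative_eq_intros\<close>)
  then have "((\<lambda>s. g (?p - s *\<^sub>R ?n) $ 4) has_real_derivative - (grad_height ?p \<bullet> ?n)) (at 0)"
    unfolding has_field_derivative_def by (rule has_derivative_eq_rhs) (auto simp: fun_eq_iff)
  from DERIV_pos_inc_right[OF this] neg obtain d where d: "d > 0"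
    "\<And>h. 0 < h \<Longrightarrow> h < d \<Longrightarrow> g (?p - h *\<^sub>R ?n) $ 4 > 0"
    using g_\<phi>[OF y] by auto
  have "((\<lambda>s. ?p - s *\<^sub>R ?n) \<longlongrightarrow> ?p - 0 *\<^sub>R ?n) (at_right 0)"
    by (intro tendsto_intros)
  then have "\<forall>\<^sub>F s in at_right 0. ?p - s *\<^sub>R ?n \<in> N"
    using open_N p by (intro topological_tendstoD) auto
  moreover have "\<forall>\<^sub>F s in at_right 0. 0 < s \<and> s < d"
    using d(1) eventually_at_right_less[of "0::real"] by (auto simp: eventually_at_right intro!: exI[of _ d])
  ultimately have "\<forall>\<^sub>F s in at_right (0::real). False"
    using o(2)
  proof eventually_elim
    case (elim s)
    then show ?case
      using in_C_iff[of "?p - s *\<^sub>R ?n"] d(2)[of s] by simp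
  qed
  then show False by simp
qed

end

text \<open>The thickened patch is shrunk to a cylinder that meets \<open>K\<close> in the patch
  alone. Its lower and upper halves are then connected and disjoint from \<open>K\<close>, so each
  lies in \<open>C\<close> or misses it, and the outer normal at the centre decides which.\<close>

lemma normal_chart_exists:
  assumes C: "C \<in> components (- K)" and outer: "\<And>p. p \<in> K \<Longrightarrow> unit_outer_normal K C p (n p)"
    and patch: "(V, \<phi>) \<in> patches K" and y0: "y0 \<in> V"
  obtains a N g g' where "normal_chart K C n V \<phi> y0 a (n (\<phi> y0)) N g g'" "\<phi> y0 \<in> N"
proof -
  define p0 m where "p0 = \<phi> y0" and "m = n p0"
  note V = patchesD(1)[OF patch] and smooth = patchesD(2)[OF patch] and open_in = patchesD(5)[OF patch]
  have p0: "p0 \<in> K"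
    using open_in y0 by (auto simp: p0_def dest: openin_imp_subset)
  note norm = unit_outer_normalD[OF outer[OF p0], folded m_def]
  have "\<bar>det (bordered (patch_jacobian \<phi> y0) m)\<bar> = sqrt (det (transpose (patch_jacobian \<phi> y0) ** patch_jacobian \<phi> y0)) * \<bar>m \<bullet> m\<bar>"
    using norm(3)[OF patch y0] norm(1) patchesD(3)[OF patch y0] by (intro abs_det_bordered) (auto simp: p0_def)
  moreover have "m \<bullet> m = 1"
    using norm(1) by (simp add: norm_eq_1)
  ultimately have "det (bordered (patch_jacobian \<phi> y0) m) \<noteq> 0"
    using det_gram_pos[OF patchesD(3)[OF patch y0]] by auto
  from thicken_inverse[OF V smooth y0 this] obtain U' V' g g'
    where U': "open U'" "U' \<subseteq> tangent_part -` V" "join y0 0 \<in> U'" and V': "open V'"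
      and homeo: "homeomorphism U' V' (thicken \<phi> m) g"
      and deriv: "\<And>p. p \<in> V' \<Longrightarrow> (g has_derivative g' p) (at p)"
        "\<And>p v. p \<in> V' \<Longrightarrow> bordered (patch_jacobian \<phi> (tangent_part (g p))) m *v g' p v = v"
    by metis
  define V1 where "V1 = {y \<in> V. join y 0 \<in> U'}"
  have "open V1"
  proof -
    have "V1 = V \<inter> (\<lambda>y. join y 0) -` U'"
      by (auto simp: V1_def)
    then show ?thesis
      using V U'(1) by (auto intro!: open_Int open_vimage continuous_intros)
  qed
  obtain \<psi> where \<psi>: "homeomorphism V (\<phi> ` V) \<phi> \<psi>"
    using patchesD(4)[OF patch] by blast
  have "openin (top_of_set (\<phi> ` V)) (\<phi> ` V1)"
    using \<open>open V1\<close> by (intro homeomorphism_imp_open_map[OF \<psi>]) (auto simp: openin_open V1_def)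
  then have "openin (top_of_set K) (\<phi> ` V1)"
    using open_in by (rule openin_trans)
  then obtain O' where O': "open O'" "\<phi> ` V1 = K \<inter> O'"
    by (auto simp: openin_open)
  have contT: "continuous_on U' (thicken \<phi> m)"
    using homeo by (simp add: homeomorphism_def)
  have "open (U' \<inter> thicken \<phi> m -` O')"
    using contT U'(1) O'(1) by (rule continuous_open_preimage)
  moreover have "join y0 0 \<in> U' \<inter> thicken \<phi> m -` O'"
  proof -
    have "\<phi> y0 \<in> \<phi> ` V1"
      using y0 U'(3) by (auto simp: V1_def)
    then show ?thesis
      using U'(3) O'(2) by auto
  qed
  ultimately obtain e where e: "e > 0" "ball (join y0 0) e \<subseteq> U' \<inter> thicken \<phi> m -` O'"
    using open_contains_ball by blast
  \<comment> \<open>Half of \<open>e\<close>, because the distance to the centre is bounded by the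
    tangential distance plus the height. The tangential bound below is not strict, so that the
    closed ball lands in \<open>V\<close>.\<close>
  define a where "a = e / 2"
  have a: "a > 0"
    using e by (simp add: a_def)
  have close: "w \<in> U' \<and> thicken \<phi> m w \<in> O'" if "dist y0 (tangent_part w) \<le> a" "\<bar>w$4\<bar> < a" for w
  proof -
    have "norm (w - join y0 0) \<le> norm (tangent_part (w - join y0 0)) + \<bar>(w - join y0 0)$4\<bar>"
      by (rule norm_le_tangent_part)
    also have "\<dots> < e"
      using that by (simp add: tangent_part_diff dist_norm norm_minus_commute a_def)
    finally show ?thesis
      using e(2) by (auto simp: dist_norm norm_minus_commute subset_iff)
  qed
  define W where "W = {w. tangent_part w \<in> ball y0 a \<and> \<bar>w$4\<bar> < a}"
  define N where "N = thicken \<phi> m ` W"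
  have WU: "W \<subseteq> U'"
    using close by (auto simp: W_def)
  have "W = tangent_part -` ball y0 a \<inter> (\<lambda>w. w$4) -` {-a<..<a}"
    by (auto simp: W_def)
  then have open_W: "open W"
    by (auto intro!: open_Int open_vimage continuous_intros)
  have NV: "N \<subseteq> V'"
    using homeo WU by (auto simp: N_def homeomorphism_def)
  have homeo_W: "homeomorphism W N (thicken \<phi> m) g"
    using homeo WU NV unfolding N_def by (rule homeomorphism_of_subsets) simp
  have "openin (top_of_set V') N"
    unfolding N_def using open_W WU by (intro homeomorphism_imp_open_map[OF homeo]) (auto simp: openin_open)
  then have open_N: "open N"
    using V' by (metis openin_open_eq)
  have g_thick: "g (thicken \<phi> m w) = w" if "w \<in> U'" for w
    using homeo that by (auto simp: homeomorphism_def)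
  have in_K: "thicken \<phi> m w \<in> K \<longleftrightarrow> w$4 = 0" if w: "w \<in> W" for w
  proof
    assume "w$4 = 0"
    moreover have "tangent_part w \<in> V"
      using w WU U'(2) by auto
    ultimately show "thicken \<phi> m w \<in> K"
      using open_in by (auto simp: thicken_def dest!: openin_imp_subset)
  next
    assume "thicken \<phi> m w \<in> K"
    moreover have "thicken \<phi> m w \<in> O'"
      using close[of w] w by (auto simp: W_def)
    ultimately obtain y where y: "y \<in> V1" "thicken \<phi> m w = \<phi> y"
      using O'(2) by blast
    then have "thicken \<phi> m w = thicken \<phi> m (join y 0)" "join y 0 \<in> U'"
      by (auto simp: V1_def)
    then have "w = join y 0"
      using g_thick w WU by (metis subsetD)
    then show "w$4 = 0" by simp
  qed
  have convex_W: "convex (W \<inter> {w. w$4 < 0})" "convex (W \<inter> {w. w$4 > 0})"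
  proof -
    have "convex (tangent_part -` ball y0 a)"
      by (intro convex_linear_vimage bounded_linear.linear[OF bounded_linear_tangent_part] convex_ball)
    moreover have "convex ((\<lambda>w::real^4. w$4) -` S)" if "convex S" for S
      using that by (intro convex_linear_vimage bounded_linear.linear[OF bounded_linear_vec_nth])
    moreover have "W \<inter> {w. w$4 < 0} = tangent_part -` ball y0 a \<inter> (\<lambda>w. w$4) -` {-a<..<0}"
      "W \<inter> {w. w$4 > 0} = tangent_part -` ball y0 a \<inter> (\<lambda>w. w$4) -` {0<..<a}"
      using a by (auto simp: W_def)
    ultimately show "convex (W \<inter> {w. w$4 < 0})" "convex (W \<inter> {w. w$4 > 0})"
      by (simp_all add: convex_Int)
  qed
  have side: "thicken \<phi> m ` S \<subseteq> C" if "S \<subseteq> W" "convex S" "\<And>w. w \<in> S \<Longrightarrow> w$4 \<noteq> 0" "w \<in> S" "thicken \<phi> m w \<in> C" for S w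
  proof (rule components_maximal[OF C])
    show "connected (thicken \<phi> m ` S)"
      using that WU by (intro connected_continuous_image convex_connected continuous_on_subset[OF contT]) auto
    show "thicken \<phi> m ` S \<subseteq> - K"
      using that in_K by blast
    show "C \<inter> thicken \<phi> m ` S \<noteq> {}"
      using that by blast
  qed
  have "\<forall>\<^sub>F s in at_right 0. 0 < s \<and> s < a"
    using a by (auto simp: eventually_at_right intro!: exI[of _ a])
  with norm(2) have "\<forall>\<^sub>F s in at_right 0. (p0 - s *\<^sub>R m \<in> C \<and> p0 + s *\<^sub>R m \<notin> C) \<and> 0 < s \<and> s < a"
    by (rule eventually_conj)
  \<comment> \<open>One height serves both sides: the point below puts the whole lower half into
    \<open>C\<close>, and the point above keeps the upper half from meeting
    \<open>C\<close>.\<close>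
  then obtain s where s: "p0 - s *\<^sub>R m \<in> C" "p0 + s *\<^sub>R m \<notin> C" "0 < s" "s < a"
    using eventually_happens'[OF trivial_limit_at_right_real] by blast
  have in_C: "thicken \<phi> m w \<in> C \<longleftrightarrow> w$4 < 0" if w: "w \<in> W" for w
  proof
    assume "w$4 < 0"
    moreover have "thicken \<phi> m ` (W \<inter> {w. w$4 < 0}) \<subseteq> C"
      by (rule side[where w = "join y0 (- s)"]) (use s a convex_W in \<open>auto simp: W_def p0_def\<close>)
    ultimately show "thicken \<phi> m w \<in> C"
      using w by blast
  next
    assume wC: "thicken \<phi> m w \<in> C"
    then have "thicken \<phi> m w \<notin> K"
      using in_components_subset[OF C] by blast
    then have "w$4 \<noteq> 0"
      using in_K[OF w] by simp
    moreover have False if "w$4 > 0"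
    proof -
      have "thicken \<phi> m ` (W \<inter> {w. w$4 > 0}) \<subseteq> C"
        by (rule side[where w = w]) (use w wC that convex_W in auto)
      moreover have "join y0 s \<in> W \<inter> {w. w$4 > 0}"
        using s a by (simp add: W_def)
      ultimately have "thicken \<phi> m (join y0 s) \<in> C"
        by blast
      then show False
        using s(2) by (simp add: p0_def)
    qed
    ultimately show "w$4 < 0"
      by (meson linorder_neqE_linordered_idom)
  qed
  have "normal_chart K C n V \<phi> y0 a m N g g'"
  proof
    show "cball y0 a \<subseteq> V"
    proof
      fix y assume "y \<in> cball y0 a"
      then have "join y 0 \<in> U'"
        using close[of "join y 0"] a by simp
      then show "y \<in> V"
        using U'(2) by auto
    qed
    show "homeomorphism {w. tangent_part w \<in> ball y0 a \<and> \<bar>w$4\<bar> < a} N (thicken \<phi> m) g"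
      using homeo_W by (simp add: W_def)
    show "p \<in> K \<longleftrightarrow> g p $ 4 = 0" if "p \<in> N" for p
      using that in_K g_thick WU by (auto simp: N_def)
    show "p \<in> C \<longleftrightarrow> g p $ 4 < 0" if "p \<in> N" for p
      using that in_C g_thick WU by (auto simp: N_def)
  qed (use outer patch a open_N deriv NV in auto)
  moreover have "p0 \<in> N"
  proof -
    have "join y0 0 \<in> W"
      using a by (simp add: W_def)
    then show ?thesis
      unfolding N_def p0_def by (rule rev_image_eqI) simp
  qed
  ultimately show thesis
    using that by (simp add: m_def p0_def)
qed

section \<open>Surface measure in a normal chart\<close>

text \<open>Real integrands are passed through \<open>real^1\<close> to use the formula for
  vector-valued ones.\<close>

lemma change_of_variables_real:
  fixes f :: "real^'m::{finite,wellorder} \<Rightarrow> real" and g :: "real^'m::_ \<Rightarrow> real^'m::_"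
  assumes S: "S \<in> sets lebesgue"
    and der: "\<And>x. x \<in> S \<Longrightarrow> (g has_derivative g' x) (at x within S)"
    and inj: "inj_on g S" and f: "f absolutely_integrable_on g ` S"
  shows "(\<lambda>x. \<bar>det (matrix (g' x))\<bar> * f (g x)) absolutely_integrable_on S"
    and "integral S (\<lambda>x. \<bar>det (matrix (g' x))\<bar> * f (g x)) = integral (g ` S) f"
proof -
  define F where "F = (\<lambda>x. vec (f x) :: real^1)"
  have "F absolutely_integrable_on g ` S"
    using f by (subst absolutely_integrable_componentwise_iff) (auto simp: F_def Basis_vec_def inner_axis)
  then have "(\<lambda>x. \<bar>det (matrix (g' x))\<bar> *\<^sub>R F (g x)) absolutely_integrable_on S \<and>
      integral S (\<lambda>x. \<bar>det (matrix (g' x))\<bar> *\<^sub>R F (g x)) = integral (g ` S) F"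
    using has_absolute_integral_change_of_variables[OF S der inj, of F "integral (g ` S) F"] by blast
  moreover have "integral (g ` S) F = vec (integral (g ` S) f)"
    using integral_on_1_eq[of "g ` S" F] by (simp add: F_def)
  moreover have "(\<lambda>x. \<bar>det (matrix (g' x))\<bar> *\<^sub>R F (g x)) = (\<lambda>x. vec (\<bar>det (matrix (g' x))\<bar> * f (g x)))"
    by (intro ext) (simp add: F_def vec_eq_iff)
  ultimately have *: "(\<lambda>x. vec (\<bar>det (matrix (g' x))\<bar> * f (g x)) :: real^1) absolutely_integrable_on S"
    "integral S (\<lambda>x. vec (\<bar>det (matrix (g' x))\<bar> * f (g x)) :: real^1) = vec (integral (g ` S) f)"
    by auto
  from *(1) show "(\<lambda>x. \<bar>det (matrix (g' x))\<bar> * f (g x)) absolutely_integrable_on S"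
    by (subst (asm) absolutely_integrable_componentwise_iff) (auto simp: Basis_vec_def inner_axis)
  from *(2) show "integral S (\<lambda>x. \<bar>det (matrix (g' x))\<bar> * f (g x)) = integral (g ` S) f"
    using integral_on_1_eq[of S "\<lambda>x. vec (\<bar>det (matrix (g' x))\<bar> * f (g x)) :: real^1"]
    by (simp add: vec_eq_iff)
qed

lemma set_integrable_lborel_imp_absolutely_integrable:
  fixes f :: "'a::euclidean_space \<Rightarrow> real"
  assumes "set_integrable lborel S f"
  shows "f absolutely_integrable_on S"
  using assms unfolding set_integrable_def
  by (subst integrable_completion) (auto intro: borel_measurable_integrable)

text \<open>The formula for absolutely integrable functions concerns the completed measure;
  \<open>meas\<close> brings the pulled back integrand down to \<open>lborel\<close>.\<close>

lemma set_integral_change_of_variables: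
  fixes f :: "real^'m::{finite,wellorder} \<Rightarrow> real" and g :: "real^'m::_ \<Rightarrow> real^'m::_"
  assumes S: "S \<in> sets borel"
    and der: "\<And>x. x \<in> S \<Longrightarrow> (g has_derivative g' x) (at x within S)"
    and inj: "inj_on g S" and f: "set_integrable lborel (g ` S) f"
    and meas: "(\<lambda>x. indicator S x *\<^sub>R (\<bar>det (matrix (g' x))\<bar> * f (g x))) \<in> borel_measurable borel"
  shows "(LINT x:S|lborel. \<bar>det (matrix (g' x))\<bar> * f (g x)) = (LINT x:g ` S|lborel. f x)"
proof -
  note cov = change_of_variables_real[OF _ der inj set_integrable_lborel_imp_absolutely_integrable[OF f]]
  have "(\<lambda>x. \<bar>det (matrix (g' x))\<bar> * f (g x)) absolutely_integrable_on S"
    using S by (intro cov(1)) auto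
  then have "set_integrable lborel S (\<lambda>x. \<bar>det (matrix (g' x))\<bar> * f (g x))"
    unfolding set_integrable_def using meas by (subst (asm) integrable_completion) auto
  then show ?thesis
    using cov(2) S set_borel_integral_eq_integral(2)[OF f]
    by (simp add: set_borel_integral_eq_integral(2))
qed

text \<open>The supremum is reached through finite suprema, and the supremum of two measures on
  \<open>X\<close> is governed by their values on subsets of \<open>X\<close>. Domination by
  \<open>N\<close> is thus a matter of subsets of \<open>X\<close> only, which permits a comparison
  with a single patch measure.\<close>

lemma emeasure_SUP_le_on:
  assumes "I \<noteq> {}" and sets: "\<And>i. i \<in> I \<Longrightarrow> sets (M i) = sets N" and X: "X \<in> sets N"
    and le: "\<And>i Y. i \<in> I \<Longrightarrow> Y \<subseteq> X \<Longrightarrow> Y \<in> sets N \<Longrightarrow> emeasure (M i) Y \<le> emeasure N Y"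
  shows "emeasure (SUP i\<in>I. M i) X \<le> emeasure N X"
proof -
  have "emeasure (SUP i\<in>J. M i) Y \<le> emeasure N Y" if "finite J" "J \<noteq> {}" "J \<subseteq> I" "Y \<subseteq> X" "Y \<in> sets N" for J Y
    using that
  proof (induction J arbitrary: Y rule: finite_ne_induct)
    case (singleton i)
    then show ?case using le by simp
  next
    case (insert i J)
    let ?S = "SUP i\<in>J. M i"
    have S: "sets ?S = sets N"
      using insert.hyps insert.prems sets by (intro sets_SUP) auto
    have Mi: "sets (M i) = sets N"
      using insert.prems sets by simp
    have "(SUP i\<in>insert i J. M i) = sup (M i) ?S"
      by simp
    also have "\<dots> = sup_measure' (M i) ?S"
      using S Mi sets_eq_imp_space_eq[of "M i" ?S] by (simp add: sup_measure_def sup_lexord_def)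
    also have "emeasure \<dots> Y \<le> emeasure N Y"
    proof (rule emeasure_sup_measure'_le2)
      fix Z assume Z: "Z \<subseteq> Y" "Z \<in> sets (M i)"
      then show "emeasure (M i) Z \<le> emeasure N Z"
        using insert.prems Mi by (intro le) auto
      show "emeasure ?S Z \<le> emeasure N Z"
        using Z insert.prems Mi by (intro insert.IH) auto
    qed (use S Mi insert.prems in auto)
    finally show ?case .
  qed
  then show ?thesis
    using emeasure_SUP[OF sets X \<open>I \<noteq> {}\<close>] X by (auto intro!: SUP_least)
qed

lemma area_density_eq_sqrt:
  "area_density \<phi> y = sqrt (det (transpose (patch_jacobian \<phi> y) ** patch_jacobian \<phi> y))"
  by (simp add: area_density_def Let_def patch_jacobian_def)

lemma area_density_eq_norm: "area_density \<phi> y = norm (normal_minors (patch_jacobian \<phi> y))"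
  by (simp add: area_density_eq_sqrt det_gram norm_eq_sqrt_inner)

lemma area_density_nonneg: "area_density \<phi> y \<ge> 0"
  by (simp add: area_density_eq_norm)

context
  fixes K :: "quat set" and V :: "(real^3) set" and \<phi> :: "real^3 \<Rightarrow> quat"
  assumes patch: "(V, \<phi>) \<in> patches K"
begin

lemma patch_continuous: "continuous_on V \<phi>"
  using smooth_on_continuous patchesD[OF patch] by blast

lemma patch_inj: "inj_on \<phi> V"
  using patchesD(4)[OF patch] by (metis homeomorphism_apply1 inj_on_inverseI)

lemma patch_in_sets [measurable]: "V \<in> sets borel"
  using patchesD(1)[OF patch] by simp

lemma patch_measurable: "\<phi> \<in> borel_measurable (restrict_space lborel V)"
proof -
  have "\<phi> \<in> borel_measurable (restrict_space borel V)"
    by (rule borel_measurable_continuous_on_restrict[OF patch_continuous])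
  then show ?thesis
    by (simp cong: measurable_cong_sets add: sets_restrict_space)
qed

lemma continuous_on_area_density: "continuous_on V (area_density \<phi>)"
proof -
  have J: "continuous_on V (patch_jacobian \<phi>)"
    using continuous_on_jacobian patchesD[OF patch] by blast
  show ?thesis
    unfolding area_density_eq_norm normal_minors_def det_4 bordered_nth
    by (intro continuous_intros J)
qed

lemma area_density_measurable: "area_density \<phi> \<in> borel_measurable (restrict_space lborel V)"
proof -
  have "area_density \<phi> \<in> borel_measurable (restrict_space borel V)"
    by (rule borel_measurable_continuous_on_restrict[OF continuous_on_area_density])
  then show ?thesis
    by (simp cong: measurable_cong_sets add: sets_restrict_space)
qed

lemma sets_patch_area: "sets (patch_area V \<phi>) = sets borel"
  by (simp add: patch_area_def)

lemma patch_preimage_in_sets: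
  assumes "X \<in> sets borel" shows "{y \<in> V. \<phi> y \<in> X} \<in> sets borel"
proof -
  have "\<phi> -` X \<inter> space (restrict_space lborel V) \<in> sets (restrict_space lborel V)"
    using assms by (rule measurable_sets[OF patch_measurable])
  moreover have "\<phi> -` X \<inter> space (restrict_space lborel V) = {y \<in> V. \<phi> y \<in> X}"
    by (auto simp: space_restrict_space)
  ultimately show ?thesis
    by (auto simp: sets_restrict_space)
qed

lemma emeasure_patch_area:
  assumes X: "X \<in> sets borel"
  shows "emeasure (patch_area V \<phi>) X = (\<integral>\<^sup>+ y. ennreal (area_density \<phi> y) * indicator {y \<in> V. \<phi> y \<in> X} y \<partial>lborel)"
proof -
  let ?R = "restrict_space lborel V"
  let ?D = "density ?R (\<lambda>y. ennreal (area_density \<phi> y))"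
  have "\<phi> \<in> measurable ?D borel"
    using patch_measurable by simp
  then have "emeasure (patch_area V \<phi>) X = emeasure ?D (\<phi> -` X \<inter> space ?R)"
    using X by (simp add: patch_area_def emeasure_distr)
  also have "\<dots> = (\<integral>\<^sup>+ y. ennreal (area_density \<phi> y) * indicator (\<phi> -` X \<inter> space ?R) y \<partial>?R)"
    using measurable_sets[OF patch_measurable X] area_density_measurable by (intro emeasure_density) auto
  also have "\<dots> = (\<integral>\<^sup>+ y. ennreal (area_density \<phi> y) * indicator (\<phi> -` X \<inter> space ?R) y * indicator V y \<partial>lborel)"
    by (subst nn_integral_restrict_space) auto
  also have "\<dots> = (\<integral>\<^sup>+ y. ennreal (area_density \<phi> y) * indicator {y \<in> V. \<phi> y \<in> X} y \<partial>lborel)"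
    by (intro nn_integral_cong) (auto simp: indicator_def space_restrict_space)
  finally show ?thesis .
qed

lemma integral_patch_area:
  fixes h :: "quat \<Rightarrow> real"
  assumes h: "h \<in> borel_measurable borel"
  shows "(LINT p|patch_area V \<phi>. h p) = (LINT y:V|lborel. area_density \<phi> y * h (\<phi> y))"
proof -
  let ?R = "restrict_space lborel V"
  let ?D = "density ?R (\<lambda>y. ennreal (area_density \<phi> y))"
  have "(LINT p|patch_area V \<phi>. h p) = (LINT y|?D. h (\<phi> y))"
    unfolding patch_area_def using h patch_measurable by (intro integral_distr) auto
  also have "\<dots> = (LINT y|?R. area_density \<phi> y *\<^sub>R h (\<phi> y))"
    using area_density_measurable area_density_nonneg measurable_compose[OF patch_measurable h]
    by (intro integral_density) auto
  also have "\<dots> = (LINT y:V|lborel. area_density \<phi> y * h (\<phi> y))"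
    by (subst integral_restrict_space) (auto simp: set_lebesgue_integral_def)
  finally show ?thesis .
qed

end

context normal_chart
begin

lemma integrable_area_density:
  assumes "S \<in> sets borel" "S \<subseteq> B"
  shows "set_integrable lborel S (area_density \<phi>)"
proof (rule set_integrable_subset)
  show "set_integrable lborel (cball y0 a) (area_density \<phi>)"
    unfolding set_integrable_def
    by (intro borel_integrable_compact compact_cball
        continuous_on_subset[OF continuous_on_area_density[OF patch] cball])
qed (use assms in auto)

text \<open>The transition map \<open>\<tau>\<close> is differentiable because it factors through the inverse \<open>g\<close> of the
  thickened patch.\<close>

lemma patch_area_le:
  assumes V': "(V', \<psi>) \<in> patches K" and K: "closed K" and X: "X \<in> sets borel" "X \<subseteq> K \<inter> N"
  shows "emeasure (patch_area V' \<psi>) X \<le> emeasure (patch_area V \<phi>) X"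
proof -
  define S where "S = {y \<in> V'. \<psi> y \<in> X}"
  define \<tau> where "\<tau> = (\<lambda>y. tangent_part (g (\<psi> y)))"
  define \<tau>' where "\<tau>' = (\<lambda>y v. tangent_part (g' (\<psi> y) (patch_jacobian \<psi> y *v v)))"
  have S: "S \<in> sets borel"
    unfolding S_def by (rule patch_preimage_in_sets[OF V' X(1)])
  have N: "\<psi> y \<in> N" if "y \<in> S" for y
    using that X by (auto simp: S_def)
  have inK: "\<psi> y \<in> K" if "y \<in> V'" for y
    using patchesD(5)[OF V'] that by (auto dest!: openin_imp_subset)
  have \<tau>: "\<tau> y \<in> B" "\<phi> (\<tau> y) = \<psi> y" if "y \<in> V'" "\<psi> y \<in> N" for y
  proof -
    have "g (\<psi> y) $ 4 = 0"
      using in_K_iff[OF that(2)] inK[OF that(1)] by simp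
    then show "\<tau> y \<in> B" "\<phi> (\<tau> y) = \<psi> y"
      using g_in_W(1)[OF that(2)] thicken_g[OF that(2)] by (auto simp: \<tau>_def thicken_def)
  qed
  have der: "(\<tau> has_derivative \<tau>' y) (at y)" if "y \<in> S" for y
  proof -
    have "y \<in> V'"
      using that by (simp add: S_def)
    then have "(\<psi> has_derivative (\<lambda>v. patch_jacobian \<psi> y *v v)) (at y)"
      by (rule smooth_on_has_derivative[OF patchesD(1,2)[OF V']])
    then have "((\<lambda>y. g (\<psi> y)) has_derivative (\<lambda>v. g' (\<psi> y) (patch_jacobian \<psi> y *v v))) (at y)"
      by (rule has_derivative_compose) (rule g_derivative[OF N[OF that]])
    then show ?thesis
      unfolding \<tau>_def \<tau>'_def
      by (rule bounded_linear.has_derivative[OF bounded_linear_tangent_part])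
  qed
  \<comment> \<open>Differentiating \<open>\<psi> = \<phi> \<circ> \<tau>\<close> factors the
    Jacobian of \<open>\<psi>\<close>, and the Gram determinant picks up the square of the
    determinant of \<open>\<tau>'\<close>.\<close>
  have density: "area_density \<psi> y = \<bar>det (matrix (\<tau>' y))\<bar> * area_density \<phi> (\<tau> y)" if y: "y \<in> S" for y
  proof -
    have yW: "y \<in> V'"
      using y by (simp add: S_def)
    have "\<tau> y \<in> V"
      using \<tau>(1)[OF yW N[OF y]] B_subset_V by blast
    then have "(\<phi> has_derivative (\<lambda>v. J (\<tau> y) *v v)) (at (\<tau> y))"
      by (rule smooth_on_has_derivative[OF V smooth])
    then have 1: "((\<lambda>y. \<phi> (\<tau> y)) has_derivative (\<lambda>v. J (\<tau> y) *v \<tau>' y v)) (at y)"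
      by (rule has_derivative_compose[OF der[OF y]])
    have opn: "open (V' \<inter> \<psi> -` N)"
      using patch_continuous[OF V'] patchesD(1)[OF V'] open_N by (rule continuous_open_preimage)
    have "(\<psi> has_derivative (\<lambda>v. J (\<tau> y) *v \<tau>' y v)) (at y)"
      by (rule has_derivative_transform_within_open[OF 1 opn]) (use \<tau>(2) yW N[OF y] in auto)
    then have eq: "(\<lambda>v. patch_jacobian \<psi> y *v v) = (\<lambda>v. J (\<tau> y) *v \<tau>' y v)"
      using smooth_on_has_derivative[OF patchesD(1,2)[OF V'] yW] has_derivative_unique by blast
    have "linear (\<tau>' y)"
      using der[OF y] has_derivative_bounded_linear bounded_linear.linear by blast
    then have "patch_jacobian \<psi> y *v v = (J (\<tau> y) ** matrix (\<tau>' y)) *v v" for v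
      using fun_cong[OF eq, of v] by (simp only: matrix_vector_mul_assoc[symmetric]) (simp add: matrix_works)
    then have "patch_jacobian \<psi> y = J (\<tau> y) ** matrix (\<tau>' y)"
      using matrix_eq by blast
    then show ?thesis
      by (simp only: area_density_eq_sqrt det_gram_mult real_sqrt_mult real_sqrt_abs)
  qed
  have "inj_on \<tau> S"
  proof (rule inj_onI)
    fix y z assume *: "y \<in> S" "z \<in> S" "\<tau> y = \<tau> z"
    then have "\<psi> y = \<psi> z"
      using \<tau>(2)[of y] \<tau>(2)[of z] N[of y] N[of z] by (simp add: S_def)
    then show "y = z"
      using * patch_inj[OF V'] by (auto simp: S_def inj_on_def)
  qed
  have image: "\<tau> ` S = {y \<in> V. \<phi> y \<in> X \<inter> \<psi> ` V' \<inter> N} \<inter> B"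
  proof (intro subset_antisym subsetI)
    fix y assume "y \<in> \<tau> ` S"
    then show "y \<in> {y \<in> V. \<phi> y \<in> X \<inter> \<psi> ` V' \<inter> N} \<inter> B"
      using \<tau> N B_subset_V by (auto simp: S_def)
  next
    fix y assume y: "y \<in> {y \<in> V. \<phi> y \<in> X \<inter> \<psi> ` V' \<inter> N} \<inter> B"
    then obtain z where z: "z \<in> V'" "\<phi> y = \<psi> z"
      by auto
    then have "\<tau> z = y"
      using y g_\<phi>[of y] by (auto simp: \<tau>_def z(2)[symmetric])
    then show "y \<in> \<tau> ` S"
      using y z by (auto simp: S_def)
  qed
  have "\<psi> ` V' \<in> sets borel"
  proof -
    obtain T where "open T" "\<psi> ` V' = K \<inter> T"
      using patchesD(5)[OF V'] by (auto simp: openin_open)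
    then show ?thesis
      using K by auto
  qed
  then have image_sets: "\<tau> ` S \<in> sets borel"
    unfolding image using X open_N by (intro sets.Int patch_preimage_in_sets[OF patch]) auto
  have "set_integrable lborel (\<tau> ` S) (area_density \<phi>)"
    by (rule integrable_area_density[OF image_sets]) (auto simp: image)
  note f = set_integrable_lborel_imp_absolutely_integrable[OF this]
  have der': "(\<tau> has_derivative \<tau>' y) (at y within S)" if "y \<in> S" for y
    using der[OF that] by (rule has_derivative_at_withinI)
  note cov = change_of_variables_real[OF _ der' \<open>inj_on \<tau> S\<close> f]
  have S': "S \<in> sets lebesgue"
    using S by auto
  define I where "I = integral (\<tau> ` S) (area_density \<phi>)"
  have "((\<lambda>y. \<bar>det (matrix (\<tau>' y))\<bar> * area_density \<phi> (\<tau> y)) has_integral I) S"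
    using integrable_integral[OF set_lebesgue_integral_eq_integral(1)[OF cov(1)[OF S']]] cov(2)[OF S']
    unfolding I_def by simp
  then have "(area_density \<psi> has_integral I) S"
    by (rule has_integral_eq[rotated]) (simp add: density)
  then have "emeasure (patch_area V' \<psi>) X = ennreal I"
    unfolding emeasure_patch_area[OF V' X(1)] S_def[symmetric]
    by (intro nn_integral_has_integral_lebesgue' area_density_nonneg)
  also have "\<dots> = (\<integral>\<^sup>+ y. ennreal (area_density \<phi> y) * indicator (\<tau> ` S) y \<partial>lborel)"
    unfolding I_def
    by (rule nn_integral_has_integral_lebesgue'[symmetric, OF area_density_nonneg
        integrable_integral[OF set_lebesgue_integral_eq_integral(1)[OF f]]])
  also have "\<dots> \<le> (\<integral>\<^sup>+ y. ennreal (area_density \<phi> y) * indicator {y \<in> V. \<phi> y \<in> X} y \<partial>lborel)"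
    by (intro nn_integral_mono) (auto simp: image indicator_def)
  also have "\<dots> = emeasure (patch_area V \<phi>) X"
    by (rule emeasure_patch_area[OF patch X(1), symmetric])
  finally show ?thesis .
qed

text \<open>On subsets of \<open>K \<inter> N\<close> every competitor in the supremum is dominated
  by the patch measure of the chart, which is itself one of the competitors.\<close>

lemma emeasure_surface_measure:
  assumes K: "closed K" and X: "X \<in> sets borel" "X \<subseteq> K \<inter> N"
  shows "emeasure (surface_measure K) X = emeasure (patch_area V \<phi>) X"
proof (rule antisym)
  show "emeasure (surface_measure K) X \<le> emeasure (patch_area V \<phi>) X"
    unfolding surface_measure_def
  proof (rule emeasure_SUP_le_on)
    show "patches K \<noteq> {}"
      using patch by auto
    fix i Y assume "i \<in> patches K" "Y \<subseteq> X" "Y \<in> sets (patch_area V \<phi>)"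
    then show "emeasure (case i of (V, \<phi>) \<Rightarrow> patch_area V \<phi>) Y \<le> emeasure (patch_area V \<phi>) Y"
      using K X(2) patch_area_le[of "fst i" "snd i" Y] unfolding sets_patch_area[OF patch] split_beta
      by (metis order_trans prod.collapse)
  qed (use X in \<open>auto simp: patch_area_def\<close>)
  have "patch_area V \<phi> \<le> surface_measure K"
    unfolding surface_measure_def using patch by (auto intro: SUP_upper2[of "(V, \<phi>)"])
  moreover have "sets (patch_area V \<phi>) = sets (surface_measure K)"
  proof -
    have "patches K \<noteq> {}"
      using patch by auto
    then show ?thesis
      unfolding surface_measure_def by (subst sets_SUP[where N = borel]) (auto simp: patch_area_def)
  qed
  ultimately show "emeasure (patch_area V \<phi>) X \<le> emeasure (surface_measure K) X"
    using X by (auto simp: le_measure patch_area_def)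
qed

lemma sets_surface: "sets (surface_measure K) = sets borel"
proof -
  have "patches K \<noteq> {}"
    using patch by auto
  then show ?thesis
    unfolding surface_measure_def by (subst sets_SUP[where N = borel]) (auto simp: patch_area_def)
qed

lemma K_Int_N_in_sets: "closed K \<Longrightarrow> K \<inter> N \<in> sets borel"
  using open_N by auto

text \<open>The surface and patch measures coincide after restriction to
  \<open>K \<inter> N\<close>, where \<open>h\<close> lives; injectivity of \<open>\<phi>\<close>
  then shrinks the parameter domain from \<open>V\<close> to \<open>B\<close>.\<close>

lemma surface_integral_local:
  fixes h :: "quat \<Rightarrow> real"
  assumes K: "closed K" and h: "h \<in> borel_measurable borel" and supp: "\<And>p. p \<notin> K \<inter> N \<Longrightarrow> h p = 0"
  shows "(LINT p|surface_measure K. h p) = (LINT y:B|lborel. area_density \<phi> y * h (\<phi> y))"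
proof -
  note KN = K_Int_N_in_sets[OF K]
  have eq: "restrict_space (surface_measure K) (K \<inter> N) = restrict_space (patch_area V \<phi>) (K \<inter> N)"
  proof (rule measure_eqI)
    show "sets (restrict_space (surface_measure K) (K \<inter> N)) = sets (restrict_space (patch_area V \<phi>) (K \<inter> N))"
      by (simp add: sets_restrict_space sets_surface sets_patch_area[OF patch])
    fix X assume "X \<in> sets (restrict_space (surface_measure K) (K \<inter> N))"
    then have "X \<in> sets borel" "X \<subseteq> K \<inter> N"
      using KN by (auto simp: sets_restrict_space sets_surface)
    then show "emeasure (restrict_space (surface_measure K) (K \<inter> N)) X = emeasure (restrict_space (patch_area V \<phi>) (K \<inter> N)) X"
      using KN by (subst (1 2) emeasure_restrict_space)
        (auto simp: sets_surface sets_patch_area[OF patch] emeasure_surface_measure[OF K])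
  qed
  have ind: "(\<lambda>p. indicat_real (K \<inter> N) p * h p) = h"
    using supp by (auto simp: indicator_def fun_eq_iff)
  have "(LINT p|surface_measure K. h p) = (LINT p|restrict_space (surface_measure K) (K \<inter> N). h p)"
    using KN by (subst integral_restrict_space) (auto simp: sets_surface ind)
  also have "\<dots> = (LINT p|patch_area V \<phi>. h p)"
    unfolding eq using KN by (subst integral_restrict_space) (auto simp: sets_patch_area[OF patch] ind)
  also have "\<dots> = (LINT y:V|lborel. area_density \<phi> y * h (\<phi> y))"
    by (rule integral_patch_area[OF patch h])
  also have "\<dots> = (LINT y:B|lborel. area_density \<phi> y * h (\<phi> y))"
  proof -
    have "y \<in> B" if y: "y \<in> V" "\<phi> y \<in> K \<inter> N" for y
    proof -
      obtain z where z: "z \<in> B" "\<phi> y = \<phi> z"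
        using y(2) K_Int_N by auto
      then have "y = z"
        using patch_inj[OF patch] y(1) B_subset_V by (meson inj_onD subsetD)
      then show ?thesis using z by simp
    qed
    then have "indicator V y *\<^sub>R (area_density \<phi> y * h (\<phi> y)) = indicator B y *\<^sub>R (area_density \<phi> y * h (\<phi> y))" for y
      using supp[of "\<phi> y"] B_subset_V by (auto simp: indicator_def)
    then show ?thesis
      unfolding set_lebesgue_integral_def by (intro Bochner_Integration.integral_cong) auto
  qed
  finally show ?thesis .
qed

lemma emeasure_surface_finite:
  assumes K: "closed K" shows "emeasure (surface_measure K) (K \<inter> N) < \<infinity>"
proof -
  note KN = K_Int_N_in_sets[OF K]
  have "emeasure (surface_measure K) (K \<inter> N) = (\<integral>\<^sup>+ y. ennreal (area_density \<phi> y) * indicator {y \<in> V. \<phi> y \<in> K \<inter> N} y \<partial>lborel)"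
    using emeasure_surface_measure[OF K KN order_refl] emeasure_patch_area[OF patch KN] by simp
  also have "{y \<in> V. \<phi> y \<in> K \<inter> N} = B"
  proof
    show "{y \<in> V. \<phi> y \<in> K \<inter> N} \<subseteq> B"
      using K_Int_N patch_inj[OF patch] B_subset_V by (auto simp: inj_on_def)
    show "B \<subseteq> {y \<in> V. \<phi> y \<in> K \<inter> N}"
      using K_Int_N B_subset_V by auto
  qed
  also have "(\<integral>\<^sup>+ y. ennreal (area_density \<phi> y) * indicator B y \<partial>lborel) = (\<integral>\<^sup>+ y. ennreal (norm (indicator B y *\<^sub>R area_density \<phi> y)) \<partial>lborel)"
    by (intro nn_integral_cong) (auto simp: indicator_def area_density_nonneg)
  also have "\<dots> < \<infinity>"
    using integrable_area_density[of B] unfolding set_integrable_def integrable_iff_bounded by auto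
  finally show ?thesis .
qed

end

section \<open>Cutoff functions and integration in product coordinates\<close>

text \<open>The antiderivative of the tent \<open>hat\<close>, rising from 0 to 1 on the unit
  interval. It is C^1, as much as a cutoff has to be here. Writing it with positive parts reduces
  its derivative to that of one squared positive part.\<close>

definition smooth_step :: "real \<Rightarrow> real" where
  "smooth_step t = 2 * (max 0 t)\<^sup>2 - 4 * (max 0 (t - 1/2))\<^sup>2 + 2 * (max 0 (t - 1))\<^sup>2"

text \<open>The tent over the unit interval with peak 2 at 1/2; the height is chosen to make its
  area 1.\<close>

definition hat :: "real \<Rightarrow> real" where
  "hat t = 4 * max 0 t - 8 * max 0 (t - 1/2) + 4 * max 0 (t - 1)"

lemma DERIV_positive_part_square: "((\<lambda>t::real. (max 0 (t - c))\<^sup>2) has_real_derivative 2 * max 0 (t - c)) (at t)"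
proof -
  consider "t < c" | "t > c" | "t = c" by linarith
  then show ?thesis
  proof cases
    case 1
    have "((\<lambda>t. 0) has_real_derivative 2 * max 0 (t - c)) (at t)"
      using 1 by simp
    then show ?thesis
      by (rule has_field_derivative_transform_within_open[of _ _ _ "{..<c}"]) (use 1 in auto)
  next
    case 2
    have "((\<lambda>t. (t - c)\<^sup>2) has_real_derivative 2 * max 0 (t - c)) (at t)"
      using 2 by (auto intro!: derivative_eq_intros)
    then show ?thesis
      by (rule has_field_derivative_transform_within_open[of _ _ _ "{c<..}"]) (use 2 in auto)
  next
    case 3
    have "(\<lambda>h::real. (max 0 h)\<^sup>2 / h) \<midarrow>0\<rightarrow> 0"
    proof (rule Lim_null_comparison)
      show "\<forall>\<^sub>F h in at (0::real). norm ((max 0 h)\<^sup>2 / h) \<le> \<bar>h\<bar>"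
        by (auto simp: max_def power2_eq_square)
      show "((\<lambda>h::real. \<bar>h\<bar>) \<longlongrightarrow> 0) (at 0)"
        by (auto intro!: tendsto_eq_intros)
    qed
    then show ?thesis
      using 3 by (simp add: DERIV_def)
  qed
qed

lemma DERIV_smooth_step: "(smooth_step has_real_derivative hat t) (at t)"
proof -
  have "((\<lambda>t. 2 * (max 0 (t - 0))\<^sup>2 - 4 * (max 0 (t - 1/2))\<^sup>2 + 2 * (max 0 (t - 1))\<^sup>2) has_real_derivative
      2 * (2 * max 0 (t - 0)) - 4 * (2 * max 0 (t - 1/2)) + 2 * (2 * max 0 (t - 1))) (at t)"
    by (intro DERIV_add DERIV_diff DERIV_cmult DERIV_positive_part_square)
  then show ?thesis
    unfolding smooth_step_def hat_def by simp
qed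

lemma continuous_on_hat [continuous_intros]: "continuous_on S f \<Longrightarrow> continuous_on S (\<lambda>x. hat (f x))"
  unfolding hat_def by (intro continuous_intros)

lemma continuous_on_smooth_step [continuous_intros]:
  "continuous_on S f \<Longrightarrow> continuous_on S (\<lambda>x. smooth_step (f x))"
  unfolding smooth_step_def by (intro continuous_intros)

lemma smooth_step_eq_0: "t \<le> 0 \<Longrightarrow> smooth_step t = 0"
  and smooth_step_eq_1: "t \<ge> 1 \<Longrightarrow> smooth_step t = 1"
  and hat_eq_0: "t \<le> 0 \<or> t \<ge> 1 \<Longrightarrow> hat t = 0"
  by (auto simp: smooth_step_def hat_def max_def power2_eq_square algebra_simps)

lemma hat_nonneg: "hat t \<ge> 0" and hat_le_2: "hat t \<le> 2"
  by (auto simp: hat_def max_def)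

lemma smooth_step_bounds: "0 \<le> smooth_step t" "smooth_step t \<le> 1"
proof -
  have mono: "smooth_step x \<le> smooth_step y" if "x \<le> y" for x y
  proof (rule DERIV_nonneg_imp_nondecreasing[OF that])
    show "\<exists>d. (smooth_step has_real_derivative d) (at z) \<and> 0 \<le> d" for z
      using DERIV_smooth_step[of z] hat_nonneg[of z] by blast
  qed
  show "0 \<le> smooth_step t"
    using mono[of "min t 0" t] by (simp add: smooth_step_eq_0)
  show "smooth_step t \<le> 1"
    using mono[of t "max t 1"] by (simp add: smooth_step_eq_1)
qed

lemma integral_hat: "integrable lborel hat" "(LINT t|lborel. hat t) = 1"
proof -
  have "has_bochner_integral lborel (\<lambda>x. hat x * indicator {0..1} x) (smooth_step 1 - smooth_step 0)"
  proof (rule has_bochner_integral_FTC_Icc_real)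
    show "isCont hat x" for x
      using continuous_on_hat[OF continuous_on_id, of UNIV] by (simp add: continuous_on_eq_continuous_at)
  qed (use DERIV_smooth_step in auto)
  moreover have "(\<lambda>x. hat x * indicator {0..1} x) = hat"
  proof
    show "hat x * indicator {0..1} x = hat x" for x
      by (cases "0 \<le> x \<and> x \<le> 1") (auto simp: hat_eq_0)
  qed
  moreover have "smooth_step 1 - smooth_step 0 = 1"
    by (simp add: smooth_step_eq_0 smooth_step_eq_1)
  ultimately have "has_bochner_integral lborel hat 1"
    by simp
  then show "integrable lborel hat" "(LINT t|lborel. hat t) = 1"
    by (auto simp: has_bochner_integral_iff)
qed

section \<open>Lebesgue measure in tangential and height coordinates\<close>

lemma prod_Basis_vec:
  fixes f :: "real^'n \<Rightarrow> 'b::comm_monoid_mult"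
  shows "prod f Basis = (\<Prod>i\<in>UNIV. f (axis i 1))"
proof -
  have "Basis = (\<lambda>i::'n. axis i (1::real)) ` UNIV"
    by (auto simp: Basis_vec_def)
  moreover have "inj_on (\<lambda>i::'n. axis i (1::real)) UNIV"
    by (auto simp: inj_on_def axis_eq_axis)
  ultimately show ?thesis
    by (metis (no_types, lifting) prod.reindex_cong)
qed

lemma measurable_join [measurable]: "(\<lambda>(y, s). join y s) \<in> borel_measurable (borel \<Otimes>\<^sub>M borel)"
  unfolding borel_prod split_beta by (intro borel_measurable_continuous_onI continuous_intros)

text \<open>A Borel measure with the right values on boxes is Lebesgue measure. This opens the way
  to Fubini in the tangential and height variables.\<close>

lemma lborel_join: "distr (lborel \<Otimes>\<^sub>M lborel) borel (\<lambda>(y, s). join y s) = (lborel :: (real^4) measure)"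
proof (rule lborel_eqI[symmetric])
  fix l u :: "real^4"
  assume le: "\<And>b. b \<in> Basis \<Longrightarrow> l \<bullet> b \<le> u \<bullet> b"
  then have le': "l $ i \<le> u $ i" for i
    by (simp add: cart_eq_inner_axis axis_in_Basis_iff)
  have "(\<lambda>(y, s). join y s) -` box l u \<inter> space (lborel \<Otimes>\<^sub>M lborel) = box (tangent_part l) (tangent_part u) \<times> {l$4<..<u$4}"
    by (auto simp: mem_box_cart forall_4 forall_3 space_pair_measure)
  then have "emeasure (distr (lborel \<Otimes>\<^sub>M lborel) borel (\<lambda>(y, s). join y s)) (box l u) =
      emeasure (lborel \<Otimes>\<^sub>M lborel) (box (tangent_part l) (tangent_part u) \<times> {l$4<..<u$4})"
    by (subst emeasure_distr) auto
  also have "\<dots> = emeasure lborel (box (tangent_part l) (tangent_part u)) * emeasure lborel {l$4<..<u$4}"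
    by (rule lborel.emeasure_pair_measure_Times) auto
  also have "emeasure lborel (box (tangent_part l) (tangent_part u)) = (\<Prod>i\<in>UNIV. tangent_part u $ i - tangent_part l $ i)"
  proof -
    have "\<And>b. b \<in> Basis \<Longrightarrow> tangent_part l \<bullet> b \<le> tangent_part u \<bullet> b"
      using le' forall_3[of "\<lambda>i. tangent_part l $ i \<le> tangent_part u $ i"]
      by (auto simp: Basis_vec_def inner_axis)
    then show ?thesis
      by (simp add: emeasure_lborel_box_eq prod_Basis_vec inner_axis)
  qed
  also have "emeasure lborel {l$4<..<u$4} = ennreal (u$4 - l$4)"
    using le' by simp
  also have "ennreal (\<Prod>i\<in>UNIV. tangent_part u $ i - tangent_part l $ i) * ennreal (u$4 - l$4) = ennreal (\<Prod>b\<in>Basis. (u - l) \<bullet> b)"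
  proof -
    have "(\<Prod>i\<in>UNIV. tangent_part u $ i - tangent_part l $ i) * (u$4 - l$4) = (\<Prod>b\<in>Basis. (u - l) \<bullet> b)"
      unfolding prod_Basis_vec UNIV_3 UNIV_4 by (simp add: inner_axis)
    then show ?thesis
      by (subst ennreal_mult''[symmetric]) (use le'[of 4] in simp_all)
  qed
  finally show "emeasure (distr (lborel \<Otimes>\<^sub>M lborel) borel (\<lambda>(y, s). join y s)) (box l u) = ennreal (\<Prod>b\<in>Basis. (u - l) \<bullet> b)" .
qed simp

lemma integral_join_product:
  fixes q :: "real^3 \<Rightarrow> real" and h :: "real \<Rightarrow> real"
  assumes q: "integrable lborel q" and h: "integrable lborel h"
  shows "(LINT w|lborel. h (w$4) * q (tangent_part w)) = (LINT s|lborel. h s) * (LINT y|lborel. q y)"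
proof -
  have [measurable]: "q \<in> borel_measurable borel" "h \<in> borel_measurable borel"
    using q h by auto
  have [measurable]: "tangent_part \<in> borel_measurable borel"
    by (intro borel_measurable_continuous_onI continuous_intros)
  have "(LINT w|lborel. h (w$4) * q (tangent_part w)) =
      (LINT w|(distr (lborel \<Otimes>\<^sub>M lborel) borel (\<lambda>(y, s). join y s)). h (w$4) * q (tangent_part w))"
    by (simp add: lborel_join)
  also have "\<dots> = (LINT z|(lborel \<Otimes>\<^sub>M lborel). h (snd z) * q (fst z))"
    by (subst integral_distr) (auto simp: split_beta)
  also have "\<dots> = (LINT y|lborel. (LINT s|lborel. h s * q y))"
  proof -
    have "integrable (lborel \<Otimes>\<^sub>M lborel) (\<lambda>z. h (snd z) * q (fst z))"
    proof (rule lborel_pair.Fubini_integrable)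
      show "integrable lborel (\<lambda>y. LINT s|lborel. norm (h (snd (y, s)) * q (fst (y, s))))"
        using q by (simp add: abs_mult)
      show "AE y in lborel. integrable lborel (\<lambda>s. h (snd (y, s)) * q (fst (y, s)))"
        using h by simp
    qed measurable
    from lborel_pair.integral_fst'[OF this] show ?thesis by simp
  qed
  also have "\<dots> = (LINT s|lborel. h s) * (LINT y|lborel. q y)"
    by simp
  finally show ?thesis .
qed

section \<open>Product rule and locality of the divergence\<close>

lemma divergence_eqI:
  "(F has_derivative A) (at p) \<Longrightarrow> divergence F p = (\<Sum>b\<in>Basis. A b \<bullet> b)"
  unfolding divergence_def by (simp add: frechet_derivative_at[symmetric])

lemma divergence_scaleR:
  fixes F :: "'a::euclidean_space \<Rightarrow> 'a"
  assumes h: "(h has_derivative (\<lambda>v. d \<bullet> v)) (at p)" and F: "F differentiable (at p)"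
  shows "(\<lambda>p. h p *\<^sub>R F p) differentiable (at p)"
    and "divergence (\<lambda>p. h p *\<^sub>R F p) p = h p * divergence F p + d \<bullet> F p"
proof -
  have "(F has_derivative frechet_derivative F (at p)) (at p)"
    using F by (simp add: frechet_derivative_works)
  with h have D: "((\<lambda>p. h p *\<^sub>R F p) has_derivative (\<lambda>v. h p *\<^sub>R frechet_derivative F (at p) v + (d \<bullet> v) *\<^sub>R F p)) (at p)"
    by (rule has_derivative_scaleR)
  then show "(\<lambda>p. h p *\<^sub>R F p) differentiable (at p)"
    by (rule differentiableI)
  have "d \<bullet> F p = (\<Sum>b\<in>Basis. (d \<bullet> b) * (F p \<bullet> b))"
    by (rule euclidean_inner)
  then show "divergence (\<lambda>p. h p *\<^sub>R F p) p = h p * divergence F p + d \<bullet> F p"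
    unfolding divergence_eqI[OF D] by (simp add: divergence_def inner_add_left sum.distrib sum_distrib_left)
qed

lemma divergence_cong_open:
  assumes "open S" "p \<in> S" "\<And>x. x \<in> S \<Longrightarrow> F x = G x"
  shows "F differentiable (at p) \<Longrightarrow> G differentiable (at p)" "F differentiable (at p) \<Longrightarrow> divergence G p = divergence F p"
proof -
  assume "F differentiable (at p)"
  then have D: "(F has_derivative frechet_derivative F (at p)) (at p)"
    by (simp add: frechet_derivative_works)
  then have "(G has_derivative frechet_derivative F (at p)) (at p)"
    by (rule has_derivative_transform_within_open[OF _ assms])
  then show "G differentiable (at p)" "divergence G p = divergence F p"
    using divergence_eqI D by (metis differentiableI, metis)
qed

text \<open>\<open>N\<close> and the complement of \<open>Q\<close> form an open cover of the space,
  and the extended function is continuous on each of them.\<close>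

lemma zero_extension:
  fixes f :: "'a::euclidean_space \<Rightarrow> real"
  assumes "open N" "compact Q" "Q \<subseteq> N" "continuous_on N f" "\<And>p. p \<in> N - Q \<Longrightarrow> f p = 0"
  shows "continuous_on UNIV (\<lambda>p. indicator N p * f p)" "integrable lborel (\<lambda>p. indicator N p * f p)"
proof -
  have "continuous_on N (\<lambda>p. indicator N p * f p)"
    using assms(4) by (rule continuous_on_eq) simp
  moreover have "continuous_on (- Q) (\<lambda>p. indicator N p * f p)"
    using assms(5) by (intro continuous_on_eq[OF continuous_on_const[of _ 0]]) (auto simp: indicator_def)
  ultimately have "continuous_on (N \<union> - Q) (\<lambda>p. indicator N p * f p)"
    using assms(1,2) by (intro continuous_on_open_Un) (auto intro: compact_imp_closed)
  moreover have "N \<union> - Q = UNIV"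
    using assms(3) by auto
  ultimately show cont: "continuous_on UNIV (\<lambda>p. indicator N p * f p)"
    by simp
  have "integrable lborel (\<lambda>p. indicator Q p *\<^sub>R (indicator N p * f p))"
    by (intro borel_integrable_compact assms continuous_on_subset[OF cont]) auto
  moreover have "(\<lambda>p. indicator Q p *\<^sub>R (indicator N p * f p)) = (\<lambda>p. indicator N p * f p)"
    using assms(3,5) by (auto simp: indicator_def fun_eq_iff)
  ultimately show "integrable lborel (\<lambda>p. indicator N p * f p)"
    by simp
qed

section \<open>The divergence theorem for fields supported in a chart\<close>

context normal_chart
begin

text \<open>The flux density of \<open>F\<close> through the translate \<open>K + s m\<close>, in the parameter of the patch; for
  \<open>s = 0\<close> it is the surface flux density.\<close>

definition level_flux :: "(quat \<Rightarrow> quat) \<Rightarrow> real^3 \<Rightarrow> real \<Rightarrow> real" where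
  "level_flux F y s = \<bar>normal_minors (J y) \<bullet> m\<bar> * (grad_height (\<phi> y) \<bullet> F (\<phi> y + s *\<^sub>R m))"

lemma abs_normal_minors_inner:
  assumes y: "y \<in> B"
  shows "\<bar>normal_minors (J y) \<bullet> m\<bar> = area_density \<phi> y * (n (\<phi> y) \<bullet> m)"
proof -
  have yV: "y \<in> V"
    using y B_subset_V by blast
  note o = unit_outer_normalD[OF outer[OF \<phi>_in_K[OF y]]]
  have "\<bar>det (bordered (J y) m)\<bar> = sqrt (det (transpose (J y) ** J y)) * \<bar>n (\<phi> y) \<bullet> m\<bar>"
    by (rule abs_det_bordered[OF o(3)[OF patch yV refl] o(1) patchesD(3)[OF patch yV]])
  then show ?thesis
    using normal_inner_pos[OF y] by (simp add: inner_normal_minors area_density_eq_sqrt)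
qed

text \<open>The volume Jacobian is the area density times \<open>n (\<phi> y) \<bullet> m\<close>,
  and the same factor turns \<open>grad_height\<close> into the unit normal.\<close>

lemma level_flux_0:
  assumes y: "y \<in> B"
  shows "level_flux F y 0 = area_density \<phi> y * (n (\<phi> y) \<bullet> F (\<phi> y))"
proof -
  have "n (\<phi> y) \<bullet> F (\<phi> y) = (n (\<phi> y) \<bullet> m) * (grad_height (\<phi> y) \<bullet> F (\<phi> y))"
    using normal_eq_grad_height[OF y] by (metis inner_scaleR_left)
  then show ?thesis
    using abs_normal_minors_inner[OF y] by (simp add: level_flux_def)
qed

lemma abs_level_flux_le:
  assumes y: "y \<in> B"
  shows "\<bar>level_flux F y s\<bar> \<le> area_density \<phi> y * norm (F (\<phi> y + s *\<^sub>R m))"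
proof -
  let ?n = "n (\<phi> y)"
  have "level_flux F y s = area_density \<phi> y * (((?n \<bullet> m) *\<^sub>R grad_height (\<phi> y)) \<bullet> F (\<phi> y + s *\<^sub>R m))"
    by (simp add: level_flux_def abs_normal_minors_inner[OF y])
  also have "\<dots> = area_density \<phi> y * (?n \<bullet> F (\<phi> y + s *\<^sub>R m))"
    by (simp only: normal_eq_grad_height[OF y, symmetric])
  also have "\<bar>\<dots>\<bar> \<le> area_density \<phi> y * (norm ?n * norm (F (\<phi> y + s *\<^sub>R m)))"
    using area_density_nonneg by (simp add: abs_mult mult_left_mono Cauchy_Schwarz_ineq2)
  finally show ?thesis
    using unit_outer_normalD(1)[OF outer[OF \<phi>_in_K[OF y]]] by simp
qed

lemma grad_height_nonzero:
  assumes p: "p \<in> N" shows "grad_height p \<noteq> 0"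
proof -
  have "normal_minors (J (tangent_part (g p))) \<bullet> m \<noteq> 0"
    using det_bordered_nonzero[OF g_in_W(1)[OF p]] by (simp add: inner_normal_minors)
  then show ?thesis
    by (auto simp: grad_height_def Let_def)
qed

lemma continuous_on_sgn_grad_height: "continuous_on N (\<lambda>p. sgn (grad_height p))"
  using grad_height_nonzero by (intro continuous_on_sgn continuous_on_grad_height) auto

text \<open>The normal is a positive multiple of \<open>grad_height\<close> of norm 1. As
  \<open>n\<close> is prescribed point by point, this formula is the source of its continuity on
  \<open>K\<close> and of the measurability of the surface integrands.\<close>

lemma normal_eq_sgn_grad_height:
  assumes y: "y \<in> B" shows "n (\<phi> y) = sgn (grad_height (\<phi> y))"
proof -
  have "sgn (n (\<phi> y)) = sgn (grad_height (\<phi> y))"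
    using normal_eq_grad_height[OF y] normal_inner_pos[OF y]
    by (metis mult_1 one_neq_zero scaleR_one sgn_pos sgn_scaleR)
  moreover have "sgn (n (\<phi> y)) = n (\<phi> y)"
    using unit_outer_normalD(1)[OF outer[OF \<phi>_in_K[OF y]]] by (simp add: sgn_div_norm)
  ultimately show ?thesis by simp
qed

lemma continuous_on_level_flux:
  assumes F: "continuous_on UNIV F" and f: "continuous_on S f" "f ` S \<subseteq> B" and h: "continuous_on S h"
  shows "continuous_on S (\<lambda>x. level_flux F (f x) (h x))"
proof -
  have \<phi>: "continuous_on S (\<lambda>x. \<phi> (f x))"
    by (rule continuous_on_compose2[OF patch_continuous[OF patch] f(1)]) (use f(2) B_subset_V in auto)
  have "continuous_on S (\<lambda>x. normal_minors (J (f x)))"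
    by (rule continuous_on_compose2[OF continuous_on_normal_minors f])
  moreover have "continuous_on S (\<lambda>x. grad_height (\<phi> (f x)))"
    by (rule continuous_on_compose2[OF continuous_on_grad_height \<phi>]) (use f(2) \<phi>_in_N in auto)
  moreover have "continuous_on S (\<lambda>x. F (\<phi> (f x) + h x *\<^sub>R m))"
    by (rule continuous_on_compose2[OF F]) (auto intro!: continuous_intros \<phi> h)
  ultimately show ?thesis
    unfolding level_flux_def by (intro continuous_intros)
qed

section \<open>Cutting off a field near the hypersurface\<close>

context
  fixes F :: "quat \<Rightarrow> quat" and Q :: "quat set"
  assumes diff: "\<And>p. F differentiable (at p)" and div: "continuous_on UNIV (divergence F)"
    and Q: "compact Q" "Q \<subseteq> N" and supp: "\<And>p. p \<notin> Q \<Longrightarrow> F p = 0"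
begin

lemma continuous_on_F: "continuous_on UNIV F"
  by (rule differentiable_at_imp_continuous_on[OF diff])

lemma divergence_outside: "p \<notin> Q \<Longrightarrow> divergence F p = 0"
  using frechet_derivative_eq_0_outside(2)[OF compact_imp_closed[OF Q(1)] supp]
  by (simp add: divergence_def)

lemma integrable_cutoff:
  "integrable lborel (\<lambda>p. indicator N p * (smooth_step (- (g p $ 4) / \<delta>) * divergence F p))"
  "integrable lborel (\<lambda>p. indicator N p * (1 / \<delta> * hat (- (g p $ 4) / \<delta>) * (grad_height p \<bullet> F p)))"
  "continuous_on UNIV (\<lambda>p. indicator N p * (smooth_step (- (g p $ 4) / \<delta>) * divergence F p))"
  "continuous_on UNIV (\<lambda>p. indicator N p * (1 / \<delta> * hat (- (g p $ 4) / \<delta>) * (grad_height p \<bullet> F p)))"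
proof -
  have "continuous_on N (\<lambda>p. - (g p $ 4) / \<delta>)"
    unfolding divide_inverse by (intro continuous_intros continuous_on_g)
  note * = this continuous_on_subset[OF div subset_UNIV] continuous_on_subset[OF continuous_on_F subset_UNIV] continuous_on_grad_height
  have c: "continuous_on N (\<lambda>p. smooth_step (- (g p $ 4) / \<delta>) * divergence F p)"
    "continuous_on N (\<lambda>p. 1 / \<delta> * hat (- (g p $ 4) / \<delta>) * (grad_height p \<bullet> F p))"
    by (intro continuous_intros *)+
  show "integrable lborel (\<lambda>p. indicator N p * (smooth_step (- (g p $ 4) / \<delta>) * divergence F p))"
    "continuous_on UNIV (\<lambda>p. indicator N p * (smooth_step (- (g p $ 4) / \<delta>) * divergence F p))"
    by (rule zero_extension[OF open_N Q c(1)]; simp add: divergence_outside)+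
  show "integrable lborel (\<lambda>p. indicator N p * (1 / \<delta> * hat (- (g p $ 4) / \<delta>) * (grad_height p \<bullet> F p)))"
    "continuous_on UNIV (\<lambda>p. indicator N p * (1 / \<delta> * hat (- (g p $ 4) / \<delta>) * (grad_height p \<bullet> F p)))"
    by (rule zero_extension[OF open_N Q c(2)]; simp add: supp)+
qed

text \<open>The cutoff is 0 at nonnegative height and 1 below height \<open>- \<delta>\<close>. The
  product rule splits the divergence of the cut off field, whose integral vanishes, into the two
  integrands; the minus sign in the argument of the step puts the second on the other side.\<close>

lemma cutoff_identity:
  assumes \<delta>: "\<delta> > 0"
  shows "(LINT p|lborel. indicator N p * (smooth_step (- (g p $ 4) / \<delta>) * divergence F p)) =
    (LINT p|lborel. indicator N p * (1 / \<delta> * hat (- (g p $ 4) / \<delta>) * (grad_height p \<bullet> F p)))"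
proof -
  define H where "H = (\<lambda>p. (indicator N p * smooth_step (- (g p $ 4) / \<delta>)) *\<^sub>R F p)"
  have inside: "H differentiable (at p)"
    "divergence H p = indicator N p * (smooth_step (- (g p $ 4) / \<delta>) * divergence F p)
      - indicator N p * (1 / \<delta> * hat (- (g p $ 4) / \<delta>) * (grad_height p \<bullet> F p))" if p: "p \<in> N" for p
  proof -
    define cut where "cut = (\<lambda>p. smooth_step (- (g p $ 4) / \<delta>))"
    have "((\<lambda>p. - (g p $ 4) / \<delta>) has_derivative (\<lambda>v. - (grad_height p \<bullet> v) / \<delta>)) (at p)"
      using \<delta> by (auto intro!: derivative_eq_intros height_derivative[OF p])
    then have "(cut has_derivative (\<lambda>v. hat (- (g p $ 4) / \<delta>) * (- (grad_height p \<bullet> v) / \<delta>))) (at p)"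
      unfolding cut_def using DERIV_smooth_step[of "- (g p $ 4) / \<delta>"]
      by (intro has_derivative_compose[of "\<lambda>p. - (g p $ 4) / \<delta>" _ p UNIV smooth_step "\<lambda>v. hat (- (g p $ 4) / \<delta>) * v"])
        (auto simp: has_field_derivative_def)
    then have "(cut has_derivative (\<lambda>v. ((- hat (- (g p $ 4) / \<delta>) / \<delta>) *\<^sub>R grad_height p) \<bullet> v)) (at p)"
      by (rule has_derivative_eq_rhs) (auto simp: fun_eq_iff)
    note D = divergence_scaleR[OF this diff[of p]]
    have eq: "cut x *\<^sub>R F x = H x" if "x \<in> N" for x
      using that by (simp add: H_def cut_def)
    show "H differentiable (at p)"
      by (rule divergence_cong_open(1)[OF open_N p eq D(1)])
    have "divergence H p = divergence (\<lambda>x. cut x *\<^sub>R F x) p"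
      by (rule divergence_cong_open(2)[OF open_N p eq D(1)])
    then show "divergence H p = indicator N p * (smooth_step (- (g p $ 4) / \<delta>) * divergence F p)
      - indicator N p * (1 / \<delta> * hat (- (g p $ 4) / \<delta>) * (grad_height p \<bullet> F p))"
      using p D(2) by (simp add: cut_def)
  qed
  have H0: "H p = 0" if "p \<notin> Q" for p
    using that by (simp add: H_def supp)
  have outside: "H differentiable (at p)" "divergence H p = 0" if "p \<notin> Q" for p
  proof -
    note D = frechet_derivative_eq_0_outside[of Q H, OF compact_imp_closed[OF Q(1)] H0 that]
    show "H differentiable (at p)"
      by (rule differentiableI[OF D(1)])
    show "divergence H p = 0"
      by (simp add: divergence_def D(2))
  qed
  have div_H: "divergence H = (\<lambda>p. indicator N p * (smooth_step (- (g p $ 4) / \<delta>) * divergence F p)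
      - indicator N p * (1 / \<delta> * hat (- (g p $ 4) / \<delta>) * (grad_height p \<bullet> F p)))"
  proof
    show "divergence H p = indicator N p * (smooth_step (- (g p $ 4) / \<delta>) * divergence F p)
      - indicator N p * (1 / \<delta> * hat (- (g p $ 4) / \<delta>) * (grad_height p \<bullet> F p))" for p
      using inside(2)[of p] outside(2)[of p] Q(2) supp[of p] divergence_outside[of p]
      by (cases "p \<in> Q") auto
  qed
  have "(LINT p|lborel. divergence H p) = 0"
  proof (rule integral_divergence_compact_support(2)[OF _ _ Q(1) H0])
    show "H differentiable (at p)" for p
      using inside(1)[of p] outside(1)[of p] Q(2) by blast
    show "continuous_on UNIV (divergence H)"
      unfolding div_H by (intro continuous_on_diff integrable_cutoff)
  qed
  then show ?thesis
    unfolding div_H using integrable_cutoff[of \<delta>] by simp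
qed

abbreviation "slab \<equiv> {w::real^4. tangent_part w \<in> B \<and> 0 < w$4 \<and> w$4 < 1}"

lemma open_slab: "open slab"
proof -
  have "slab = tangent_part -` B \<inter> (\<lambda>w. w$4) -` {0<..<1}"
    by auto
  then show ?thesis
    by (auto intro!: open_Int open_vimage continuous_intros)
qed

lemma slab_in_W:
  assumes "w \<in> slab" "0 < \<delta>" "\<delta> \<le> a"
  shows "join (tangent_part w) (- \<delta> * w$4) \<in> W"
proof -
  have "\<delta> * w$4 < \<delta> * 1"
    using assms by (intro mult_strict_left_mono) auto
  then have "\<delta> * w$4 < a"
    using assms(3) by linarith
  then show ?thesis
    using assms by (simp add: abs_mult)
qed

text \<open>Substitute \<open>p = \<phi> y - \<delta> t m\<close> with \<open>0 < t < 1\<close>; the factor \<open>1 / \<delta>\<close> is absorbed by the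
  Jacobian.\<close>

lemma collar_integral:
  assumes \<delta>: "0 < \<delta>" "\<delta> \<le> a"
  shows "(LINT p|lborel. indicator N p * (1 / \<delta> * hat (- (g p $ 4) / \<delta>) * (grad_height p \<bullet> F p))) =
    (LINT w:slab|lborel. hat (w$4) * level_flux F (tangent_part w) (- \<delta> * w$4))"
proof -
  define T where "T = thicken \<phi> (- \<delta> *\<^sub>R m)"
  define k where "k = (\<lambda>p. indicator N p * (1 / \<delta> * hat (- (g p $ 4) / \<delta>) * (grad_height p \<bullet> F p)))"
  have T: "T w = thicken \<phi> m (join (tangent_part w) (- \<delta> * w$4))" for w
    by (simp add: T_def thicken_def)
  have T_N: "T w \<in> N" and g_T: "g (T w) = join (tangent_part w) (- \<delta> * w$4)" if "w \<in> slab" for w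
    unfolding T using thicken_in_N[OF slab_in_W[OF that \<delta>]] g_thicken[OF slab_in_W[OF that \<delta>]] by auto
  have inj: "inj_on T slab"
  proof (rule inj_onI)
    fix w w' assume *: "w \<in> slab" "w' \<in> slab" "T w = T w'"
    then have "join (tangent_part w) (- \<delta> * w$4) = join (tangent_part w') (- \<delta> * w'$4)"
      using g_T[of w] g_T[of w'] by simp
    then have "tangent_part w = tangent_part w'" "- \<delta> * w$4 = - \<delta> * w'$4"
      by (metis tangent_part_join, metis join_nth(4))
    then have "join (tangent_part w) (w$4) = join (tangent_part w') (w'$4)"
      using \<delta>(1) by simp
    then show "w = w'"
      by (simp only: join_tangent_part)
  qed
  have image: "T ` slab = N \<inter> (\<lambda>p. g p $ 4) -` {-\<delta><..<0}"
  proof (intro subset_antisym subsetI)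
    fix p assume "p \<in> T ` slab"
    then obtain w where "w \<in> slab" "p = T w" by blast
    then show "p \<in> N \<inter> (\<lambda>p. g p $ 4) -` {-\<delta><..<0}"
      using T_N g_T \<delta>(1) by auto
  next
    fix p assume p: "p \<in> N \<inter> (\<lambda>p. g p $ 4) -` {-\<delta><..<0}"
    define w where "w = join (tangent_part (g p)) (- (g p $ 4) / \<delta>)"
    have "w \<in> slab"
      using p \<delta> g_in_W(1)[of p] by (auto simp: w_def field_simps)
    moreover have "T w = p"
      using thicken_g[of p] p \<delta> by (simp add: T w_def)
    ultimately show "p \<in> T ` slab" by blast
  qed
  have open_image: "open (T ` slab)"
    unfolding image by (intro continuous_open_preimage continuous_intros continuous_on_g open_N open_greaterThanLessThan)
  have der: "(T has_derivative (\<lambda>z. bordered (J (tangent_part w)) (- \<delta> *\<^sub>R m) *v z)) (at w within slab)"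
    if "w \<in> slab" for w
    unfolding T_def
    by (rule has_derivative_at_withinI[OF thicken_has_derivative[OF V smooth]]) (use that B_subset_V in auto)
  have integrand: "\<bar>det (matrix (\<lambda>z. bordered (J (tangent_part w)) (- \<delta> *\<^sub>R m) *v z))\<bar> * k (T w) =
      hat (w$4) * level_flux F (tangent_part w) (- \<delta> * w$4)" if w: "w \<in> slab" for w
  proof -
    have "\<bar>det (matrix (\<lambda>z. bordered (J (tangent_part w)) (- \<delta> *\<^sub>R m) *v z))\<bar> = \<delta> * \<bar>normal_minors (J (tangent_part w)) \<bullet> m\<bar>"
      using \<delta>(1) by (simp add: abs_mult flip: inner_normal_minors)
    moreover have "grad_height (T w) = grad_height (\<phi> (tangent_part w))"
      unfolding T using grad_height_thicken[OF slab_in_W[OF w \<delta>]] by simp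
    moreover have "T w = \<phi> (tangent_part w) + (- \<delta> * w$4) *\<^sub>R m"
      by (simp add: T)
    ultimately show ?thesis
      using T_N[OF w] g_T[OF w] \<delta>(1) by (simp add: k_def level_flux_def)
  qed
  have cont: "continuous_on slab (\<lambda>w. hat (w$4) * level_flux F (tangent_part w) (- \<delta> * w$4))"
    by (intro continuous_intros continuous_on_level_flux continuous_on_F) auto
  have k: "integrable lborel k"
    unfolding k_def by (rule integrable_cutoff)
  have "(LINT p|lborel. k p) = (LINT p:T ` slab|lborel. k p)"
  proof -
    \<comment> \<open>Off the collar \<open>hat\<close> vanishes, also at the heights 0 and
      \<open>- \<delta>\<close>, which the open image leaves out.\<close>
    have "indicator (T ` slab) p *\<^sub>R k p = k p" for p
    proof (cases "p \<in> N \<and> \<not> (- \<delta> < g p $ 4 \<and> g p $ 4 < 0)")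
      case True
      then have "- (g p $ 4) / \<delta> \<le> 0 \<or> - (g p $ 4) / \<delta> \<ge> 1"
        using \<delta>(1) by (auto simp: field_simps)
      then show ?thesis
        by (simp add: k_def hat_eq_0)
    next
      case False
      then have "p \<in> T ` slab \<or> p \<notin> N"
        unfolding image by auto
      then show ?thesis
        by (auto simp: k_def)
    qed
    then show ?thesis
      by (simp only: set_lebesgue_integral_def)
  qed
  also have "\<dots> = (LINT w:slab|lborel. \<bar>det (matrix (\<lambda>z. bordered (J (tangent_part w)) (- \<delta> *\<^sub>R m) *v z))\<bar> * k (T w))"
  proof (rule set_integral_change_of_variables[symmetric, OF _ der inj])
    show "set_integrable lborel (T ` slab) k"
      unfolding set_integrable_def using open_image k by (intro integrable_mult_indicator) auto
    have "(\<lambda>w. indicator slab w *\<^sub>R (hat (w$4) * level_flux F (tangent_part w) (- \<delta> * w$4))) \<in> borel_measurable borel"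
      using open_slab by (intro borel_measurable_continuous_on_indicator cont) auto
    then show "(\<lambda>w. indicator slab w *\<^sub>R (\<bar>det (matrix (\<lambda>z. bordered (J (tangent_part w)) (- \<delta> *\<^sub>R m) *v z))\<bar> * k (T w))) \<in> borel_measurable borel"
    proof (rule measurable_cong[THEN iffD1, rotated])
      show "indicator slab w *\<^sub>R (hat (w$4) * level_flux F (tangent_part w) (- \<delta> * w$4)) =
          indicator slab w *\<^sub>R (\<bar>det (matrix (\<lambda>z. bordered (J (tangent_part w)) (- \<delta> *\<^sub>R m) *v z))\<bar> * k (T w))" for w
        using integrand[of w] by (cases "w \<in> slab") simp_all
    qed
  qed (use open_slab in auto)
  also have "\<dots> = (LINT w:slab|lborel. hat (w$4) * level_flux F (tangent_part w) (- \<delta> * w$4))"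
    unfolding set_lebesgue_integral_def
  proof (intro Bochner_Integration.integral_cong)
    show "indicator slab w *\<^sub>R (\<bar>det (matrix (\<lambda>z. bordered (J (tangent_part w)) (- \<delta> *\<^sub>R m) *v z))\<bar> * k (T w)) =
        indicator slab w *\<^sub>R (hat (w$4) * level_flux F (tangent_part w) (- \<delta> * w$4))" for w
      using integrand[of w] by (cases "w \<in> slab") simp_all
  qed simp
  finally show ?thesis
    by (simp only: k_def)
qed

text \<open>The area density is bounded on the closed parameter ball and \<open>F\<close> has
  compact support. The bound is uniform in \<open>s\<close>, as dominated convergence
  requires.\<close>

lemma bounded_level_flux:
  obtains M where "\<And>y s. y \<in> B \<Longrightarrow> \<bar>level_flux F y s\<bar> \<le> M" "M \<ge> 0"
proof -
  have "compact (area_density \<phi> ` cball y0 a)"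
    by (intro compact_continuous_image continuous_on_subset[OF continuous_on_area_density[OF patch] cball] compact_cball)
  then obtain A where A: "\<And>y. y \<in> cball y0 a \<Longrightarrow> norm (area_density \<phi> y) \<le> A"
    by (meson bounded_iff compact_imp_bounded imageI)
  have "compact (F ` Q)"
    by (intro compact_continuous_image continuous_on_subset[OF continuous_on_F] Q) auto
  then obtain M where M: "\<And>p. p \<in> Q \<Longrightarrow> norm (F p) \<le> M"
    by (meson bounded_iff compact_imp_bounded imageI)
  have M': "norm (F p) \<le> \<bar>M\<bar>" for p
    using M[of p] supp[of p] by (cases "p \<in> Q") auto
  show thesis
  proof (rule that[of "\<bar>A\<bar> * \<bar>M\<bar>"])
    show "\<bar>level_flux F y s\<bar> \<le> \<bar>A\<bar> * \<bar>M\<bar>" if "y \<in> B" for y s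
    proof -
      have "\<bar>level_flux F y s\<bar> \<le> area_density \<phi> y * norm (F (\<phi> y + s *\<^sub>R m))"
        by (rule abs_level_flux_le[OF that])
      also have "\<dots> \<le> \<bar>A\<bar> * \<bar>M\<bar>"
        using A[of y] M' that by (intro mult_mono) auto
      finally show ?thesis .
    qed
  qed simp
qed

text \<open>On \<open>N\<close> the cutoffs tend to the indicator of \<open>C\<close>, while the
  collar integrals tend to the flux at height 0 weighted by \<open>hat\<close>, which integrates to
  1. Equating the two limits gives the claim.\<close>

theorem local_divergence_theorem:
  assumes K: "closed K" and C: "C \<in> sets borel"
  shows "(LINT p:K|surface_measure K. n p \<bullet> F p) = (LINT p:C|lborel. divergence F p)"
proof -
  \<comment> \<open>With \<open>Suc k\<close> every width is defined and at most \<open>a\<close>,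
    so the collar stays inside the chart.\<close>
  define \<delta> where "\<delta> = (\<lambda>k. a / real (Suc k))"
  have \<delta>: "0 < \<delta> k" "\<delta> k \<le> a" for k
    using a by (auto simp: \<delta>_def field_simps)
  have \<delta>_lim: "\<delta> \<longlonglongrightarrow> 0"
    unfolding \<delta>_def by (rule LIMSEQ_Suc[OF lim_const_over_n])
  obtain M where M: "\<And>y s. y \<in> B \<Longrightarrow> \<bar>level_flux F y s\<bar> \<le> M" "M \<ge> 0"
    by (rule bounded_level_flux) blast
  have cont_0: "continuous_on B (\<lambda>y. level_flux F y 0)"
    by (intro continuous_on_level_flux continuous_on_F continuous_intros) auto
  have slab_sets: "slab \<in> sets borel"
    using open_slab by simp
  have collar_meas: "(\<lambda>w. indicator slab w *\<^sub>R (hat (w$4) * level_flux F (tangent_part w) (r * w$4))) \<in> borel_measurable borel" for r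
    by (intro borel_measurable_continuous_on_indicator slab_sets continuous_intros continuous_on_level_flux continuous_on_F) auto
  have collar: "(\<lambda>k. LINT w:slab|lborel. hat (w$4) * level_flux F (tangent_part w) (- \<delta> k * w$4))
      \<longlonglongrightarrow> (LINT w:slab|lborel. hat (w$4) * level_flux F (tangent_part w) 0)"
    unfolding set_lebesgue_integral_def
  proof (rule integral_dominated_convergence[where w = "\<lambda>w. indicator slab w *\<^sub>R (2 * M)"])
    show "(\<lambda>w. indicator slab w *\<^sub>R (hat (w$4) * level_flux F (tangent_part w) 0)) \<in> borel_measurable lborel"
      using collar_meas[of 0] by simp
    show "(\<lambda>w. indicator slab w *\<^sub>R (hat (w$4) * level_flux F (tangent_part w) (- \<delta> k * w$4))) \<in> borel_measurable lborel" for k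
      using collar_meas[of "- \<delta> k"] by simp
    have "bounded slab"
    proof (rule bounded_subset[OF bounded_ball])
      show "slab \<subseteq> ball 0 (norm y0 + a + 1)"
      proof
        fix w assume w: "w \<in> slab"
        have "norm w \<le> norm (tangent_part w) + \<bar>w$4\<bar>"
          by (rule norm_le_tangent_part)
        moreover have "norm (tangent_part w) \<le> norm y0 + dist y0 (tangent_part w)"
          by (metis dist_norm norm_minus_commute norm_triangle_sub)
        ultimately show "w \<in> ball 0 (norm y0 + a + 1)"
          using w by simp
      qed
    qed
    then have "emeasure lborel slab < \<infinity>"
      by (rule emeasure_bounded_finite)
    then show "integrable lborel (\<lambda>w. indicator slab w *\<^sub>R (2 * M))"
      using slab_sets by (intro integrable_scaleR_left integrable_real_indicator) auto
    show "AE w in lborel. (\<lambda>k. indicator slab w *\<^sub>R (hat (w$4) * level_flux F (tangent_part w) (- \<delta> k * w$4)))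
        \<longlonglongrightarrow> indicator slab w *\<^sub>R (hat (w$4) * level_flux F (tangent_part w) 0)"
    proof (rule AE_I2)
      fix w :: "real^4"
      show "(\<lambda>k. indicator slab w *\<^sub>R (hat (w$4) * level_flux F (tangent_part w) (- \<delta> k * w$4)))
        \<longlonglongrightarrow> indicator slab w *\<^sub>R (hat (w$4) * level_flux F (tangent_part w) 0)"
      proof (cases "w \<in> slab")
        case True
        then have "continuous_on UNIV (level_flux F (tangent_part w))"
          by (intro continuous_on_level_flux continuous_on_F continuous_intros) auto
        then have "isCont (level_flux F (tangent_part w)) 0"
          by (simp add: continuous_on_eq_continuous_at)
        moreover have "(\<lambda>k. - \<delta> k * w$4) \<longlonglongrightarrow> 0"
          using tendsto_mult[OF tendsto_minus[OF \<delta>_lim] tendsto_const[of "w$4"]] by simp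
        ultimately have "(\<lambda>k. level_flux F (tangent_part w) (- \<delta> k * w$4)) \<longlonglongrightarrow> level_flux F (tangent_part w) 0"
          by (rule isCont_tendsto_compose)
        then show ?thesis
          by (intro tendsto_intros)
      qed simp
    qed
    show "AE w in lborel. norm (indicator slab w *\<^sub>R (hat (w$4) * level_flux F (tangent_part w) (- \<delta> k * w$4))) \<le> indicator slab w *\<^sub>R (2 * M)" for k
    proof (rule AE_I2)
      fix w :: "real^4"
      have "\<bar>hat (w$4)\<bar> * \<bar>level_flux F (tangent_part w) (- \<delta> k * w$4)\<bar> \<le> 2 * M" if "w \<in> slab"
        using that hat_nonneg hat_le_2 M by (intro mult_mono) auto
      then show "norm (indicator slab w *\<^sub>R (hat (w$4) * level_flux F (tangent_part w) (- \<delta> k * w$4))) \<le> indicator slab w *\<^sub>R (2 * M)"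
        by (auto simp: indicator_def abs_mult)
    qed
  qed
  have "(LINT w:slab|lborel. hat (w$4) * level_flux F (tangent_part w) 0) =
      (LINT w|lborel. hat (w$4) * (indicator B (tangent_part w) * level_flux F (tangent_part w) 0))"
    unfolding set_lebesgue_integral_def
  proof (intro Bochner_Integration.integral_cong)
    show "indicator slab w *\<^sub>R (hat (w$4) * level_flux F (tangent_part w) 0) =
        hat (w$4) * (indicator B (tangent_part w) * level_flux F (tangent_part w) 0)" for w
      by (cases "0 < w$4 \<and> w$4 < 1") (auto simp: indicator_def hat_eq_0 not_less)
  qed simp
  \<comment> \<open>At flux height 0 the height coordinate enters through \<open>hat\<close> alone,
    so the integral is a product.\<close>
  also have "\<dots> = (LINT s|lborel. hat s) * (LINT y|lborel. indicator B y * level_flux F y 0)"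
  proof (rule integral_join_product[OF _ integral_hat(1)])
    show "integrable lborel (\<lambda>y. indicator B y * level_flux F y 0)"
    proof (rule Bochner_Integration.integrable_bound[of lborel "\<lambda>y. indicator B y *\<^sub>R M"])
      have "emeasure lborel B < \<infinity>"
        by (intro emeasure_bounded_finite bounded_ball)
      then show "integrable lborel (\<lambda>y. indicator B y *\<^sub>R M)"
        by (intro integrable_scaleR_left integrable_real_indicator) auto
      show "(\<lambda>y. indicator B y * level_flux F y 0) \<in> borel_measurable lborel"
        using borel_measurable_continuous_on_indicator[OF _ cont_0] by simp
      show "AE y in lborel. norm (indicator B y * level_flux F y 0) \<le> norm (indicator B y *\<^sub>R M)"
        using M by (auto simp: indicator_def abs_mult intro!: AE_I2)
    qed
  qed
  finally have flux: "(LINT w:slab|lborel. hat (w$4) * level_flux F (tangent_part w) 0) = (LINT y:B|lborel. level_flux F y 0)"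
    by (simp add: integral_hat set_lebesgue_integral_def)
  have volume: "(\<lambda>k. LINT p|lborel. indicator N p * (smooth_step (- (g p $ 4) / \<delta> k) * divergence F p))
      \<longlonglongrightarrow> (LINT p:C|lborel. divergence F p)"
    unfolding set_lebesgue_integral_def
  proof (rule integral_dominated_convergence[where w = "\<lambda>p. norm (divergence F p)"])
    have "integrable lborel (divergence F)"
      by (rule integral_divergence_compact_support(1)[OF diff div Q(1) supp])
    then show "integrable lborel (\<lambda>p. norm (divergence F p))"
      by simp
    show "(\<lambda>p. indicator C p *\<^sub>R divergence F p) \<in> borel_measurable lborel"
      using C borel_measurable_continuous_onI[OF div] by simp
    show "(\<lambda>p. indicator N p * (smooth_step (- (g p $ 4) / \<delta> k) * divergence F p)) \<in> borel_measurable lborel" for k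
      using integrable_cutoff(1)[of "\<delta> k"] by (rule borel_measurable_integrable)
    show "AE p in lborel. norm (indicator N p * (smooth_step (- (g p $ 4) / \<delta> k) * divergence F p)) \<le> norm (divergence F p)" for k
      using smooth_step_bounds by (auto simp: indicator_def abs_mult intro!: AE_I2 mult_left_le_one_le)
    show "AE p in lborel. (\<lambda>k. indicator N p * (smooth_step (- (g p $ 4) / \<delta> k) * divergence F p))
        \<longlonglongrightarrow> indicator C p *\<^sub>R divergence F p"
    proof (rule AE_I2)
      fix p
      show "(\<lambda>k. indicator N p * (smooth_step (- (g p $ 4) / \<delta> k) * divergence F p)) \<longlonglongrightarrow> indicator C p *\<^sub>R divergence F p"
      proof (cases "p \<in> N")
        case False
        then have "divergence F p = 0"
          using divergence_outside Q(2) by blast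
        then show ?thesis by simp
      next
        case True
        have "(\<lambda>k. smooth_step (- (g p $ 4) / \<delta> k)) \<longlonglongrightarrow> indicator C p"
        proof (cases "g p $ 4 < 0")
          case neg: True
          have "\<forall>\<^sub>F k in sequentially. \<delta> k < - (g p $ 4)"
            using neg by (intro order_tendstoD[OF \<delta>_lim]) simp
          then have "\<forall>\<^sub>F k in sequentially. smooth_step (- (g p $ 4) / \<delta> k) = indicator C p"
          proof eventually_elim
            case (elim k)
            have "p \<in> C"
              using in_C_iff[OF True] neg by simp
            moreover have "- (g p $ 4) / \<delta> k \<ge> 1"
              using elim \<delta>(1)[of k] by (simp add: field_simps)
            ultimately show ?case
              using smooth_step_eq_1 by simp
          qed
          then show ?thesis
            by (rule tendsto_eventually)
        next
          case nonneg: False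
          \<comment> \<open>Height 0 belongs here: points of \<open>K\<close> lie outside
            \<open>C\<close>, and the cutoff is 0 at them for every width.\<close>
          then have "p \<notin> C"
            using in_C_iff[OF True] by simp
          moreover have "smooth_step (- (g p $ 4) / \<delta> k) = 0" for k
            using nonneg \<delta>(1)[of k] by (intro smooth_step_eq_0) (simp add: divide_nonpos_pos)
          ultimately show ?thesis by simp
        qed
        then have "(\<lambda>k. smooth_step (- (g p $ 4) / \<delta> k) * divergence F p) \<longlonglongrightarrow> indicator C p * divergence F p"
          by (intro tendsto_intros)
        then show ?thesis
          using True by simp
      qed
    qed
  qed
  \<comment> \<open>A Borel representative of the surface integrand on the whole space;
    \<open>n\<close> itself is arbitrary off \<open>K\<close>.\<close>
  define h where "h = (\<lambda>p. indicator K p * (indicator N p * (sgn (grad_height p) \<bullet> F p)))"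
  have h_\<phi>: "h (\<phi> y) = n (\<phi> y) \<bullet> F (\<phi> y)" if "y \<in> B" for y
    using \<phi>_in_K[OF that] \<phi>_in_N[OF that] normal_eq_sgn_grad_height[OF that] by (simp add: h_def)
  have h_eq: "indicator K p *\<^sub>R (n p \<bullet> F p) = h p" for p
  proof (cases "p \<in> K \<inter> N")
    case True
    then obtain y where "y \<in> B" "p = \<phi> y"
      using K_Int_N by blast
    then show ?thesis
      using h_\<phi> True by simp
  next
    case False
    then show ?thesis
      using subsetD[OF Q(2), of p] supp[of p] by (cases "p \<in> Q") (auto simp: h_def)
  qed
  have h_meas: "h \<in> borel_measurable borel"
  proof -
    have "continuous_on N (\<lambda>p. sgn (grad_height p) \<bullet> F p)"
      by (intro continuous_intros continuous_on_sgn_grad_height continuous_on_subset[OF continuous_on_F]) auto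
    then have "(\<lambda>p. indicator N p *\<^sub>R (sgn (grad_height p) \<bullet> F p)) \<in> borel_measurable borel"
      using open_N by (intro borel_measurable_continuous_on_indicator) auto
    then show ?thesis
      unfolding h_def using K by simp
  qed
  have "(LINT p:C|lborel. divergence F p) = (LINT y:B|lborel. level_flux F y 0)"
    using volume collar unfolding cutoff_identity[OF \<delta>(1)] collar_integral[OF \<delta>] flux
    by (rule LIMSEQ_unique)
  also have "\<dots> = (LINT y:B|lborel. area_density \<phi> y * h (\<phi> y))"
    unfolding set_lebesgue_integral_def
    by (intro Bochner_Integration.integral_cong) (auto simp: indicator_def level_flux_0 h_\<phi>)
  also have "\<dots> = (LINT p|surface_measure K. h p)"
    by (rule surface_integral_local[OF K h_meas, symmetric]) (auto simp: h_def indicator_def)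
  also have "\<dots> = (LINT p:K|surface_measure K. n p \<bullet> F p)"
    unfolding set_lebesgue_integral_def using h_eq by (intro Bochner_Integration.integral_cong) auto
  finally show ?thesis ..
qed

end

end

section \<open>The Fueter operator as a divergence\<close>

lemma partial_deriv_eq:
  assumes "f differentiable (at p)"
  shows "partial_deriv f e p = frechet_derivative f (at p) e"
proof -
  define D where "D = frechet_derivative f (at p)"
  have D: "(f has_derivative D) (at p)"
    using assms by (simp add: D_def flip: frechet_derivative_works)
  have "((\<lambda>h. p + h *\<^sub>R e) has_derivative (\<lambda>h. h *\<^sub>R e)) (at 0)"
    by (auto intro!: derivative_eq_intros)
  then have "((\<lambda>h. f (p + h *\<^sub>R e)) has_derivative (\<lambda>h. D (h *\<^sub>R e))) (at 0)"
    by (rule has_derivative_compose) (use D in simp)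
  then have "((\<lambda>h. f (p + h *\<^sub>R e)) has_vector_derivative D e) (at 0)"
    unfolding has_vector_derivative_def
    using linear_cmul[OF bounded_linear.linear[OF has_derivative_bounded_linear[OF D]]] by simp
  then show ?thesis
    unfolding partial_deriv_def D_def by (rule vector_derivative_at)
qed

lemma fueter_left_eq:
  assumes "f differentiable (at p)"
  shows "fueter_left f p = (\<Sum>b\<in>UNIV. axis b 1 \<odot> frechet_derivative f (at p) (axis b 1))"
  by (simp add: fueter_left_def partial_deriv_eq[OF assms] sum_4 qmult_one)

lemma qmult_sum_axis: "(\<Sum>b\<in>UNIV. axis b 1 \<odot> (d$b *\<^sub>R q)) = d \<odot> q"
  by (simp add: sum_4 quat_eq_iff qmult_def axis_def)

lemma qmult_scaleR_right: "p \<odot> (c *\<^sub>R q) = c *\<^sub>R (p \<odot> q)"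
  and qmult_scaleR_left: "(c *\<^sub>R p) \<odot> q = c *\<^sub>R (p \<odot> q)"
  and qmult_add_right: "p \<odot> (q + q') = p \<odot> q + p \<odot> q'"
  by (simp_all add: quat_eq_iff qmult_def algebra_simps)

text \<open>A real factor commutes with the units, so in the product rule they remain on the left
  and assemble the gradient of \<open>s\<close> into one quaternion.\<close>

lemma fueter_left_scaleR:
  assumes s: "(s has_derivative (\<lambda>v. d \<bullet> v)) (at p)" and f: "f differentiable (at p)"
  shows "(\<lambda>p. s p *\<^sub>R f p) differentiable (at p)"
    and "fueter_left (\<lambda>p. s p *\<^sub>R f p) p = s p *\<^sub>R fueter_left f p + d \<odot> f p"
proof -
  have "(f has_derivative frechet_derivative f (at p)) (at p)"
    using f by (simp flip: frechet_derivative_works)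
  with s have D: "((\<lambda>p. s p *\<^sub>R f p) has_derivative (\<lambda>v. s p *\<^sub>R frechet_derivative f (at p) v + (d \<bullet> v) *\<^sub>R f p)) (at p)"
    by (rule has_derivative_scaleR)
  then show diff: "(\<lambda>p. s p *\<^sub>R f p) differentiable (at p)"
    by (rule differentiableI)
  have "frechet_derivative (\<lambda>p. s p *\<^sub>R f p) (at p) (axis b 1) = s p *\<^sub>R frechet_derivative f (at p) (axis b 1) + d$b *\<^sub>R f p" for b
    unfolding frechet_derivative_at[OF D, symmetric] by (simp add: inner_axis)
  then show "fueter_left (\<lambda>p. s p *\<^sub>R f p) p = s p *\<^sub>R fueter_left f p + d \<odot> f p"
    unfolding fueter_left_eq[OF diff] fueter_left_eq[OF f]
    by (simp only: qmult_add_right sum.distrib qmult_sum_axis) (simp only: qmult_scaleR_right scaleR_sum_right)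
qed

lemma iota_nth: "iota p $ 1 = 0" "iota p $ 2 = p$2 / qr p" "iota p $ 3 = p$3 / qr p" "iota p $ 4 = p$4 / qr p"
  by (simp_all add: iota_def axis_def)

lemma qr_square: "(qr p)\<^sup>2 = (p$2)\<^sup>2 + (p$3)\<^sup>2 + (p$4)\<^sup>2"
  by (simp add: qr_def)

text \<open>The gradient of \<open>r\<close> is \<open>\<iota>\<close>. The computation goes through
  the polynomial \<open>r^2\<close> and so avoids differentiating the root.\<close>

lemma inverse_square_qr_derivative:
  assumes p: "p \<notin> real_axis"
  shows "((\<lambda>p. 1 / (qr p)\<^sup>2) has_derivative (\<lambda>v. (- (2 / qr p ^ 3) *\<^sub>R iota p) \<bullet> v)) (at p)"
proof -
  define \<rho> where "\<rho> = (p$2)\<^sup>2 + (p$3)\<^sup>2 + (p$4)\<^sup>2"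
  have r: "qr p > 0" and \<rho>: "\<rho> = (qr p)\<^sup>2"
    using qr_pos[OF p] by (auto simp: qr_square \<rho>_def)
  then have "\<rho> \<noteq> 0" by simp
  have "((\<lambda>p::quat. 1 / ((p$2)\<^sup>2 + (p$3)\<^sup>2 + (p$4)\<^sup>2)) has_derivative
      (\<lambda>v. - (2 * (p$2) * v$2 + 2 * (p$3) * v$3 + 2 * (p$4) * v$4) / \<rho>\<^sup>2)) (at p)"
    using \<open>\<rho> \<noteq> 0\<close> unfolding \<rho>_def
    by (auto intro!: derivative_eq_intros bounded_linear.has_derivative[OF bounded_linear_vec_nth]
        simp: fun_eq_iff field_simps power2_eq_square)
  moreover have "- (2 * (p$2) * v$2 + 2 * (p$3) * v$3 + 2 * (p$4) * v$4) / \<rho>\<^sup>2 = (- (2 / qr p ^ 3) *\<^sub>R iota p) \<bullet> v" for v :: quat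
    using r unfolding \<rho> by (simp add: inner_vec_def sum_4 iota_nth field_simps power2_eq_square power3_eq_cube)
  ultimately show ?thesis
    by (simp only: qr_square)
qed

text \<open>The origin of the weight: the equation for \<open>f\<close> contributes
  \<open>-2 v / r^3\<close>, and the gradient of the weight contributes
  \<open>(-2 / r^3) \<iota> (u + \<iota> v)\<close>, whose second part is \<open>2 v / r^3\<close>
  since \<open>\<iota>\<close> squares to -1. The terms in \<open>v\<close> cancel.\<close>

lemma fueter_left_weighted:
  assumes hyp: "hyperholomorphic_on U f u v" and p: "p \<in> U" "p \<notin> real_axis"
  shows "(\<lambda>p. (1 / (qr p)\<^sup>2) *\<^sub>R f p) differentiable (at p)"
    and "fueter_left (\<lambda>p. (1 / (qr p)\<^sup>2) *\<^sub>R f p) p = (- 2 * u p / qr p ^ 3) *\<^sub>R iota p"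
proof -
  have f: "f p = u p *\<^sub>R qone + v p *\<^sub>R iota p" "f differentiable (at p)"
    "fueter_left f p = (- 2 * v p / qr p) *\<^sub>R qone"
    using hyp p by (auto simp: hyperholomorphic_on_def complex_like_on_def)
  note w = fueter_left_scaleR[OF inverse_square_qr_derivative[OF p(2)] f(2)]
  show "(\<lambda>p. (1 / (qr p)\<^sup>2) *\<^sub>R f p) differentiable (at p)"
    by (rule w(1))
  have r: "qr p > 0"
    by (rule qr_pos[OF p(2)])
  have "(- (2 / qr p ^ 3) *\<^sub>R iota p) \<odot> f p = (- (2 / qr p ^ 3)) *\<^sub>R (u p *\<^sub>R iota p - v p *\<^sub>R qone)"
    unfolding f(1) qmult_scaleR_left qmult_add_right qmult_scaleR_right iota_iota[OF p(2)] qmult_one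
    by (simp add: scaleR_diff_right mult.commute)
  then show "fueter_left (\<lambda>p. (1 / (qr p)\<^sup>2) *\<^sub>R f p) p = (- 2 * u p / qr p ^ 3) *\<^sub>R iota p"
    unfolding w(2) f(3) using r
    by (simp add: quat_eq_iff iota_nth axis_def field_simps power2_eq_square power3_eq_cube)
qed

text \<open>Component \<open>l\<close> of the product \<open>n \<odot> f p\<close> is linear in
  \<open>n\<close>; this is the vector that represents it.\<close>

definition flux_field :: "(quat \<Rightarrow> quat) \<Rightarrow> 4 \<Rightarrow> quat \<Rightarrow> quat" where
  "flux_field f l p = (\<chi> b. (axis b 1 \<odot> f p) $ l)"

lemma inner_flux_field: "n \<bullet> flux_field f l p = (n \<odot> f p) $ l"
proof -
  have "n \<odot> f p = (\<Sum>b\<in>UNIV. axis b 1 \<odot> (n$b *\<^sub>R f p))"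
    by (rule qmult_sum_axis[symmetric])
  then show ?thesis
    by (simp add: flux_field_def inner_vec_def qmult_scaleR_right sum_component)
qed

lemma sum_Basis_vec:
  fixes f :: "real^'n \<Rightarrow> 'b::comm_monoid_add"
  shows "sum f Basis = (\<Sum>i\<in>UNIV. f (axis i 1))"
proof -
  have "Basis = (\<lambda>i::'n. axis i (1::real)) ` UNIV"
    by (auto simp: Basis_vec_def)
  moreover have "inj_on (\<lambda>i::'n. axis i (1::real)) UNIV"
    by (auto simp: inj_on_def axis_eq_axis)
  ultimately show ?thesis
    by (metis (no_types, lifting) sum.reindex_cong)
qed

text \<open>The flux density pairs the component \<open>n$b\<close> with the unit
  \<open>axis b 1\<close> acting from the left. Replacing \<open>n$b\<close> by the partial
  derivative in direction \<open>b\<close> produces the left Fueter operator.\<close>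

lemma divergence_flux_field:
  assumes f: "f differentiable (at p)"
  shows "flux_field f l differentiable (at p)" "divergence (flux_field f l) p = fueter_left f p $ l"
proof -
  define L where "L = (\<lambda>q. (\<chi> b. (axis b 1 \<odot> q) $ l) :: quat)"
  have "linear L"
    by (rule linearI) (simp_all add: L_def vec_eq_iff qmult_add_right qmult_scaleR_right)
  then have L: "bounded_linear L"
    by (rule linear_conv_bounded_linear[THEN iffD1])
  have "(f has_derivative frechet_derivative f (at p)) (at p)"
    using f by (simp flip: frechet_derivative_works)
  then have D: "(flux_field f l has_derivative (\<lambda>v. L (frechet_derivative f (at p) v))) (at p)"
    unfolding flux_field_def L_def[symmetric] using bounded_linear.has_derivative[OF L] by (simp add: L_def flux_field_def)
  then show "flux_field f l differentiable (at p)"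
    by (rule differentiableI)
  have "divergence (flux_field f l) p = (\<Sum>b\<in>Basis. L (frechet_derivative f (at p) b) \<bullet> b)"
    by (rule divergence_eqI[OF D])
  also have "\<dots> = (\<Sum>b\<in>UNIV. (axis b 1 \<odot> frechet_derivative f (at p) (axis b 1)) $ l)"
    by (simp add: sum_Basis_vec L_def inner_axis)
  also have "\<dots> = fueter_left f p $ l"
    by (simp add: fueter_left_eq[OF f] sum_component)
  finally show "divergence (flux_field f l) p = fueter_left f p $ l" .
qed

text \<open>The real axis is connected and misses \<open>K\<close>, so if it met \<open>C\<close> it
  would lie inside; but it is unbounded.\<close>

lemma real_axis_disjoint_bounded_component:
  assumes C: "C \<in> components (- K)" "bounded C" and K: "K \<inter> real_axis = {}"
  shows "C \<inter> real_axis = {}"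
proof (rule ccontr)
  assume meets: "C \<inter> real_axis \<noteq> {}"
  have axis: "real_axis = range (\<lambda>t. t *\<^sub>R qone)"
  proof (intro subset_antisym subsetI)
    fix p :: quat assume "p \<in> real_axis"
    then have "p = p$1 *\<^sub>R qone"
      by (simp add: real_axis_def quat_eq_iff axis_def)
    then show "p \<in> range (\<lambda>t. t *\<^sub>R qone)" by blast
  qed (auto simp: real_axis_def axis_def)
  have "connected real_axis"
    unfolding axis by (intro connected_continuous_image continuous_intros connected_UNIV)
  then have "real_axis \<subseteq> C"
    using K meets by (intro components_maximal[OF C(1)]) auto
  then have "bounded real_axis"
    using C(2) bounded_subset by blast
  then obtain M where M: "\<And>p. p \<in> real_axis \<Longrightarrow> norm p \<le> M"
    by (auto simp: bounded_iff)
  have "norm ((\<bar>M\<bar> + 1) *\<^sub>R qone) \<le> M"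
    by (rule M) (auto simp: axis)
  then show False by simp
qed

section \<open>The divergence theorem for the interior of a hypersurface\<close>

lemma set_integral_zero:
  fixes f :: "'a \<Rightarrow> real"
  assumes "\<And>x. x \<in> A \<Longrightarrow> f x = 0" shows "(LINT x:A|M. f x) = 0"
proof -
  have "(\<lambda>x. indicator A x *\<^sub>R f x) = (\<lambda>_. 0)"
    using assms by (auto simp: indicator_def fun_eq_iff)
  then show ?thesis
    by (simp only: set_lebesgue_integral_def) simp
qed

locale bounded_interior =
  fixes K C U :: "quat set" and n :: "quat \<Rightarrow> quat"
  assumes hypersurface: "smooth_closed_hypersurface K"
    and component: "C \<in> components (- K)" and bounded: "bounded C"
    and outer: "\<And>p. p \<in> K \<Longrightarrow> unit_outer_normal K C p (n p)"
    and open_U: "open U" and subset_U: "K \<union> C \<subseteq> U"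
begin

lemma compact_K: "compact K" and closed_K: "closed K"
  using hypersurface compact_imp_closed by (auto simp: smooth_closed_hypersurface_def)

lemma open_C: "open C"
  using component closed_K by (auto intro: open_components)

lemma compact_closure: "compact (K \<union> C)"
proof -
  have "frontier C \<subseteq> K"
    by (rule frontier_of_components_closed_complement[OF closed_K component])
  then have "closure C \<subseteq> K \<union> C"
    using closure_Un_frontier[of C] by blast
  then have "K \<union> C = K \<union> closure C"
    using closure_subset by blast
  then show ?thesis
    using compact_K bounded by (simp add: compact_Un)
qed

lemma chart_at:
  assumes "p \<in> K"
  obtains V \<phi> y0 a m N g g' where "normal_chart K C n V \<phi> y0 a m N g g'" "p \<in> N"
proof -
  obtain V \<phi> y where "(V, \<phi>) \<in> patches K" "y \<in> V" "p = \<phi> y"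
    using hypersurface assms unfolding smooth_closed_hypersurface_def by blast
  then show thesis
    using normal_chart_exists[OF component outer, of V \<phi> y] that by metis
qed

lemma sets_surface: "sets (surface_measure K) = sets borel"
  by (rule sets_surface_measure[OF hypersurface])

lemma emeasure_surface_finite: "emeasure (surface_measure K) K < \<infinity>"
proof -
  have "\<exists>N. open N \<and> p \<in> N \<and> emeasure (surface_measure K) (K \<inter> N) < \<infinity>" if p: "p \<in> K" for p
  proof -
    obtain V \<phi> y0 a m N g g' where *: "normal_chart K C n V \<phi> y0 a m N g g'" "p \<in> N"
      by (rule chart_at[OF p])
    then interpret normal_chart K C n V \<phi> y0 a m N g g'
      by simp
    show ?thesis
      using open_N emeasure_surface_finite[OF closed_K] *(2) by blast
  qed
  then obtain N where N: "\<And>p. p \<in> K \<Longrightarrow> open (N p)" "\<And>p. p \<in> K \<Longrightarrow> p \<in> N p"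
    "\<And>p. p \<in> K \<Longrightarrow> emeasure (surface_measure K) (K \<inter> N p) < \<infinity>"
    by metis
  obtain P where P: "P \<subseteq> K" "finite P" "K \<subseteq> (\<Union>p\<in>P. N p)"
    using compactE_image[OF compact_K, of K N] N by blast
  have "emeasure (surface_measure K) K = emeasure (surface_measure K) (\<Union>p\<in>P. K \<inter> N p)"
    using P(3) by (intro arg_cong[where f = "emeasure (surface_measure K)"]) auto
  also have "\<dots> \<le> (\<Sum>p\<in>P. emeasure (surface_measure K) (K \<inter> N p))"
    using P N(1) closed_K by (intro emeasure_subadditive_finite) (auto simp: sets_surface)
  also have "\<dots> < \<infinity>"
    using P N(3) by (auto simp: less_top[symmetric] ennreal_sum_eq_top)
  finally show ?thesis .
qed

lemma continuous_on_normal: "continuous_on K n"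
proof (rule continuous_on_eq_continuous_within[THEN iffD2, rule_format])
  fix p assume p: "p \<in> K"
  obtain V \<phi> y0 a m N g g' where *: "normal_chart K C n V \<phi> y0 a m N g g'" "p \<in> N"
    by (rule chart_at[OF p])
  then interpret normal_chart K C n V \<phi> y0 a m N g g'
    by simp
  have eq: "n q = sgn (grad_height q)" if "q \<in> K \<inter> N" for q
    using that K_Int_N normal_eq_sgn_grad_height by auto
  have "continuous_on (K \<inter> N) n"
    using continuous_on_subset[OF continuous_on_sgn_grad_height Int_lower2]
    by (rule continuous_on_eq) (use eq in auto)
  then have "continuous (at p within K \<inter> N) n"
    using p *(2) by (simp add: continuous_on_eq_continuous_within)
  moreover have "at p within K = at p within K \<inter> N"
    by (rule at_within_nhd[OF *(2) open_N]) auto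
  ultimately show "continuous (at p within K) n"
    by simp
qed

lemma surface_integrable:
  fixes h :: "quat \<Rightarrow> 'b::{banach, second_countable_topology}"
  assumes "continuous_on K h"
  shows "set_integrable (surface_measure K) K h"
proof -
  obtain M where M: "\<And>p. p \<in> K \<Longrightarrow> norm (h p) \<le> M"
    using compact_imp_bounded[OF compact_continuous_image[OF assms compact_K]]
    by (auto simp: bounded_iff)
  show ?thesis
    unfolding set_integrable_def
  proof (rule integrableI_bounded_set[where A = K and B = M])
    show "(\<lambda>p. indicat_real K p *\<^sub>R h p) \<in> borel_measurable (surface_measure K)"
      using borel_measurable_continuous_on_indicator[OF _ assms] closed_K
      by (simp cong: measurable_cong_sets add: sets_surface)
  qed (use closed_K sets_surface M emeasure_surface_finite in \<open>auto simp: indicator_def\<close>)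
qed

lemma interior_integrable:
  fixes h :: "quat \<Rightarrow> 'b::{banach, second_countable_topology}"
  assumes "continuous_on U h"
  shows "set_integrable lborel C h"
proof (rule set_integrable_subset)
  show "set_integrable lborel (K \<union> C) h"
    unfolding set_integrable_def
    by (intro borel_integrable_compact compact_closure continuous_on_subset[OF assms subset_U])
qed (use open_C in auto)

text \<open>Only the divergence is asked to be continuous, not the derivative; this is the
  regularity that the flux fields of a hyperholomorphic function have.\<close>

definition regular_field :: "(quat \<Rightarrow> quat) \<Rightarrow> bool" where
  "regular_field F \<longleftrightarrow> (\<forall>p\<in>U. F differentiable (at p)) \<and> continuous_on U (divergence F)"

definition flux_balance :: "(quat \<Rightarrow> quat) \<Rightarrow> bool" where
  "flux_balance F \<longleftrightarrow> (LINT p:K|surface_measure K. n p \<bullet> F p) = (LINT p:C|lborel. divergence F p)"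

lemma regular_field_continuous:
  assumes "regular_field F" shows "continuous_on U F"
  using assms by (intro differentiable_at_imp_continuous_on) (simp add: regular_field_def)

lemma regular_field_global:
  assumes F: "regular_field F" and Q: "closed Q" "Q \<subseteq> U" and supp: "\<And>p. p \<notin> Q \<Longrightarrow> F p = 0"
  shows "F differentiable (at p)" "continuous_on UNIV (divergence F)"
proof -
  have D: "(F has_derivative (\<lambda>_. 0)) (at x)" "frechet_derivative F (at x) = (\<lambda>_. 0)" if "x \<notin> Q" for x
    using frechet_derivative_eq_0_outside[OF Q(1) _ that, of F] supp by auto
  show "F differentiable (at p)"
  proof (cases "p \<in> U")
    case True
    then show ?thesis using F by (simp add: regular_field_def)
  next
    case False
    then have "p \<notin> Q" using Q(2) by blast
    then show ?thesis by (rule differentiableI[OF D(1)])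
  qed
  have "continuous_on (- Q) (divergence F)"
    by (rule continuous_on_eq[OF continuous_on_const[of _ 0]]) (simp add: divergence_def D(2))
  then have "continuous_on (U \<union> - Q) (divergence F)"
    using F open_U Q(1) by (intro continuous_on_open_Un) (auto simp: regular_field_def)
  moreover have "U \<union> - Q = UNIV"
    using Q(2) by blast
  ultimately show "continuous_on UNIV (divergence F)"
    by simp
qed

text \<open>Around a point of \<open>C\<close> a small ball stays away from \<open>K\<close>, and
  both integrals are zero. Around a point of \<open>K\<close> the ball is chosen inside a
  chart.\<close>

lemma flux_balance_local:
  assumes p: "p \<in> K \<union> C"
  shows "\<exists>\<rho>>0. \<forall>F. regular_field F \<longrightarrow> (\<forall>x. x \<notin> cball p \<rho> \<longrightarrow> F x = 0) \<longrightarrow> flux_balance F"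
proof (cases "p \<in> C")
  case True
  then obtain \<rho> where \<rho>: "\<rho> > 0" "cball p \<rho> \<subseteq> C"
    using open_C by (auto simp: open_contains_cball)
  have "flux_balance F" if F: "regular_field F" and supp: "\<And>x. x \<notin> cball p \<rho> \<Longrightarrow> F x = 0" for F
  proof -
    have sub: "cball p \<rho> \<subseteq> U"
      using \<rho> subset_U by blast
    have glob: "F differentiable (at x)" "continuous_on UNIV (divergence F)" for x
      using regular_field_global[OF F closed_cball sub] supp by auto
    have "divergence F x = 0" if "x \<notin> C" for x
    proof -
      have xQ: "x \<notin> cball p \<rho>"
        using that \<rho>(2) by blast
      show ?thesis
        using frechet_derivative_eq_0_outside(2)[OF closed_cball _ xQ, of F] supp
        by (simp add: divergence_def)
    qed
    then have "(\<lambda>x. indicat_real C x *\<^sub>R divergence F x) = divergence F"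
      by (intro ext) (auto simp: indicator_def)
    then have "(LINT p:C|lborel. divergence F p) = 0"
      unfolding set_lebesgue_integral_def
      using integral_divergence_compact_support(2)[OF glob compact_cball, of p \<rho>] supp by simp
    moreover have "F x = 0" if "x \<in> K" for x
    proof -
      have "x \<notin> C"
        using that in_components_subset[OF component] by blast
      then show ?thesis
        using \<rho>(2) supp by blast
    qed
    then have "(LINT p:K|surface_measure K. n p \<bullet> F p) = 0"
      by (intro set_integral_zero) simp
    ultimately show ?thesis
      by (simp add: flux_balance_def)
  qed
  then show ?thesis
    using \<rho>(1) by blast
next
  case False
  then have pK: "p \<in> K"
    using p by blast
  obtain V \<phi> y0 a m N g g' where *: "normal_chart K C n V \<phi> y0 a m N g g'" "p \<in> N"
    by (rule chart_at[OF pK])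
  then interpret normal_chart K C n V \<phi> y0 a m N g g'
    by simp
  have "open (N \<inter> U)" "p \<in> N \<inter> U"
    using open_N open_U *(2) pK subset_U by auto
  then obtain \<rho> where \<rho>: "\<rho> > 0" "cball p \<rho> \<subseteq> N \<inter> U"
    by (meson open_contains_cball)
  have "flux_balance F" if F: "regular_field F" and supp: "\<And>x. x \<notin> cball p \<rho> \<Longrightarrow> F x = 0" for F
  proof -
    have sub: "cball p \<rho> \<subseteq> U" "cball p \<rho> \<subseteq> N"
      using \<rho> by auto
    have glob: "F differentiable (at x)" "continuous_on UNIV (divergence F)" for x
      using regular_field_global[OF F closed_cball sub(1)] supp by auto
    have "C \<in> sets borel"
      using open_C by simp
    then show ?thesis
      unfolding flux_balance_def
      using local_divergence_theorem[OF glob compact_cball sub(2) _ closed_K] supp by blast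
  qed
  then show ?thesis
    using \<rho>(1) by blast
qed

lemma flux_balance_zero:
  assumes "\<And>x. x \<in> K \<union> C \<Longrightarrow> F x = 0"
  shows "flux_balance F"
proof -
  have "divergence F x = 0" if x: "x \<in> C" for x
  proof -
    have "divergence F x = divergence (\<lambda>_. 0) x"
      by (rule divergence_cong_open(2)[OF open_C x]) (use assms in auto)
    also have "\<dots> = 0"
      by (simp add: divergence_def)
    finally show ?thesis .
  qed
  then show ?thesis
    using assms by (simp add: flux_balance_def set_integral_zero)
qed

lemma flux_balance_add:
  assumes F: "regular_field F" and G: "regular_field G" and "flux_balance F" "flux_balance G"
    and sum: "\<And>x. H x = F x + G x"
  shows "flux_balance H"
proof -
  have H: "H = (\<lambda>x. F x + G x)"
    using sum by auto
  have "divergence H x = divergence F x + divergence G x" if "x \<in> C" for x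
  proof -
    have "F differentiable (at x)" "G differentiable (at x)"
      using that F G subset_U by (auto simp: regular_field_def)
    then have "(H has_derivative (\<lambda>v. frechet_derivative F (at x) v + frechet_derivative G (at x) v)) (at x)"
      unfolding H by (intro has_derivative_add) (simp_all flip: frechet_derivative_works)
    from divergence_eqI[OF this] show ?thesis
      by (simp add: divergence_def inner_add_left sum.distrib)
  qed
  then have "(LINT p:C|lborel. divergence H p) = (LINT p:C|lborel. divergence F p + divergence G p)"
    using open_C by (intro set_lebesgue_integral_cong) auto
  also have "\<dots> = (LINT p:C|lborel. divergence F p) + (LINT p:C|lborel. divergence G p)"
    using F G by (intro set_integral_add interior_integrable) (auto simp: regular_field_def)
  finally have 1: "(LINT p:C|lborel. divergence H p) = (LINT p:C|lborel. divergence F p) + (LINT p:C|lborel. divergence G p)" .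
  have cont: "continuous_on K (\<lambda>p. n p \<bullet> F p)" "continuous_on K (\<lambda>p. n p \<bullet> G p)"
    using regular_field_continuous[OF F] regular_field_continuous[OF G] subset_U
    by (auto intro!: continuous_intros continuous_on_normal elim: continuous_on_subset)
  have "(LINT p:K|surface_measure K. n p \<bullet> H p) = (LINT p:K|surface_measure K. n p \<bullet> F p + n p \<bullet> G p)"
    by (simp add: H inner_add_right)
  also have "\<dots> = (LINT p:K|surface_measure K. n p \<bullet> F p) + (LINT p:K|surface_measure K. n p \<bullet> G p)"
    using cont by (intro set_integral_add surface_integrable)
  finally show ?thesis
    using 1 assms(3,4) by (simp add: flux_balance_def)
qed

section \<open>Bump functions and globalization\<close>

lemma smooth_bump:
  assumes "\<rho> > 0"
  obtains \<beta> d :: "quat \<Rightarrow> _" where "\<And>x. (\<beta> has_derivative (\<lambda>v. d x \<bullet> v)) (at x)" "continuous_on UNIV d"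
    "\<And>x. x \<in> cball p (\<rho> / 2) \<Longrightarrow> \<beta> x = (1::real)" "\<And>x. x \<notin> cball p \<rho> \<Longrightarrow> \<beta> x = 0"
proof -
  \<comment> \<open>Normalizes \<open>q\<close> to equal 1 at distance \<open>\<rho> / 2\<close>
    from \<open>p\<close>, where the bracket is \<open>3 * \<rho>\<^sup>2 / 4\<close>; at distance
    \<open>\<rho>\<close> it vanishes.\<close>
  define c where "c = 4 / (3 * \<rho>\<^sup>2)"
  have c: "c > 0"
    using assms by (simp add: c_def)
  define q where "q = (\<lambda>x. c * (\<rho>\<^sup>2 - (x - p) \<bullet> (x - p)))"
  define d where "d = (\<lambda>x. (hat (q x) * (- 2 * c)) *\<^sub>R (x - p))"
  have qd: "(q has_derivative (\<lambda>v. - 2 * c * ((x - p) \<bullet> v))) (at x)" for x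
    unfolding q_def by (auto intro!: derivative_eq_intros simp: fun_eq_iff inner_commute algebra_simps)
  show thesis
  proof (rule that[of "\<lambda>x. smooth_step (q x)" d])
    show "((\<lambda>x. smooth_step (q x)) has_derivative (\<lambda>v. d x \<bullet> v)) (at x)" for x
    proof -
      have "((\<lambda>x. smooth_step (q x)) has_derivative (\<lambda>v. hat (q x) * (- 2 * c * ((x - p) \<bullet> v)))) (at x)"
        by (rule has_derivative_compose[OF qd])
          (use DERIV_smooth_step[of "q x"] in \<open>simp add: has_field_derivative_def\<close>)
      then show ?thesis
        by (rule has_derivative_eq_rhs) (auto simp: d_def fun_eq_iff)
    qed
    show "continuous_on UNIV d"
      unfolding d_def q_def by (intro continuous_intros)
    have norm: "(x - p) \<bullet> (x - p) = (dist p x)\<^sup>2" for x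
      by (simp add: dist_norm norm_minus_commute[of p x] power2_norm_eq_inner)
    show "smooth_step (q x) = 1" if "x \<in> cball p (\<rho> / 2)" for x
    proof (rule smooth_step_eq_1)
      have "(dist p x)\<^sup>2 \<le> (\<rho> / 2)\<^sup>2"
        using that by (intro power_mono) auto
      then have "\<rho>\<^sup>2 - (x - p) \<bullet> (x - p) \<ge> 3 * \<rho>\<^sup>2 / 4"
        by (simp add: norm power_divide)
      then have "c * (\<rho>\<^sup>2 - (x - p) \<bullet> (x - p)) \<ge> c * (3 * \<rho>\<^sup>2 / 4)"
        using c by (intro mult_left_mono) auto
      then show "1 \<le> q x"
        using assms by (simp add: q_def c_def)
    qed
    show "smooth_step (q x) = 0" if "x \<notin> cball p \<rho>" for x
    proof (rule smooth_step_eq_0)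
      have "\<rho>\<^sup>2 \<le> (dist p x)\<^sup>2"
        using that assms by (intro power_mono) auto
      then show "q x \<le> 0"
        using c by (simp add: q_def norm mult_nonneg_nonpos)
    qed
  qed
qed

lemma regular_field_scaleR:
  assumes F: "regular_field F" and h: "\<And>x. (h has_derivative (\<lambda>v. d x \<bullet> v)) (at x)" and d: "continuous_on UNIV d"
  shows "regular_field (\<lambda>x. h x *\<^sub>R F x)"
  unfolding regular_field_def
proof (intro conjI ballI)
  have diff: "F differentiable (at x)" if "x \<in> U" for x
    using F that by (simp add: regular_field_def)
  show "(\<lambda>x. h x *\<^sub>R F x) differentiable (at x)" if "x \<in> U" for x
    by (rule divergence_scaleR(1)[OF h diff[OF that]])
  have "continuous_on UNIV h"
    using h by (meson continuous_at_imp_continuous_on has_derivative_continuous)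
  then have "continuous_on U (\<lambda>x. h x * divergence F x + d x \<bullet> F x)"
    using F continuous_on_subset[OF d subset_UNIV] regular_field_continuous[OF F]
    by (intro continuous_intros) (auto simp: regular_field_def elim: continuous_on_subset)
  then show "continuous_on U (divergence (\<lambda>x. h x *\<^sub>R F x))"
    by (rule continuous_on_eq) (simp add: divergence_scaleR(2)[OF h diff])
qed

text \<open>Balls are peeled off one at a time in place of a partition of unity. For the ball at
  \<open>p\<close>, the field \<open>\<beta> F\<close> is balanced by the local result, and
  \<open>(1 - \<beta>) F\<close> vanishes on the half ball, so one ball fewer has to be covered. The
  cover uses half radii because the bump equals 1 only there.\<close>

theorem flux_balance_regular_field:
  assumes "regular_field F" shows "flux_balance F"
proof -
  obtain \<rho> where \<rho>: "\<And>p. p \<in> K \<union> C \<Longrightarrow> \<rho> p > 0"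
    "\<And>p F. p \<in> K \<union> C \<Longrightarrow> regular_field F \<Longrightarrow> (\<And>x. x \<notin> cball p (\<rho> p) \<Longrightarrow> F x = 0) \<Longrightarrow> flux_balance F"
    using flux_balance_local by metis
  have cover: "flux_balance F"
    if "finite P" "P \<subseteq> K \<union> C" "regular_field F" "\<And>x. x \<in> K \<union> C \<Longrightarrow> x \<notin> (\<Union>p\<in>P. ball p (\<rho> p / 2)) \<Longrightarrow> F x = 0" for P F
    using that
  proof (induction P arbitrary: F rule: finite_induct)
    case empty
    then show ?case
      by (intro flux_balance_zero) auto
  next
    case (insert p P)
    have p: "p \<in> K \<union> C"
      using insert.prems by simp
    obtain \<beta> d where \<beta>: "\<And>x. (\<beta> has_derivative (\<lambda>v. d x \<bullet> v)) (at x)" "continuous_on UNIV d"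
      "\<And>x. x \<in> cball p (\<rho> p / 2) \<Longrightarrow> \<beta> x = (1::real)" "\<And>x. x \<notin> cball p (\<rho> p) \<Longrightarrow> \<beta> x = 0"
      using smooth_bump[OF \<rho>(1)[OF p]] by metis
    have compl: "((\<lambda>x. 1 - \<beta> x) has_derivative (\<lambda>v. - d x \<bullet> v)) (at x)" for x
      using has_derivative_diff[OF has_derivative_const \<beta>(1), of 1 x] by simp
    have reg: "regular_field (\<lambda>x. \<beta> x *\<^sub>R F x)" "regular_field (\<lambda>x. (1 - \<beta> x) *\<^sub>R F x)"
      using insert.prems \<beta>(2) by (auto intro!: regular_field_scaleR[OF _ \<beta>(1)] regular_field_scaleR[OF _ compl] continuous_intros)
    have "flux_balance (\<lambda>x. \<beta> x *\<^sub>R F x)"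
      by (rule \<rho>(2)[OF p reg(1)]) (simp add: \<beta>(4))
    moreover have "flux_balance (\<lambda>x. (1 - \<beta> x) *\<^sub>R F x)"
    proof (rule insert.IH[OF _ reg(2)])
      fix x assume x: "x \<in> K \<union> C" "x \<notin> (\<Union>p\<in>P. ball p (\<rho> p / 2))"
      show "(1 - \<beta> x) *\<^sub>R F x = 0"
      proof (cases "x \<in> ball p (\<rho> p / 2)")
        case True
        then show ?thesis
          using \<beta>(3)[of x] by simp
      next
        case False
        then show ?thesis
          using insert.prems(3)[of x] x by simp
      qed
    qed (use insert.prems in auto)
    ultimately show ?case
      by (rule flux_balance_add[OF reg]) (simp flip: scaleR_add_left)
  qed
  have "K \<union> C \<subseteq> (\<Union>p\<in>K \<union> C. ball p (\<rho> p / 2))"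
    using \<rho>(1) by force
  then obtain P where "P \<subseteq> K \<union> C" "finite P" "K \<union> C \<subseteq> (\<Union>p\<in>P. ball p (\<rho> p / 2))"
    using compactE_image[OF compact_closure, of "K \<union> C" "\<lambda>p. ball p (\<rho> p / 2)"] by auto
  then show ?thesis
    using assms by (intro cover[of P]) auto
qed

end

lemma set_integral_component:
  fixes h :: "'a \<Rightarrow> real^'n"
  assumes "set_integrable M A h"
  shows "(LINT x:A|M. h x) $ l = (LINT x:A|M. h x $ l)"
  using integral_bounded_linear[OF bounded_linear_vec_nth assms[unfolded set_integrable_def], of l]
  by (simp add: set_lebesgue_integral_def)

lemma closed_real_axis: "closed real_axis"
proof -
  have "closed ({p::quat. p$2 = 0} \<inter> {p. p$3 = 0} \<inter> {p. p$4 = 0})"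
    by (intro closed_Int closed_Collect_eq continuous_intros)
  moreover have "real_axis = {p. p$2 = 0} \<inter> {p. p$3 = 0} \<inter> {p. p$4 = 0}"
    by (auto simp: real_axis_def)
  ultimately show ?thesis
    by (simp only:)
qed

lemma continuous_on_iota:
  assumes "S \<inter> real_axis = {}"
  shows "continuous_on S qr" "continuous_on S iota"
proof -
  have nz: "qr p \<noteq> 0" if "p \<in> S" for p
    using qr_pos[of p] assms that by (metis disjoint_iff less_irrefl)
  show qr: "continuous_on S qr"
    unfolding qr_def by (intro continuous_intros)
  show "continuous_on S iota"
    unfolding iota_def using nz by (intro continuous_intros qr) auto
qed

theorem proposition4:
  fixes f n :: "quat \<Rightarrow> quat" and u v :: "quat \<Rightarrow> real" and U K Kstar :: "quat set"
  assumes "smooth_closed_hypersurface K"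
    and "K \<inter> real_axis = {}"
    and "Kstar \<in> components (- K)" and "bounded Kstar"
    and "open U" and "K \<union> Kstar \<subseteq> U"
    and "hyperholomorphic_on U f u v"
    and "\<forall>p\<in>K. unit_outer_normal K Kstar p (n p)"
  shows "(LINT p:K|surface_measure K. (1 / (qr p)\<^sup>2) *\<^sub>R (n p \<odot> f p)) =
         - 2 *\<^sub>R (LINT p:Kstar|lborel. (u p / qr p ^ 3) *\<^sub>R iota p)"
proof -
  \<comment> \<open>Hyperholomorphy says nothing at real points. Removing the closed axis leaves an
    open set that still contains \<open>K\<close> and its interior, both of which avoid the
    axis.\<close>
  define U' where "U' = U - real_axis"
  have U': "open U'" "K \<union> Kstar \<subseteq> U'" "U' \<inter> real_axis = {}"
    using assms(2,5,6) real_axis_disjoint_bounded_component[OF assms(3,4,2)] closed_real_axis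
    by (auto simp: U'_def)
  interpret bounded_interior K Kstar U' n
    using assms(1,3,4,8) U'(1,2) by (simp add: bounded_interior_def)
  define g where "g = (\<lambda>p. (1 / (qr p)\<^sup>2) *\<^sub>R f p)"
  define w where "w = (\<lambda>p. (u p / qr p ^ 3) *\<^sub>R iota p)"
  have g: "g differentiable (at p)" "fueter_left g p = - 2 *\<^sub>R w p" if "p \<in> U'" for p
    using fueter_left_weighted[OF assms(7), of p] that by (auto simp: g_def w_def U'_def)
  have nz: "qr p \<noteq> 0" if "p \<in> U'" for p
    using qr_pos[of p] that by (auto simp: U'_def)
  have w: "continuous_on U' w"
  proof -
    have f: "f p = u p *\<^sub>R qone + v p *\<^sub>R iota p" "f differentiable (at p)" if "p \<in> U'" for p
      using assms(7) that by (auto simp: hyperholomorphic_on_def complex_like_on_def U'_def)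
    have "continuous_on U' f"
      by (rule differentiable_at_imp_continuous_on[OF f(2)])
    then have "continuous_on U' (\<lambda>p. f p $ 1)"
      by (intro continuous_intros)
    \<comment> \<open>\<open>\<iota>\<close> has no real part, so \<open>u\<close> is the first
      component of \<open>f\<close> and inherits its continuity.\<close>
    then have "continuous_on U' u"
      by (rule continuous_on_eq) (simp add: f(1) iota_nth axis_def)
    then show ?thesis
      unfolding w_def using nz by (intro continuous_intros continuous_on_iota U') auto
  qed
  have g_cont: "continuous_on K g"
    using g(1) U'(2) by (intro differentiable_at_imp_continuous_on) auto
  have ng: "continuous_on K (\<lambda>p. n p \<odot> g p)"
    by (rule bounded_bilinear.continuous_on[OF bilinear_conv_bounded_bilinear[THEN iffD1, OF bilinear_qmult]
          continuous_on_normal g_cont])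
  have "(LINT p:K|surface_measure K. n p \<odot> g p) $ l = (- 2 *\<^sub>R (LINT p:Kstar|lborel. w p)) $ l" for l
  proof -
    have div: "divergence (flux_field g l) p = - 2 * w p $ l" if "p \<in> U'" for p
      using divergence_flux_field(2)[OF g(1)[OF that]] g(2)[OF that] by simp
    have "continuous_on U' (\<lambda>p. - 2 * w p $ l)"
      by (intro continuous_intros w)
    then have "continuous_on U' (divergence (flux_field g l))"
      by (rule continuous_on_eq) (simp add: div)
    then have "regular_field (flux_field g l)"
      using divergence_flux_field(1)[OF g(1)] by (auto simp: regular_field_def)
    then have "flux_balance (flux_field g l)"
      by (rule flux_balance_regular_field)
    then have "(LINT p:K|surface_measure K. (n p \<odot> g p) $ l) = (LINT p:Kstar|lborel. divergence (flux_field g l) p)"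
      by (simp add: flux_balance_def inner_flux_field)
    also have "\<dots> = (LINT p:Kstar|lborel. - 2 * w p $ l)"
      using open_C U'(2) div by (intro set_lebesgue_integral_cong) auto
    also have "\<dots> = - 2 * (LINT p:Kstar|lborel. w p $ l)"
      by (rule set_integral_mult_right)
    \<comment> \<open>Both quaternionic integrands are integrable, by continuity of the normal and
      compactness, so taking a component commutes with integration.\<close>
    finally show ?thesis
      using set_integral_component[OF surface_integrable[OF ng], of l]
        set_integral_component[OF interior_integrable[OF w], of l] by simp
  qed
  then have "(LINT p:K|surface_measure K. n p \<odot> g p) = - 2 *\<^sub>R (LINT p:Kstar|lborel. w p)"
    by (simp add: vec_eq_iff)
  then show ?thesis
    by (simp add: g_def w_def qmult_scaleR_right)
qed

end
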